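(* The subscheme $R\subset\mathrm{Gr}(2,\mathbb{S}^\vee)$ is a divisor which is cut out (on $\mathrm{Gr}(2,\mathbb{S}^\vee)$ in its Plücker embedding) by a smooth quadric in $\mathbb{P}(\wedge^2\mathbb{S}^\vee)$.
   Context: The base field is algebraically closed of characteristic zero. $V$ is a 10-dimensional vector space with a nondegenerate quadratic form; $\mathrm{OGr}_\pm(5,V)$ are the two connected components of the Grassmannian of isotropic 5-dimensional subspaces; $\mathbb{S}$, $\mathbb{S}^\vee$ are the two (mutually dual, 16-dimensional) half-spinor representations of $\mathrm{Spin}(V)$. $X=\mathrm{OGr}_+(5,V)\subset\mathbb{P}(\mathbb{S})$ and its projective dual $X^\vee=\mathrm{OGr}_-(5,V)\subset\mathbb{P}(\mathbb{S}^\vee)$ are embedded by the ample generators of their Picard groups. For a 2-dimensional $K\subset\mathbb{S}^\vee$ with annihilator $K^\perp\subset\mathbb{S}$, $X_K=X\times_{\mathbb{P}(\mathbb{S})}\mathbb{P}(K^\perp)$; it is smooth of codimension 2 in $X$ iff $\mathbb{P}(K)\cap X^\vee=\varnothing$. A smooth codimension-2 section $X_K$ is called special if it contains a linear 4-space $\mathbb{P}^4\subset\mathbb{P}(\mathbb{S})$. $R_0\subset\mathrm{Gr}(2,\mathbb{S}^\vee)$ is the set of $[K]$ with $\mathbb{P}(K)\cap X^\vee=\varnothing$ and $X_K$ special (it is a $\mathrm{Spin}(V)$-orbit, closed in the open subset $\{\mathbb{P}(K)\cap X^\vee=\varnothing\}$), and $R$ is the closure of $R_0$ in $\mathrm{Gr}(2,\mathbb{S}^\vee)$.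 *)

theory Defs
  imports "HOL-Analysis.Analysis" "HOL-Computational_Algebra.Computational_Algebra"
begin

section \<open>Zariski topology, irreducible components, codimension\<close>

definition irreducible_closed :: "'a topology \<Rightarrow> 'a set \<Rightarrow> bool" where
  "irreducible_closed T Z \<longleftrightarrow> closedin T Z \<and> Z \<noteq> {} \<and>
     (\<forall>A B. closedin T A \<longrightarrow> closedin T B \<longrightarrow> Z \<subseteq> A \<union> B \<longrightarrow> Z \<subseteq> A \<or> Z \<subseteq> B)"

definition irreducible_component_of :: "'a topology \<Rightarrow> 'a set \<Rightarrow> 'a set \<Rightarrow> bool" where
  "irreducible_component_of T D Z \<longleftrightarrow> irreducible_closed T Z \<and> Z \<subseteq> D \<and>
     (\<forall>Z'. irreducible_closed T Z' \<longrightarrow> Z \<subseteq> Z' \<longrightarrow> Z' \<subseteq> D \<longrightarrow> Z' = Z)"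

text \<open>Codimension of an irreducible closed subset: the supremum of the lengths of strictly
  increasing chains of irreducible closed sets that start with it.\<close>

definition codim :: "'a topology \<Rightarrow> 'a set \<Rightarrow> enat" where
  "codim T Z = Sup {enat n | n. \<exists>C :: nat \<Rightarrow> 'a set. C 0 = Z \<and>
     (\<forall>i\<le>n. irreducible_closed T (C i)) \<and> (\<forall>i<n. C i \<subset> C (Suc i))}"

text \<open>A (nonzero, reduced, effective) divisor: a closed subset of pure codimension one.\<close>

definition divisor :: "'a topology \<Rightarrow> 'a set \<Rightarrow> bool" where
  "divisor T D \<longleftrightarrow> closedin T D \<and> D \<noteq> {} \<and>
     (\<forall>Z. irreducible_component_of T D Z \<longrightarrow> codim T Z = 1)"

text \<open>Polynomial functions in the coordinates. They are only used over infinite fields, where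
  they are the same thing as polynomials.\<close>

inductive_set poly_fun :: "('k::field ^ 'n \<Rightarrow> 'k) set" where
  const: "(\<lambda>w. c) \<in> poly_fun"
| coord: "(\<lambda>w. w $ i) \<in> poly_fun"
| add: "P \<in> poly_fun \<Longrightarrow> P' \<in> poly_fun \<Longrightarrow> (\<lambda>w. P w + P' w) \<in> poly_fun"
| mult: "P \<in> poly_fun \<Longrightarrow> P' \<in> poly_fun \<Longrightarrow> (\<lambda>w. P w * P' w) \<in> poly_fun"

definition hom_poly :: "nat \<Rightarrow> ('k::field ^ 'n \<Rightarrow> 'k) set" where
  "hom_poly d = {P \<in> poly_fun. \<forall>a w. P (a *s w) = a ^ d * P w}"

definition grass :: "nat \<Rightarrow> ('k::field ^ 'n) set \<Rightarrow> ('k ^ 'n) set set" where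
  "grass r W = {K. vec.subspace K \<and> K \<subseteq> W \<and> vec.dim K = r}"

text \<open>The projective space of \<open>W\<close> is the set of lines in \<open>W\<close>.\<close>

abbreviation proj :: "('k::field ^ 'n) set \<Rightarrow> ('k ^ 'n) set set" where
  "proj W \<equiv> grass 1 W"

definition zariski_proj :: "('k::field ^ 'n) set \<Rightarrow> ('k ^ 'n) set topology" where
  "zariski_proj W = topology_generated_by
     {{l \<in> proj W. \<exists>w\<in>l. P w \<noteq> 0} | P d. P \<in> hom_poly d}"

section \<open>The Grassmannian of lines in its Pluecker embedding\<close>

text \<open>\<open>E \<otimes> E\<close> has coordinates indexed by pairs, and the exterior square is the space of
  skew tensors in it (characteristic zero).\<close>

definition wedge :: "'k::field ^ 'n \<Rightarrow> 'k ^ 'n \<Rightarrow> 'k ^ ('n::finite \<times> 'n)" where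
  "wedge f g = (\<chi> p. f $ fst p * g $ snd p - f $ snd p * g $ fst p)"

definition ext2 :: "('k::field ^ ('n::finite \<times> 'n)) set" where
  "ext2 = vec.span {wedge f g | f g. True}"

definition pluecker :: "('k::field ^ 'n) set \<Rightarrow> ('k ^ ('n::finite \<times> 'n)) set" where
  "pluecker K = vec.span {wedge f g | f g. f \<in> K \<and> g \<in> K}"

definition zariski_gr2 :: "('k::field ^ 'n) set topology" where
  "zariski_gr2 = pullback_topology (grass 2 UNIV) pluecker (zariski_proj ext2)"

section \<open>Quadrics\<close>

definition polar :: "('k::field ^ 'n \<Rightarrow> 'k) \<Rightarrow> 'k ^ 'n \<Rightarrow> 'k ^ 'n \<Rightarrow> 'k" where
  "polar q v w = q (v + w) - q v - q w"

definition nondegenerate_quadratic_form :: "('k::field ^ 'n \<Rightarrow> 'k) \<Rightarrow> bool" where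
  "nondegenerate_quadratic_form q \<longleftrightarrow>
     q \<in> hom_poly 2 \<and> (\<forall>v. (\<forall>w. polar q v w = 0) \<longrightarrow> v = 0)"

text \<open>The Jacobian criterion for the hypersurface \<open>Q = 0\<close> in the projective space of \<open>W\<close>:
  \<open>polar Q w\<close> is the differential of \<open>Q\<close> at \<open>w\<close>.\<close>

definition smooth_quadric :: "('k::field ^ 'n) set \<Rightarrow> ('k ^ 'n \<Rightarrow> 'k) \<Rightarrow> bool" where
  "smooth_quadric W Q \<longleftrightarrow> Q \<in> hom_poly 2 \<and>
     (\<forall>w\<in>W. w \<noteq> 0 \<longrightarrow> Q w = 0 \<longrightarrow> (\<exists>u\<in>W. polar Q w u \<noteq> 0))"

text \<open>Let \<open>Z \<subseteq> Y\<close> be Zariski-closed subsets of the projective space of \<open>W\<close>, with their reduced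
  structures. Then \<open>cut_out W Y Z Q\<close> says that \<open>Z\<close> is, as a scheme, the intersection of \<open>Y\<close>
  with the hypersurface \<open>Q = 0\<close>. Every point of the projective space has to lie in an affine
  chart \<open>l \<noteq> 0\<close>, identified with the affine space \<open>{w \<in> W. l w = 1}\<close>, in which the ideal of
  \<open>Z\<close> in the coordinate ring of \<open>Y\<close> is generated by the dehomogenisation of \<open>Q\<close>.
  The union of a set of lines is its affine cone.\<close>

definition cut_out ::
  "('k::field ^ 'n) set \<Rightarrow> ('k ^ 'n) set set \<Rightarrow> ('k ^ 'n) set set \<Rightarrow> ('k ^ 'n \<Rightarrow> 'k) \<Rightarrow> bool" where
  "cut_out W Y Z Q \<longleftrightarrow>
     (\<forall>p\<in>proj W. \<exists>l. Vector_Spaces.linear (*s) (*) l \<and> (\<exists>w\<in>p. l w \<noteq> 0) \<and>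
        (\<forall>P\<in>poly_fun.
           (\<forall>w\<in>\<Union>Z. l w = 1 \<longrightarrow> P w = 0) \<longleftrightarrow>
           (\<exists>B\<in>poly_fun. \<forall>w\<in>\<Union>Y. l w = 1 \<longrightarrow> P w = Q w * B w)))"

section \<open>Half-spinor modules and spinor varieties\<close>

definition bilinear_map ::
  "('k::field ^ 'a \<Rightarrow> 'k ^ 'b \<Rightarrow> 'k ^ 'c) \<Rightarrow> bool" where
  "bilinear_map c \<longleftrightarrow> (\<forall>v. Vector_Spaces.linear (*s) (*s) (c v)) \<and>
     (\<forall>s. Vector_Spaces.linear (*s) (*s) (\<lambda>v. c v s))"

text \<open>A \<open>\<int>/2\<close>-graded module of dimension \<open>16 + 16\<close> over the Clifford algebra of a nondegenerate
  form in ten variables: such a module is the spinor module, and its graded pieces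
  \<open>S\<close> and \<open>S\<^sup>\<or>\<close> are the two half-spinor representations. The maps \<open>c\<close> and \<open>c'\<close> are the Clifford
  multiplications \<open>V \<otimes> S \<rightarrow> S\<^sup>\<or>\<close> and \<open>V \<otimes> S\<^sup>\<or> \<rightarrow> S\<close>. The coordinates on the two pieces are dual
  to each other with respect to the invariant pairing; \<open>Spin(V)\<close> is generated by the products
  \<open>u w\<close> with \<open>q u = q w = 1\<close>.\<close>

definition half_spinor_modules ::
  "('k::field ^ 10 \<Rightarrow> 'k) \<Rightarrow> ('k ^ 10 \<Rightarrow> 'k ^ 16 \<Rightarrow> 'k ^ 16) \<Rightarrow> ('k ^ 10 \<Rightarrow> 'k ^ 16 \<Rightarrow> 'k ^ 16) \<Rightarrow> bool"
  where
  "half_spinor_modules q c c' \<longleftrightarrow>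
     bilinear_map c \<and> bilinear_map c' \<and>
     (\<forall>v s. c' v (c v s) = q v *s s) \<and>
     (\<forall>v f. c v (c' v f) = q v *s f) \<and>
     (\<forall>u w f s. q u = 1 \<longrightarrow> q w = 1 \<longrightarrow>
        scalar_product (c u (c' w f)) (c' u (c w s)) = scalar_product f s)"

definition OGr5 :: "('k::field ^ 10 \<Rightarrow> 'k) \<Rightarrow> ('k ^ 10) set set" where
  "OGr5 q = {U \<in> grass 5 UNIV. \<forall>u\<in>U. q u = 0}"

text \<open>A maximal isotropic subspace \<open>U\<close> kills exactly one line of spinors, which lies in one of
  the two half-spinor modules; which one depends on the connected component of \<open>U\<close>.
  In the other module only 0 is killed. So this is the image of one of the components
  under its half-spinor embedding.\<close>

definition spinor_variety ::
  "('k::field ^ 10 \<Rightarrow> 'k) \<Rightarrow> ('k ^ 10 \<Rightarrow> 'k ^ 16 \<Rightarrow> 'k ^ 16) \<Rightarrow> ('k ^ 16) set set" where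
  "spinor_variety q c = {{s. \<forall>u\<in>U. c u s = 0} | U. U \<in> OGr5 q} \<inter> proj UNIV"

definition annihilator :: "('k::field ^ 'n) set \<Rightarrow> ('k ^ 'n) set" where
  "annihilator K = {s. \<forall>f\<in>K. scalar_product f s = 0}"

text \<open>The closed points of \<open>X\<^sub>K\<close>.\<close>

definition linear_section :: "('k::field ^ 'n) set set \<Rightarrow> ('k ^ 'n) set \<Rightarrow> ('k ^ 'n) set set" where
  "linear_section X K = X \<inter> proj (annihilator K)"

text \<open>With \<open>X\<close> and \<open>X\<^sup>\<or>\<close> the two spinor varieties, \<open>P(K) \<inter> X\<^sup>\<or> = \<emptyset>\<close> says that \<open>X\<^sub>K\<close> is smooth
  of codimension 2 in \<open>X\<close>. A projective 4-space is the projectivisation of some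
  5-dimensional \<open>L\<close>.\<close>

definition special_locus_open ::
  "('k::field ^ 10 \<Rightarrow> 'k) \<Rightarrow> ('k ^ 10 \<Rightarrow> 'k ^ 16 \<Rightarrow> 'k ^ 16) \<Rightarrow> ('k ^ 10 \<Rightarrow> 'k ^ 16 \<Rightarrow> 'k ^ 16)
     \<Rightarrow> ('k ^ 16) set set" where
  "special_locus_open q c c' = {K \<in> grass 2 UNIV.
     proj K \<inter> spinor_variety q c' = {} \<and>
     (\<exists>L\<in>grass 5 UNIV. proj L \<subseteq> linear_section (spinor_variety q c) K)}"

definition special_locus ::
  "('k::field ^ 10 \<Rightarrow> 'k) \<Rightarrow> ('k ^ 10 \<Rightarrow> 'k ^ 16 \<Rightarrow> 'k ^ 16) \<Rightarrow> ('k ^ 10 \<Rightarrow> 'k ^ 16 \<Rightarrow> 'k ^ 16)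
     \<Rightarrow> ('k ^ 16) set set" where
  "special_locus q c c' = zariski_gr2 closure_of special_locus_open q c c'"

end

theory Submission
  imports Defs
begin

text \<open>Write \<open>f \<star> s\<close> for the pairing of the two half-spinor modules \<open>S\<^sup>\<or>\<close> and \<open>S\<close>. A pair of spinors \<open>x\<close>, \<open>y\<close> in
  \<open>S\<^sup>\<or>\<close> has an attached vector \<open>\<beta>(x, y)\<close> in \<open>V\<close>, given by \<open>b v (\<beta>(x, y)) = x \<star> c' v y\<close>; it is symmetric in
  \<open>x\<close> and \<open>y\<close>, and \<open>\<beta>(x, x)\<close> is isotropic. A pure spinor \<open>t\<close> satisfies \<open>\<beta>(t, t) = 0\<close>. Over the
  exterior square of \<open>S\<^sup>\<or>\<close> there is an invariant quadratic form whose value at \<open>x \<and> y\<close> is a multiple of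
  \<open>b (\<beta>(x, x)) (\<beta>(y, y))\<close>. This is the required quadric.

  All computations take place in a Fock space. A hyperbolic basis \<open>e\<^sub>i\<close>, \<open>f\<^sub>i\<close> of \<open>V\<close> and a spinor \<open>t\<close> killed
  by all \<open>e\<^sub>i\<close> (a vacuum) give a basis of \<open>S \<oplus> S\<^sup>\<or>\<close> that consists of the products of the \<open>f\<^sub>i\<close> applied
  to \<open>t\<close>. The freedom to choose the basis and the vacuum plays the role of the group \<open>Spin(V)\<close>
  (lemmas \<open>unipotent_frame\<close>, \<open>change_basis\<close>, \<open>swap_one\<close>, \<open>shear\<close>).

  \<^item> The quadric is smooth, and the affine charts used below cover the Pluecker space, because a skew
    form that vanishes on the pairs \<open>f\<^sub>0 t\<close>, \<open>f\<^sub>1 t\<close> for all vacua is zero (\<open>frame_detects\<close>).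

  \<^item> Planes of special sections lie on the quadric. A projective 4-space in the spinor variety comes from some
    \<open>c'(V) t\<close> with \<open>t\<close> a pure spinor (\<open>five_space_of_pure_spinors\<close>). If \<open>K\<close> is orthogonal to it, then in the
    frame of \<open>t\<close> the vectors \<open>\<beta>(x, x)\<close>, \<open>x \<in> K\<close>, lie in the isotropic space spanned by the \<open>e\<^sub>i\<close>.

  \<^item> Conversely, a plane \<open>K\<close> on the quadric in general position is orthogonal to such a space
    (\<open>generic_special\<close>): the pure spinor is found by linear algebra with a skew form in five variables.

  \<^item> In the chart where a plane has a basis with coordinates \<open>(1, 0)\<close> and \<open>(0, 1)\<close> at \<open>f\<^sub>0 t\<close>, \<open>f\<^sub>1 t\<close>, the
    equation of the quadric is \<open>a A + R\<close> with a variable \<open>a\<close> that occurs neither in \<open>A\<close> nor in \<open>R\<close>, and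
    \<open>A\<close> is in turn monic linear in a second variable; moreover \<open>R\<close> does not vanish on \<open>A = 0\<close>. Such a polynomial is prime, and polynomials that
    vanish on a nonempty open part of its zero set are multiples of it (\<open>multiple_if_vanishes\<close>). This
    gives the closure of the special locus, its ideal, and its codimension.\<close>

unbundle no Formal_Power_Series.fps_syntax

section \<open>Polynomial functions\<close>

lemma poly_fun_uminus: "P \<in> poly_fun \<Longrightarrow> (\<lambda>z. - P z) \<in> poly_fun"
  using poly_fun.mult[OF poly_fun.const[of "-1"], of P] by simp

lemma poly_fun_diff: "P \<in> poly_fun \<Longrightarrow> R \<in> poly_fun \<Longrightarrow> (\<lambda>z. P z - R z) \<in> poly_fun"
  using poly_fun.add[OF _ poly_fun_uminus, of P R] by simp

lemma poly_fun_power: "P \<in> poly_fun \<Longrightarrow> (\<lambda>z. P z ^ n) \<in> poly_fun"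
  by (induction n) (auto intro: poly_fun.intros)

lemma poly_fun_sum: "(\<And>i. i \<in> I \<Longrightarrow> P i \<in> poly_fun) \<Longrightarrow> (\<lambda>z. \<Sum>i\<in>I. P i z) \<in> poly_fun"
  by (induction I rule: infinite_finite_induct) (auto intro: poly_fun.intros)

lemmas poly_fun_intros = poly_fun.intros poly_fun_uminus poly_fun_diff poly_fun_power poly_fun_sum

lemma poly_fun_compose:
  assumes "P \<in> poly_fun" "\<And>i. (\<lambda>z. G z $ i) \<in> poly_fun"
  shows "(\<lambda>z. P (G z)) \<in> poly_fun"
  using assms(1) by induction (auto intro: poly_fun.intros assms(2))

lemma poly_fun_linear:
  fixes L :: "'k::field ^ 'n \<Rightarrow> 'k"
  assumes "Vector_Spaces.linear (*s) (*) L"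
  shows "L \<in> poly_fun"
proof -
  interpret L: Vector_Spaces.linear "(*s)" "(*)" L by (rule assms)
  have "L z = (\<Sum>i\<in>UNIV. z $ i * L (axis i 1))" for z
    by (subst basis_expansion[of z, symmetric]) (simp add: L.sum L.scale)
  hence eq: "L = (\<lambda>z. \<Sum>i\<in>UNIV. z $ i * L (axis i 1))" by blast
  have "(\<lambda>z. \<Sum>i\<in>UNIV. z $ i * L (axis i 1)) \<in> poly_fun" by (intro poly_fun_intros)
  thus ?thesis using eq by simp
qed

lemma poly_fun_on_line:
  assumes "P \<in> poly_fun"
  shows "\<exists>p. \<forall>t. P (x + t *s y) = poly p t"
  using assms
proof induction
  case (const c)
  show ?case by (rule exI[of _ "[:c:]"]) simp
next
  case (coord i)
  show ?case by (rule exI[of _ "[:x $ i, y $ i:]"]) simp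
next
  case (add P P')
  then obtain p p' where "\<forall>t. P (x + t *s y) = poly p t" "\<forall>t. P' (x + t *s y) = poly p' t" by blast
  thus ?case by (intro exI[of _ "p + p'"]) simp
next
  case (mult P P')
  then obtain p p' where "\<forall>t. P (x + t *s y) = poly p t" "\<forall>t. P' (x + t *s y) = poly p' t" by blast
  thus ?case by (intro exI[of _ "p * p'"]) simp
qed

text \<open>A nonzero polynomial has finitely many roots, but the field is infinite.\<close>

lemma poly_eqI_cofinite:
  fixes p :: "'k::field_char_0 poly"
  assumes "\<And>t. t \<notin> S \<Longrightarrow> poly p t = 0" "finite S"
  shows "p = 0"
proof (rule ccontr)
  assume "p \<noteq> 0"
  hence "finite ({t. poly p t = 0} \<union> S)" using poly_roots_finite assms(2) by blast
  moreover have "{t. poly p t = 0} \<union> S = UNIV" using assms(1) by blast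
  ultimately show False using infinite_UNIV_char_0[where 'a='k] by simp
qed

text \<open>The polynomial functions form an integral domain: two points where the factors do not
  vanish can be joined by a line.\<close>

lemma poly_fun_mult_eq_0:
  fixes P R :: "'k::field_char_0 ^ 'n \<Rightarrow> 'k"
  assumes PR: "P \<in> poly_fun" "R \<in> poly_fun" and zero: "\<And>z. P z * R z = 0"
    and x: "P x \<noteq> 0"
  shows "R y = 0"
proof (rule ccontr)
  assume y: "R y \<noteq> 0"
  obtain p where p: "\<forall>t. P (x + t *s (y - x)) = poly p t" using poly_fun_on_line[OF PR(1)] by blast
  obtain r where r: "\<forall>t. R (x + t *s (y - x)) = poly r t" using poly_fun_on_line[OF PR(2)] by blast
  have "p * r = 0" by (rule poly_eqI_cofinite[of "{}"]) (use zero p r in \<open>simp_all flip: p r\<close>)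
  moreover have "p \<noteq> 0" using p[rule_format, of 0] x by auto
  moreover have "r \<noteq> 0" using r[rule_format, of 1] y by auto
  ultimately show False by simp
qed

subsection \<open>Hypersurfaces that are linear in one variable\<close>

definition vec_upd :: "'k ^ 'n \<Rightarrow> 'n \<Rightarrow> 'k \<Rightarrow> 'k ^ 'n" where
  "vec_upd z i a = (\<chi> j. if j = i then a else z $ j)"

lemma vec_upd_nth [simp]: "vec_upd z i a $ j = (if j = i then a else z $ j)"
  by (simp add: vec_upd_def)

lemma vec_upd_same [simp]: "vec_upd z i (z $ i) = z"
  by (simp add: vec_eq_iff)

lemma poly_fun_vec_upd:
  assumes "P \<in> poly_fun" "S \<in> poly_fun"
  shows "(\<lambda>z. P (vec_upd z i (S z))) \<in> poly_fun"
proof (rule poly_fun_compose[OF assms(1)])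
  show "(\<lambda>z. vec_upd z i (S z) $ j) \<in> poly_fun" for j
    by (cases "j = i") (auto intro: poly_fun.coord assms(2))
qed

lemma vec_upd_eq_line: "vec_upd z i a = z + (a - z $ i) *s axis i (1::'k::field)"
  by (simp add: vec_eq_iff axis_def)

text \<open>Division with remainder by \<open>z\<^sub>i A + R\<close>, viewed as a linear polynomial in \<open>z\<^sub>i\<close>, after multiplication with
  a power of its leading coefficient \<open>A\<close>. By induction on \<open>P\<close>; only the coordinate \<open>z\<^sub>i\<close> itself needs a
  step: \<open>A z\<^sub>i = (z\<^sub>i A + R) - R\<close>.\<close>

lemma pseudo_division:
  fixes A R :: "'k::field ^ 'n \<Rightarrow> 'k"
  assumes AR: "A \<in> poly_fun" "R \<in> poly_fun"
    and A_indep: "\<And>z a. A (vec_upd z i a) = A z" and R_indep: "\<And>z a. R (vec_upd z i a) = R z"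
    and "P \<in> poly_fun"
  shows "\<exists>d. \<exists>B\<in>poly_fun. \<exists>S\<in>poly_fun. (\<forall>z a. S (vec_upd z i a) = S z) \<and>
    (\<forall>z. A z ^ d * P z = (z $ i * A z + R z) * B z + S z)"
  using assms(5)
proof induction
  case (const c)
  show ?case
    by (rule exI[of _ 0], rule bexI[of _ "\<lambda>z. 0"], rule bexI[of _ "\<lambda>z. c"]) (auto intro: poly_fun.intros)
next
  case (coord j)
  show ?case
  proof (cases "j = i")
    case True
    show ?thesis
      by (rule exI[of _ 1], rule bexI[of _ "\<lambda>z. 1"], rule bexI[of _ "\<lambda>z. - R z"])
        (auto intro: poly_fun_intros AR simp: True R_indep)
  next
    case False
    show ?thesis
      by (rule exI[of _ 0], rule bexI[of _ "\<lambda>z. 0"], rule bexI[of _ "\<lambda>z. z $ j"])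
        (auto intro: poly_fun.intros simp: False)
  qed
next
  case (add P P')
  then obtain d B S d' B' S' where *: "B \<in> poly_fun" "S \<in> poly_fun" "B' \<in> poly_fun" "S' \<in> poly_fun"
    "\<And>z a. S (vec_upd z i a) = S z" "\<And>z a. S' (vec_upd z i a) = S' z"
    and e: "\<And>z. A z ^ d * P z = (z $ i * A z + R z) * B z + S z"
    and e': "\<And>z. A z ^ d' * P' z = (z $ i * A z + R z) * B' z + S' z" by blast
  have "A z ^ (d + d') * (P z + P' z) = (z $ i * A z + R z) * (A z ^ d' * B z + A z ^ d * B' z)
      + (A z ^ d' * S z + A z ^ d * S' z)" for z
  proof -
    have "A z ^ (d + d') * (P z + P' z) = A z ^ d' * (A z ^ d * P z) + A z ^ d * (A z ^ d' * P' z)"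
      by (simp add: power_add algebra_simps)
    thus ?thesis unfolding e e' by (simp add: algebra_simps)
  qed
  thus ?case using *
    by (intro exI[of _ "d + d'"] bexI[of _ "\<lambda>z. A z ^ d' * B z + A z ^ d * B' z"]
          bexI[of _ "\<lambda>z. A z ^ d' * S z + A z ^ d * S' z"])
      (auto intro!: poly_fun_intros AR simp: A_indep)
next
  case (mult P P')
  then obtain d B S d' B' S' where *: "B \<in> poly_fun" "S \<in> poly_fun" "B' \<in> poly_fun" "S' \<in> poly_fun"
    "\<And>z a. S (vec_upd z i a) = S z" "\<And>z a. S' (vec_upd z i a) = S' z"
    and e: "\<And>z. A z ^ d * P z = (z $ i * A z + R z) * B z + S z"
    and e': "\<And>z. A z ^ d' * P' z = (z $ i * A z + R z) * B' z + S' z" by blast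
  have "A z ^ (d + d') * (P z * P' z) = (z $ i * A z + R z) *
      (B z * ((z $ i * A z + R z) * B' z + S' z) + S z * B' z) + S z * S' z" for z
  proof -
    have "A z ^ (d + d') * (P z * P' z) = (A z ^ d * P z) * (A z ^ d' * P' z)"
      by (simp add: power_add algebra_simps)
    thus ?thesis unfolding e e' by (simp add: algebra_simps)
  qed
  thus ?case using *
    by (intro exI[of _ "d + d'"]
          bexI[of _ "\<lambda>z. B z * ((z $ i * A z + R z) * B' z + S' z) + S z * B' z"]
          bexI[of _ "\<lambda>z. S z * S' z"])
      (auto intro!: poly_fun_intros AR)
qed

text \<open>The remainder of the division by \<open>z\<^sub>j + T\<close> is the value at \<open>z\<^sub>j = - T\<close>.\<close>

lemma monic_division:
  fixes T :: "'k::field ^ 'n \<Rightarrow> 'k"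
  assumes T: "T \<in> poly_fun" and "P \<in> poly_fun"
  shows "\<exists>B\<in>poly_fun. \<forall>z. P z = (z $ j + T z) * B z + P (vec_upd z j (- T z))"
  using assms(2)
proof induction
  case (const c)
  show ?case by (rule bexI[of _ "\<lambda>z. 0"]) (auto intro: poly_fun.intros)
next
  case (coord i)
  show ?case
    by (rule bexI[of _ "\<lambda>z. if i = j then 1 else 0"]) (auto intro: poly_fun.intros)
next
  case (add P P')
  then obtain B B' where "B \<in> poly_fun" "B' \<in> poly_fun"
    and e: "\<And>z. P z = (z $ j + T z) * B z + P (vec_upd z j (- T z))"
    and e': "\<And>z. P' z = (z $ j + T z) * B' z + P' (vec_upd z j (- T z))" by blast
  have "\<forall>z. P z + P' z = (z $ j + T z) * (B z + B' z) + (P (vec_upd z j (- T z)) + P' (vec_upd z j (- T z)))"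
    by (rule allI, rule trans[OF arg_cong2[where f="(+)", OF e e']]) (simp add: algebra_simps)
  thus ?case by (rule bexI[of _ "\<lambda>z. B z + B' z"]) (intro poly_fun.intros \<open>B \<in> poly_fun\<close> \<open>B' \<in> poly_fun\<close>)
next
  case (mult P P')
  then obtain B B' where *: "B \<in> poly_fun" "B' \<in> poly_fun"
    and e: "\<And>z. P z = (z $ j + T z) * B z + P (vec_upd z j (- T z))"
    and e': "\<And>z. P' z = (z $ j + T z) * B' z + P' (vec_upd z j (- T z))" by blast
  have "\<forall>z. P z * P' z = (z $ j + T z) * (B z * P' z + P (vec_upd z j (- T z)) * B' z)
     + P (vec_upd z j (- T z)) * P' (vec_upd z j (- T z))"
  proof
    fix z
    have "P z * P' z = (z $ j + T z) * B z * P' z + P (vec_upd z j (- T z)) * P' z"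
      by (rule trans[OF arg_cong2[where f="(*)", OF e refl]]) (simp only: distrib_right)
    also have "P (vec_upd z j (- T z)) * P' z = P (vec_upd z j (- T z)) *
        ((z $ j + T z) * B' z + P' (vec_upd z j (- T z)))" by (simp only: e'[of z, symmetric])
    finally show "P z * P' z = (z $ j + T z) * (B z * P' z + P (vec_upd z j (- T z)) * B' z)
     + P (vec_upd z j (- T z)) * P' (vec_upd z j (- T z))" by (simp add: algebra_simps)
  qed
  moreover have "(\<lambda>z. P (vec_upd z j (- T z))) \<in> poly_fun"
    by (intro poly_fun_vec_upd mult.hyps poly_fun_uminus T)
  ultimately show ?case
    by (rule_tac bexI[of _ "\<lambda>z. B z * P' z + P (vec_upd z j (- T z)) * B' z"])
      (assumption, intro poly_fun.intros * mult.hyps, assumption)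
qed

text \<open>If \<open>Q = z\<^sub>i A + R\<close> where \<open>A = z\<^sub>j + T\<close> and \<open>R\<close> does not vanish on \<open>A = 0\<close>, then \<open>Q\<close> is a prime
  polynomial, and the hypersurface \<open>Q = 0\<close> is the closure of its part \<open>A \<noteq> 0\<close>, which is a graph.
  Hence a polynomial that vanishes on \<open>Q = 0\<close>, or just on the part of it where \<open>h \<noteq> 0\<close>, is a multiple
  of \<open>Q\<close>: its pseudo-remainder modulo \<open>Q\<close> vanishes because of the graph, and \<open>A\<close> can be cancelled
  because \<open>A\<close> is prime and does not divide \<open>Q\<close>.\<close>

locale linear_in_variable =
  fixes i j :: "'n::finite" and A T R Q :: "'k::field_char_0 ^ 'n \<Rightarrow> 'k"
  assumes T: "T \<in> poly_fun" and R: "R \<in> poly_fun"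
    and ij: "i \<noteq> j"
    and T_i: "\<And>z a. T (vec_upd z i a) = T z" and T_j: "\<And>z a. T (vec_upd z j a) = T z"
    and R_i: "\<And>z a. R (vec_upd z i a) = R z"
    and A_def: "\<And>z. A z = z $ j + T z" and Q_def: "\<And>z. Q z = z $ i * A z + R z"
    and R_nonzero: "\<exists>z. A z = 0 \<and> R z \<noteq> 0"
begin

lemma A: "A \<in> poly_fun"
proof -
  have "(\<lambda>z. z $ j + T z) \<in> poly_fun" by (intro poly_fun_intros T)
  thus ?thesis by (simp flip: A_def)
qed

lemma Q: "Q \<in> poly_fun"
proof -
  have "(\<lambda>z. z $ i * A z + R z) \<in> poly_fun" by (intro poly_fun_intros A R)
  thus ?thesis by (simp flip: Q_def)
qed

lemma A_i: "A (vec_upd z i a) = A z"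
  using ij by (simp add: A_def T_i)

text \<open>On the set \<open>A = 0\<close>, which is a graph over the other variables, \<open>A P = Q B\<close> becomes \<open>R B = 0\<close>. So \<open>B\<close> vanishes
  there, and it is a multiple of \<open>A\<close> by division with remainder.\<close>

lemma cancel_A:
  assumes P: "P \<in> poly_fun" and B: "B \<in> poly_fun" and eq: "\<And>z. A z * P z = Q z * B z"
  shows "\<exists>B'\<in>poly_fun. \<forall>z. P z = Q z * B' z"
proof -
  let ?s = "\<lambda>z. vec_upd z j (- T z)"
  have s: "(\<lambda>z. F (?s z)) \<in> poly_fun" if "F \<in> poly_fun" for F
    by (intro poly_fun_vec_upd that poly_fun_uminus T)
  have A_s: "A (?s z) = 0" for z by (simp add: A_def T_j)
  obtain z0 where z0: "A z0 = 0" "R z0 \<noteq> 0" using R_nonzero by blast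
  have "?s z0 = z0" using z0(1) unfolding A_def
    by (metis eq_neg_iff_add_eq_0 vec_upd_same)
  hence "R (?s z0) \<noteq> 0" using z0 by simp
  moreover have "R (?s z) * B (?s z) = 0" for z
    using eq[of "?s z"] unfolding A_s Q_def by simp
  ultimately have B_s: "B (?s z) = 0" for z
    using poly_fun_mult_eq_0[OF s[OF R] s[OF B]] by blast
  obtain B' where B': "B' \<in> poly_fun" "\<And>z. B z = A z * B' z"
    using monic_division[OF T B, of j] B_s unfolding A_def by auto
  have D: "(\<lambda>z. P z - Q z * B' z) \<in> poly_fun" by (intro poly_fun_intros P Q B'(1))
  have "A z * (P z - Q z * B' z) = 0" for z using eq[of z] B'(2)[of z] by (simp add: algebra_simps)
  moreover have "A (vec_upd 0 j (1 - T 0)) \<noteq> 0" by (simp add: A_def T_j)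
  ultimately have "P z - Q z * B' z = 0" for z
    using poly_fun_mult_eq_0[OF A D] by blast
  thus ?thesis using B'(1) by auto
qed

theorem multiple_if_vanishes:
  assumes P: "P \<in> poly_fun" and h: "h \<in> poly_fun"
    and h_nonzero: "\<exists>z. Q z = 0 \<and> A z \<noteq> 0 \<and> h z \<noteq> 0"
    and vanish: "\<And>z. Q z = 0 \<Longrightarrow> h z \<noteq> 0 \<Longrightarrow> P z = 0"
  shows "\<exists>B\<in>poly_fun. \<forall>z. P z = Q z * B z"
proof -
  obtain d B S where BS: "B \<in> poly_fun" "S \<in> poly_fun" and S_i: "\<And>z a. S (vec_upd z i a) = S z"
    and P_eq: "\<And>z. A z ^ d * P z = Q z * B z + S z"
    using pseudo_division[OF A R A_i R_i P] unfolding Q_def by metis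
  obtain d' B' H where H: "H \<in> poly_fun" and H_i: "\<And>z a. H (vec_upd z i a) = H z"
    and h_eq: "\<And>z. A z ^ d' * h z = Q z * B' z + H z"
    using pseudo_division[OF A R A_i R_i h] unfolding Q_def by metis
  have "(A z * H z) * S z = 0" for z
  proof (cases "A z = 0")
    case False
    let ?z = "vec_upd z i (- R z / A z)"
    have Q0: "Q ?z = 0" using False by (simp add: Q_def A_i R_i)
    show ?thesis
    proof (cases "h ?z = 0")
      case True
      hence "H ?z = 0" using h_eq[of ?z] Q0 by simp
      thus ?thesis by (simp add: H_i)
    next
      case False
      hence "S ?z = 0" using P_eq[of ?z] vanish Q0 by simp
      thus ?thesis by (simp add: S_i)
    qed
  qed simp
  moreover obtain z1 where "Q z1 = 0" "A z1 \<noteq> 0" "h z1 \<noteq> 0" using h_nonzero by blast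
  hence "A z1 * H z1 \<noteq> 0" using h_eq[of z1] by auto
  ultimately have "S z = 0" for z
    using poly_fun_mult_eq_0[OF poly_fun.mult[OF A H] BS(2)] by blast
  hence eq: "A z ^ d * P z = Q z * B z" for z using P_eq by simp
  thus ?thesis using BS(1)
  proof (induction d arbitrary: B)
    case 0
    thus ?case by auto
  next
    case (Suc d)
    have "(\<lambda>z. A z ^ d * P z) \<in> poly_fun" by (intro poly_fun_intros A P)
    moreover have "A z * (A z ^ d * P z) = Q z * B z" for z using Suc.prems(1)[of z] by (simp add: mult.assoc)
    ultimately obtain B' where "B' \<in> poly_fun" "\<forall>z. A z ^ d * P z = Q z * B' z"
      using cancel_A[of "\<lambda>z. A z ^ d * P z" B] Suc.prems(2) by blast
    thus ?case using Suc.IH[of B'] by blast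
  qed
qed

text \<open>Along the direction of the \<open>i\<close>-th coordinate \<open>Q\<close> has degree one. So the multiplicity of \<open>Q\<close> in a
  nonzero polynomial is bounded.\<close>

lemma no_infinite_division:
  assumes P: "P \<in> poly_fun" and div: "\<And>m::nat. \<exists>B\<in>poly_fun. \<forall>z. P z = Q z ^ m * B z"
  shows "P z = 0"
proof (rule ccontr)
  assume z: "P z \<noteq> 0"
  have "A (vec_upd 0 j (1 - T 0)) \<noteq> 0" by (simp add: A_def T_j)
  hence "\<not> (\<forall>z. P z * A z = 0)" using poly_fun_mult_eq_0[OF P A _ z] by blast
  then obtain x where "P x * A x \<noteq> 0" by blast
  hence x: "P x \<noteq> 0" "A x \<noteq> 0" by auto
  obtain p where p: "\<forall>t. P (x + t *s axis i 1) = poly p t" using poly_fun_on_line[OF P] by blast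
  have "p \<noteq> 0" using p[rule_format, of 0] x by auto
  define q where "q = [:Q x, A x:]"
  have line: "x + t *s axis i 1 = vec_upd x i (x $ i + t)" for t
    by (simp add: vec_upd_eq_line)
  have q: "Q (x + t *s axis i 1) = poly q t" for t
    unfolding line by (simp add: Q_def A_i R_i q_def algebra_simps)
  obtain B where B: "B \<in> poly_fun" "\<forall>z. P z = Q z ^ (Suc (degree p)) * B z" using div by blast
  obtain b where b: "\<forall>t. B (x + t *s axis i 1) = poly b t" using poly_fun_on_line[OF B(1)] by blast
  have "p - q ^ Suc (degree p) * b = 0"
    by (rule poly_eqI_cofinite[of "{}"])
      (use B(2) in \<open>simp_all flip: p[rule_format] q b[rule_format]\<close>)
  hence "p = q ^ Suc (degree p) * b" by simp
  moreover from this have "b \<noteq> 0" "q \<noteq> 0" using \<open>p \<noteq> 0\<close> by auto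
  ultimately have "degree p = Suc (degree p) * degree q + degree b"
    by (metis degree_mult_eq degree_power_eq power_eq_0_iff)
  moreover have "degree q = 1" using x(2) by (simp add: q_def)
  ultimately show False by simp
qed

end

subsection \<open>Homogenisation\<close>

lemma hom_poly_mult: "P \<in> hom_poly d \<Longrightarrow> R \<in> hom_poly e \<Longrightarrow> (\<lambda>z. P z * R z) \<in> hom_poly (d + e)"
  by (simp add: hom_poly_def power_add poly_fun.mult)

lemma linear_hom_poly:
  assumes "Vector_Spaces.linear (*s) (*) L"
  shows "L \<in> hom_poly 1"
proof -
  interpret L: Vector_Spaces.linear "(*s)" "(*)" L by (rule assms)
  show ?thesis by (simp add: hom_poly_def poly_fun_linear[OF assms] L.scale)
qed

text \<open>The degree of the homogenisation may be raised by powers of \<open>L\<close>, which is what makes sums possible; this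
  is why the induction proves the claim for all large degrees.\<close>

lemma homogenize:
  fixes L :: "'k::field ^ 'n \<Rightarrow> 'k"
  assumes L: "L \<in> hom_poly 1" and "P \<in> poly_fun"
  shows "\<exists>N. \<exists>H\<in>hom_poly N. \<forall>w. L w = 1 \<longrightarrow> H w = P w"
proof -
  have pow: "(\<lambda>w. L w ^ n) \<in> hom_poly n" for n
    using L by (simp add: hom_poly_def power_mult_distrib poly_fun_power)
  have "\<exists>N. \<forall>n\<ge>N. \<exists>H\<in>hom_poly n. \<forall>w. L w = 1 \<longrightarrow> H w = P w"
    using assms(2)
  proof induction
    case (const c)
    have "(\<lambda>w. c * L w ^ n) \<in> hom_poly n" for n
      using pow[of n] by (simp add: hom_poly_def poly_fun.const poly_fun.mult)
    hence "\<exists>H\<in>hom_poly n. \<forall>w. L w = 1 \<longrightarrow> H w = c" for n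
      by (rule bexI[rotated]) simp
    thus ?case by blast
  next
    case (coord i)
    have "(\<lambda>w. w $ i) \<in> hom_poly 1" by (simp add: hom_poly_def poly_fun.coord)
    from hom_poly_mult[OF this pow] have *: "(\<lambda>w. w $ i * L w ^ n) \<in> hom_poly (Suc n)" for n by simp
    have "\<exists>H\<in>hom_poly n. \<forall>w. L w = 1 \<longrightarrow> H w = w $ i" if "n \<ge> 1" for n
    proof -
      obtain m where "n = Suc m" using \<open>n \<ge> 1\<close> not0_implies_Suc by fastforce
      thus ?thesis using *[of m] by (intro bexI[of _ "\<lambda>w. w $ i * L w ^ m"]) simp_all
    qed
    thus ?case by blast
  next
    case (add P P')
    then obtain N N' where *: "\<forall>n\<ge>N. \<exists>H\<in>hom_poly n. \<forall>w. L w = 1 \<longrightarrow> H w = P w"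
      "\<forall>n\<ge>N'. \<exists>H\<in>hom_poly n. \<forall>w. L w = 1 \<longrightarrow> H w = P' w" by blast
    show ?case
    proof (intro exI[of _ "max N N'"] allI impI)
      fix n assume "n \<ge> max N N'"
      hence n: "n \<ge> N" "n \<ge> N'" by auto
      obtain H where H: "H \<in> hom_poly n" "\<forall>w. L w = 1 \<longrightarrow> H w = P w" using *(1) n(1) by blast
      obtain H' where H': "H' \<in> hom_poly n" "\<forall>w. L w = 1 \<longrightarrow> H' w = P' w" using *(2) n(2) by blast
      have "(\<lambda>w. H w + H' w) \<in> hom_poly n"
        using H(1) H'(1) by (simp add: hom_poly_def distrib_left poly_fun.add)
      thus "\<exists>H\<in>hom_poly n. \<forall>w. L w = 1 \<longrightarrow> H w = P w + P' w"
        by (rule bexI[rotated]) (simp add: H(2) H'(2))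
    qed
  next
    case (mult P P')
    then obtain N N' where *: "\<forall>n\<ge>N. \<exists>H\<in>hom_poly n. \<forall>w. L w = 1 \<longrightarrow> H w = P w"
      "\<forall>n\<ge>N'. \<exists>H\<in>hom_poly n. \<forall>w. L w = 1 \<longrightarrow> H w = P' w" by blast
    show ?case
    proof (intro exI[of _ "N + N'"] allI impI)
      fix n assume n: "n \<ge> N + N'"
      obtain H where H: "H \<in> hom_poly N" "\<forall>w. L w = 1 \<longrightarrow> H w = P w" using * by blast
      have "n - N \<ge> N'" using n by simp
      then obtain H' where H': "H' \<in> hom_poly (n - N)" "\<forall>w. L w = 1 \<longrightarrow> H' w = P' w" using * by blast
      have "(\<lambda>w. H w * H' w) \<in> hom_poly n" using hom_poly_mult[OF H(1) H'(1)] n by simp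
      thus "\<exists>H\<in>hom_poly n. \<forall>w. L w = 1 \<longrightarrow> H w = P w * P' w"
        by (rule bexI[rotated]) (simp add: H(2) H'(2))
    qed
  qed
  thus ?thesis by blast
qed

section \<open>Finite families of vectors\<close>

definition lin_indep :: "nat \<Rightarrow> (nat \<Rightarrow> 'k::field ^ 'm) \<Rightarrow> bool" where
  "lin_indep n v \<longleftrightarrow> (\<forall>x. (\<Sum>i<n. x i *s v i) = 0 \<longrightarrow> (\<forall>i<n. x i = 0))"

lemma lin_indepD: "lin_indep n v \<Longrightarrow> (\<Sum>i<n. x i *s v i) = 0 \<Longrightarrow> i < n \<Longrightarrow> x i = 0"
  by (auto simp: lin_indep_def)

text \<open>Families indexed by \<open>{..<n}\<close> avoid the case of repeated vectors; this is the translation to sets.\<close>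

lemma lin_indep_iff: "lin_indep n v \<longleftrightarrow> inj_on v {..<n} \<and> vec.independent (v ` {..<n})"
proof
  assume v: "lin_indep n v"
  have inj: "inj_on v {..<n}"
  proof (rule inj_onI, rule ccontr)
    fix i j assume ij: "i \<in> {..<n}" "j \<in> {..<n}" "v i = v j" "i \<noteq> j"
    let ?x = "\<lambda>k. if k = i then 1 else if k = j then - 1 else (0::'a)"
    have "(\<Sum>k<n. ?x k *s v k) = (\<Sum>k\<in>{i, j}. ?x k *s v k)"
      by (rule sum.mono_neutral_right) (use ij in auto)
    also have "\<dots> = 0" using ij by simp
    finally show False using lin_indepD[OF v, of ?x i] ij by simp
  qed
  have "vec.independent (v ` {..<n})"
  proof (rule vec.independent_if_scalars_zero)
    fix f x assume f: "(\<Sum>x\<in>v ` {..<n}. f x *s x) = 0" and x: "x \<in> v ` {..<n}"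
    have "(\<Sum>i<n. f (v i) *s v i) = 0" using f by (simp add: sum.reindex[OF inj])
    thus "f x = 0" using lin_indepD[OF v, of "\<lambda>i. f (v i)"] x by auto
  qed simp
  thus "inj_on v {..<n} \<and> vec.independent (v ` {..<n})" using inj by blast
next
  assume v: "inj_on v {..<n} \<and> vec.independent (v ` {..<n})"
  show "lin_indep n v"
    unfolding lin_indep_def
  proof (intro allI impI)
    fix x i assume x: "(\<Sum>i<n. x i *s v i) = 0" and i: "i < n"
    define g where "g = (\<lambda>y. x (the_inv_into {..<n} v y))"
    have g: "g (v i) = x i" if "i < n" for i
      using that v by (simp add: g_def the_inv_into_f_f)
    have "(\<Sum>y\<in>v ` {..<n}. g y *s y) = (\<Sum>i<n. x i *s v i)"
      using v by (simp add: sum.reindex g)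
    hence "g (v i) = 0" using vec.independentD[of "v ` {..<n}" "v ` {..<n}" g "v i"] v x i by auto
    thus "x i = 0" using g i by simp
  qed
qed

lemma lin_indep_spans:
  fixes v :: "nat \<Rightarrow> 'k::field ^ 'm"
  assumes v: "lin_indep n v" and U: "vec.subspace U" "vec.dim U = n" "\<And>i. i < n \<Longrightarrow> v i \<in> U"
    and u: "u \<in> U"
  shows "\<exists>x. u = (\<Sum>i<n. x i *s v i)"
proof -
  have inj: "inj_on v {..<n}" and ind: "vec.independent (v ` {..<n})"
    using v by (auto simp: lin_indep_iff)
  have "U \<subseteq> vec.span (v ` {..<n})"
    by (rule vec.card_ge_dim_independent) (use U ind in \<open>auto simp: card_image[OF inj]\<close>)
  hence "u \<in> vec.span (v ` {..<n})" using u by blast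
  then obtain g where "u = (\<Sum>y\<in>v ` {..<n}. g y *s y)" by (subst (asm) vec.span_finite) auto
  hence "u = (\<Sum>i<n. g (v i) *s v i)" by (simp add: sum.reindex[OF inj])
  thus ?thesis by (rule exI[of _ "\<lambda>i. g (v i)"])
qed

lemma dim_UNIV_vec: "vec.dim (UNIV :: ('k::field ^ 'm) set) = CARD('m)"
  by (rule vec_dim_card)

lemma subspace_family:
  assumes "vec.subspace U" "vec.dim U = n"
  shows "\<exists>v. lin_indep n v \<and> (\<forall>i<n. v i \<in> U)"
proof -
  obtain B where B: "B \<subseteq> U" "vec.independent B" "card B = n" using vec.basis_exists[of U] assms by metis
  hence "finite B" using vec.finiteI_independent by blast
  then obtain h where "bij_betw h {..<n} B"
    using B(3) by (metis ex_bij_betw_nat_finite atLeast0LessThan)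
  hence "inj_on h {..<n}" "h ` {..<n} = B" by (auto simp: bij_betw_def)
  thus ?thesis using B by (intro exI[of _ h]) (auto simp: lin_indep_iff)
qed

lemma extend_family:
  assumes v: "lin_indep m v" "\<And>i. i < m \<Longrightarrow> v i \<in> U" and U: "vec.subspace U" "vec.dim U = n"
  shows "\<exists>v'. lin_indep n v' \<and> (\<forall>i<n. v' i \<in> U) \<and> (\<forall>i<m. v' i = v i) \<and> m \<le> n"
proof -
  have inj: "inj_on v {..<m}" and ind: "vec.independent (v ` {..<m})"
    using v by (auto simp: lin_indep_iff)
  have sub: "v ` {..<m} \<subseteq> U" using v by auto
  obtain B where B: "v ` {..<m} \<subseteq> B" "B \<subseteq> U" "vec.independent B" "U \<subseteq> vec.span B"
    using vec.maximal_independent_subset_extend[OF sub ind] by blast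
  have fB: "finite B" using B(3) vec.finiteI_independent by blast
  have cB: "card B = n" using vec.dim_unique[OF B(2,4,3) refl] U by simp
  have mn: "m \<le> n" using card_mono[OF fB B(1)] cB card_image[OF inj] by simp
  have "card (B - v ` {..<m}) = card {m..<n}"
    using cB fB B(1) card_image[OF inj] by (simp add: card_Diff_subset)
  then obtain h where h: "bij_betw h {m..<n} (B - v ` {..<m})"
    using fB by (metis finite_Diff finite_atLeastLessThan finite_same_card_bij)
  define v' where "v' = (\<lambda>i. if i < m then v i else h i)"
  have "inj_on v' ({..<m} \<union> {m..<n})"
    using inj h by (auto simp: inj_on_Un v'_def bij_betw_def inj_on_def)
  moreover have "{..<m} \<union> {m..<n} = {..<n}" using mn by auto
  moreover have "v' ` ({..<m} \<union> {m..<n}) = B"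
  proof -
    have "v' ` {..<m} = v ` {..<m}" "v' ` {m..<n} = B - v ` {..<m}"
      using h by (auto simp: v'_def bij_betw_def image_def)
    thus ?thesis using B(1) by (auto simp: image_Un)
  qed
  ultimately have "inj_on v' {..<n}" "v' ` {..<n} = B" by auto
  thus ?thesis using B mn by (intro exI[of _ v']) (auto simp: lin_indep_iff v'_def)
qed

lemma dual_functional:
  fixes v :: "nat \<Rightarrow> 'k::field ^ 'm"
  assumes "lin_indep n v"
  shows "\<exists>\<phi>. Vector_Spaces.linear (*s) (*) \<phi> \<and> (\<forall>i<n. \<phi> (v i) = (if i = j then 1 else 0))"
proof -
  have inj: "inj_on v {..<n}" and ind: "vec.independent (v ` {..<n})"
    using assms by (auto simp: lin_indep_iff)
  interpret vector_space_pair "(*s) :: 'k \<Rightarrow> 'k ^ 'm \<Rightarrow> 'k ^ 'm" "(*) :: 'k \<Rightarrow> 'k \<Rightarrow> 'k"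
    by unfold_locales
  obtain \<phi> where "Vector_Spaces.linear (*s) (*) \<phi>"
    "\<forall>x\<in>v ` {..<n}. \<phi> x = (if the_inv_into {..<n} v x = j then 1 else 0)"
    using linear_independent_extend[OF ind, of "\<lambda>x. if the_inv_into {..<n} v x = j then 1 else 0"]
    by blast
  thus ?thesis using inj by (intro exI[of _ \<phi>]) (auto simp: the_inv_into_f_f)
qed

lemma dim_span_family:
  assumes "lin_indep n v"
  shows "vec.dim (vec.span (v ` {..<n})) = n"
  using assms by (simp add: lin_indep_iff vec.dim_span vec.dim_eq_card_independent card_image)

lemma span_familyI: "(\<Sum>i<n. x i *s v i) \<in> vec.span (v ` {..<n})"
  by (intro vec.span_sum vec.span_scale vec.span_base) auto

section \<open>The pairing of spinors\<close>

notation scalar_product (infixl "\<star>" 70)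

lemma scalar_product_simps [simp]:
  fixes x y z :: "'k::field ^ 'n"
  shows "(x + y) \<star> z = x \<star> z + y \<star> z" "z \<star> (x + y) = z \<star> x + z \<star> y"
    "(x - y) \<star> z = x \<star> z - y \<star> z" "z \<star> (x - y) = z \<star> x - z \<star> y"
    "(- x) \<star> z = - (x \<star> z)" "z \<star> (- x) = - (z \<star> x)"
    "(a *s x) \<star> z = a * (x \<star> z)" "z \<star> (a *s x) = a * (z \<star> x)"
    "0 \<star> z = 0" "z \<star> 0 = 0"
  by (simp_all add: scalar_product_def sum.distrib algebra_simps sum_subtractf sum_negf sum_distrib_left)

lemma scalar_product_sum:
  fixes z :: "'k::field ^ 'n"
  shows "(\<Sum>i\<in>I. v i) \<star> z = (\<Sum>i\<in>I. v i \<star> z)" "z \<star> (\<Sum>i\<in>I. v i) = (\<Sum>i\<in>I. z \<star> v i)"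
  by (induction I rule: infinite_finite_induct) simp_all

lemma scalar_product_commute: "x \<star> y = y \<star> (x :: 'k::field ^ 'n)"
  by (simp add: scalar_product_def mult.commute)

lemma scalar_product_axis: "x \<star> axis i 1 = (x :: 'k::field ^ 'n) $ i"
  by (simp add: scalar_product_def axis_def if_distrib cong: if_cong)

lemma scalar_product_eqI: "(\<And>s. x \<star> s = y \<star> s) \<Longrightarrow> x = (y :: 'k::field ^ 'n)"
  by (metis scalar_product_axis vec_eq_iff)

section \<open>The Clifford action\<close>

locale spinor_modules =
  fixes q :: "'k::{alg_closed_field, field_char_0} ^ 10 \<Rightarrow> 'k"
    and c c' :: "'k ^ 10 \<Rightarrow> 'k ^ 16 \<Rightarrow> 'k ^ 16"
  assumes nondegenerate: "nondegenerate_quadratic_form q" and modules: "half_spinor_modules q c c'"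
begin

lemma swap: "spinor_modules q c' c"
  using nondegenerate modules
  by (simp add: spinor_modules_def half_spinor_modules_def scalar_product_commute)

lemma c_simps [simp]:
  "c v (x + y) = c v x + c v y" "c v (a *s x) = a *s c v x"
  "c (v + w) x = c v x + c w x" "c (a *s v) x = a *s c v x"
  "c v (- x) = - c v x" "c v (x - y) = c v x - c v y" "c v 0 = 0"
  "c (- v) x = - c v x" "c (v - w) x = c v x - c w x" "c 0 x = 0"
proof -
  have "Vector_Spaces.linear (*s) (*s) (c v)" "Vector_Spaces.linear (*s) (*s) (\<lambda>v. c v x)" for v x
    using modules by (auto simp: half_spinor_modules_def bilinear_map_def)
  then interpret r: Vector_Spaces.linear "(*s)" "(*s)" "c v"
    + l: Vector_Spaces.linear "(*s)" "(*s)" "\<lambda>v. c v x" for v x by auto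
  show "c v (x + y) = c v x + c v y" "c v (a *s x) = a *s c v x"
    "c (v + w) x = c v x + c w x" "c (a *s v) x = a *s c v x"
    "c v (- x) = - c v x" "c v (x - y) = c v x - c v y" "c v 0 = 0"
    "c (- v) x = - c v x" "c (v - w) x = c v x - c w x" "c 0 x = 0"
    by (rule r.add r.scale l.add l.scale r.neg r.diff r.zero l.neg l.diff l.zero)+
qed

lemma c_sum: "c v (\<Sum>i\<in>I. x i) = (\<Sum>i\<in>I. c v (x i))" "c (\<Sum>i\<in>I. u i) s = (\<Sum>i\<in>I. c (u i) s)"
  by (induction I rule: infinite_finite_induct) simp_all

lemmas c'_simps [simp] = spinor_modules.c_simps[OF swap]
lemmas c'_sum = spinor_modules.c_sum[OF swap]

lemma square: "c' v (c v s) = q v *s s" "c v (c' v s) = q v *s s"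
  using modules by (auto simp: half_spinor_modules_def)

abbreviation b where "b \<equiv> polar q"

lemma clifford: "c' u (c w s) + c' w (c u s) = b u w *s s"
proof -
  have "q (u + w) *s s = c' (u + w) (c (u + w) s)" by (simp only: square)
  also have "\<dots> = q u *s s + q w *s s + (c' u (c w s) + c' w (c u s))"
    by (simp only: c_simps c'_simps) (simp add: square algebra_simps)
  finally show ?thesis by (simp add: polar_def vector_sub_rdistrib algebra_simps)
qed

lemmas clifford' = spinor_modules.clifford[OF swap]

text \<open>A spinor with a coordinate equal to one detects that the polar form is bilinear.\<close>

lemma b_eq: "b u w = (c' u (c w (axis 0 1)) + c' w (c u (axis 0 1))) $ 0"
  unfolding clifford by simp

lemma b_simps [simp]:
  "b (u + v) w = b u w + b v w" "b (a *s u) w = a * b u w"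
  "b w (u + v) = b w u + b w v" "b w (a *s u) = a * b w u"
  "b (u - v) w = b u w - b v w" "b w (u - v) = b w u - b w v"
  "b (- u) w = - b u w" "b w (- u) = - b w u" "b 0 w = 0" "b w 0 = 0"
  unfolding b_eq by (simp_all add: algebra_simps)

lemma b_sum: "b (\<Sum>i\<in>I. v i) w = (\<Sum>i\<in>I. b (v i) w)" "b w (\<Sum>i\<in>I. v i) = (\<Sum>i\<in>I. b w (v i))"
  by (induction I rule: infinite_finite_induct) simp_all

lemma b_commute: "b u w = b w u"
  by (simp add: polar_def add.commute)

lemma q_eq: "b v v = 2 * q v"
proof -
  have "q v *s axis 0 1 = c' v (c v (axis 0 (1::'k)))" by (rule square(1)[symmetric])
  hence "q v = c' v (c v (axis 0 1)) $ 0"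
    by (metis (no_types) axis_nth mult.right_neutral vector_smult_component)
  thus ?thesis unfolding b_eq by simp
qed

lemma q_scale: "q (a *s v) = a ^ 2 * q v"
proof -
  have "b (a *s v) (a *s v) = a ^ 2 * b v v" by (simp add: power2_eq_square mult.assoc)
  thus ?thesis unfolding q_eq by simp
qed

lemma q_add: "q (u + v) = q u + q v + b u v"
  by (simp add: polar_def)

lemma b_nondegenerate: "(\<And>w. b v w = 0) \<Longrightarrow> v = 0"
  using nondegenerate by (auto simp: nondegenerate_quadratic_form_def)

text \<open>The map \<open>v \<mapsto> b v\<close> to the dual space is injective between spaces of the same finite dimension.\<close>

lemma representable:
  assumes "Vector_Spaces.linear (*s) (*) \<phi>"
  shows "\<exists>v. \<forall>w. b v w = \<phi> w"
proof -
  interpret \<phi>: Vector_Spaces.linear "(*s)" "(*)" \<phi> by (rule assms)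
  define L where "L = (\<lambda>v. \<chi> i. b v (axis i 1))"
  have lin: "Vector_Spaces.linear (*s) (*s) L"
    by unfold_locales (auto simp: L_def vec_eq_iff)
  have expand: "b v w = (\<Sum>i\<in>UNIV. w $ i * L v $ i)" for v w
    by (subst basis_expansion[of w, symmetric]) (simp add: L_def b_sum)
  have "inj L"
    unfolding vec.linear_inj_iff_eq_0[OF lin]
    using expand by (auto intro: b_nondegenerate)
  hence "surj L" using vec.linear_inj_imp_surj[OF lin] by simp
  then obtain v where "L v = (\<chi> i. \<phi> (axis i 1))" by (metis surjD)
  hence "b v w = \<phi> w" for w
    by (subst (2) basis_expansion[of w, symmetric]) (simp add: expand \<phi>.sum \<phi>.scale)
  thus ?thesis by blast
qed

lemma q_nonzero: "\<exists>y. q y \<noteq> 0"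
proof (rule ccontr)
  assume "\<not> ?thesis"
  hence "axis 0 1 = (0 :: 'k ^ 10)" by (intro b_nondegenerate) (simp add: polar_def)
  thus False by (simp add: axis_eq_0_iff)
qed

text \<open>The invariance of the pairing under \<open>Spin(V)\<close> says that \<open>c u c' w\<close> and \<open>c' w c u\<close> are adjoint
  for unit vectors. As the non-isotropic vectors span \<open>V\<close>, this holds for all vectors.\<close>

lemma adjoint: "c u (c' w f) \<star> s = f \<star> c' w (c u s)"
proof -
  have unit: "c u (c' w f) \<star> s = f \<star> c' w (c u s)" if "q u = 1" "q w = 1" for u w f s
  proof -
    have "c' u (c w (c' w (c u s))) = s" using that by (simp add: square)
    moreover have "c u (c' w f) \<star> c' u (c w (c' w (c u s))) = f \<star> c' w (c u s)"
      using modules that unfolding half_spinor_modules_def by blast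
    ultimately show ?thesis by (simp only:)
  qed
  have scaled: "\<exists>a y. u = a *s y \<and> q y = 1" if u: "q u \<noteq> 0" for u
  proof -
    obtain r where r: "r ^ 2 = q u" using nth_root_exists[of 2 "q u"] by auto
    hence r0: "r \<noteq> 0" using u by auto
    have "u = r *s (inverse r *s u)" using r0 by simp
    moreover have "q (inverse r *s u) = 1" unfolding q_scale r[symmetric] using r0 by (simp add: field_simps)
    ultimately show ?thesis by blast
  qed
  have nonisotropic: "c u (c' w f) \<star> s = f \<star> c' w (c u s)" if nz: "q u \<noteq> 0" "q w \<noteq> 0" for u w f s
  proof -
    obtain a y where "u = a *s y" "q y = 1" using scaled nz(1) by blast
    moreover obtain a' y' where "w = a' *s y'" "q y' = 1" using scaled nz(2) by blast
    ultimately show ?thesis by (simp add: unit)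
  qed
  have spans: "\<exists>x y. u = x - y \<and> q x \<noteq> 0 \<and> q y \<noteq> 0" for u
  proof -
    obtain y where y: "q y \<noteq> 0" using q_nonzero by blast
    show ?thesis
    proof (cases "q (u + y) = 0 \<and> q (u + 2 *s y) = 0")
      case False
      hence "(q (u + y) \<noteq> 0 \<and> q y \<noteq> 0 \<and> u = (u + y) - y) \<or>
        (q (u + 2 *s y) \<noteq> 0 \<and> q (2 *s y) \<noteq> 0 \<and> u = (u + 2 *s y) - 2 *s y)"
        using y by (auto simp: q_scale)
      thus ?thesis by blast
    next
      case True
      \<comment> \<open>Then \<open>q (u + a y) = (a - 1) (a - 2) q y\<close>.\<close>
      hence "q u + q y + b u y = 0" "q u + 4 * q y + 2 * b u y = 0" by (simp_all add: q_add q_scale)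
      hence "b u y = - 3 * q y" "q u = 2 * q y" by algebra+
      hence "q (u + 3 *s y) = 2 * q y" by (simp add: q_add q_scale)
      moreover have "q (3 *s y) \<noteq> 0" using y by (simp add: q_scale)
      ultimately have "q (u + 3 *s y) \<noteq> 0 \<and> q (3 *s y) \<noteq> 0 \<and> u = (u + 3 *s y) - 3 *s y"
        using y by simp
      thus ?thesis by blast
    qed
  qed
  obtain x y where "u = x - y" "q x \<noteq> 0" "q y \<noteq> 0" using spans by blast
  moreover obtain x' y' where "w = x' - y'" "q x' \<noteq> 0" "q y' \<noteq> 0" using spans by blast
  ultimately show ?thesis by (simp add: nonisotropic)
qed

end

lemma lin_indep_spans_UNIV:
  fixes v :: "nat \<Rightarrow> 'k::field ^ 'm"
  assumes "lin_indep n v" "CARD('m) = n"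
  shows "\<exists>x. u = (\<Sum>i<n. x i *s v i)"
  by (rule lin_indep_spans[OF assms(1) vec.subspace_UNIV]) (simp_all only: dim_UNIV_vec assms UNIV_I)

section \<open>Hyperbolic bases and Fock spaces\<close>

context spinor_modules begin

definition hyperbolic :: "nat \<Rightarrow> (nat \<Rightarrow> 'k ^ 10) \<Rightarrow> (nat \<Rightarrow> 'k ^ 10) \<Rightarrow> bool" where
  "hyperbolic n e f \<longleftrightarrow> (\<forall>i<n. \<forall>j<n. b (e i) (e j) = 0 \<and> b (f i) (f j) = 0 \<and>
     b (e i) (f j) = (if i = j then 1 else 0))"

lemma hyperbolicD:
  assumes "hyperbolic n e f" "i < n" "j < n"
  shows "b (e i) (e j) = 0" "b (f i) (f j) = 0" "b (e i) (f j) = (if i = j then 1 else 0)"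
    "b (f i) (e j) = (if i = j then 1 else 0)"
  using assms b_commute[of "f i" "e j"] by (auto simp: hyperbolic_def)

text \<open>The projection \<open>\<pi>\<close> to the orthogonal complement of the pairs found so far has rank at least two, and a plane
  contains an isotropic vector because the field is algebraically closed. A vector with product one is
  made isotropic by subtracting a multiple.\<close>

lemma exists_hyperbolic: "n \<le> 5 \<Longrightarrow> \<exists>e f. hyperbolic n e f"
proof (induction n)
  case 0
  show ?case by (simp add: hyperbolic_def)
next
  case (Suc n)
  then obtain e f where ef: "hyperbolic n e f" by auto
  note h = hyperbolicD[OF ef]
  define W where "W = e ` {..<n} \<union> f ` {..<n}"
  define \<pi> where "\<pi> v = v - (\<Sum>i<n. b v (f i) *s e i + b v (e i) *s f i)" for v
  have b_\<pi>: "b (e j) (\<pi> v) = 0" "b (f j) (\<pi> v) = 0" if "j < n" for j v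
    using that by (simp_all add: \<pi>_def b_sum h mult_delta_right mult_delta_left sum.distrib)
      (simp_all add: b_commute)
  have b_\<pi>': "b (\<pi> v) (e j) = 0" "b (\<pi> v) (f j) = 0" if "j < n" for j v
    using b_\<pi>[OF that] b_commute by simp_all
  have \<pi>W: "v - \<pi> v \<in> vec.span W" for v
    unfolding \<pi>_def W_def by (auto intro!: vec.span_sum vec.span_add vec.span_scale intro: vec.span_base)
  have finW: "finite W" by (simp add: W_def)
  have "card W \<le> card (e ` {..<n}) + card (f ` {..<n})" unfolding W_def by (rule card_Un_le)
  also have "\<dots> \<le> n + n" by (intro add_mono) (metis card_image_le card_lessThan finite_lessThan)+
  finally have cardW: "card W \<le> 8" using Suc.prems by simp
  have ex: "\<exists>x. x \<notin> vec.span S" if "finite S" "card S < 10" for S :: "('k ^ 10) set"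
  proof (rule ccontr)
    assume "\<not> ?thesis"
    hence "UNIV \<subseteq> vec.span S" by auto
    hence "vec.dim (UNIV :: ('k ^ 10) set) \<le> card S" using that(1) vec.dim_le_card by blast
    thus False using that(2) unfolding dim_UNIV_vec by simp
  qed
  obtain x where x: "x \<notin> vec.span W" using ex[OF finW] cardW by auto
  have "card (insert x W) \<le> Suc (card W)" using finW by (simp add: card_insert_if)
  then obtain z where z: "z \<notin> vec.span (insert x W)" using ex[of "insert x W"] finW cardW by auto
  have \<pi>_lin: "\<pi> (v + a *s w) = \<pi> v + a *s \<pi> w" for v w a
    by (simp add: \<pi>_def sum.distrib vec.scale_sum_right vec.scale_right_distrib vec.scale_right_diff_distrib
        vec.scale_left_distrib)
  have "\<exists>u. \<pi> u \<noteq> 0 \<and> q (\<pi> u) = 0"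
  proof (cases "q (\<pi> x) = 0")
    case True
    have "\<pi> x \<noteq> 0" using \<pi>W[of x] x by auto
    thus ?thesis using True by blast
  next
    case False
    hence "degree [:q (\<pi> z), b (\<pi> z) (\<pi> x), q (\<pi> x):] > 0" by simp
    then obtain a where "poly [:q (\<pi> z), b (\<pi> z) (\<pi> x), q (\<pi> x):] a = 0"
      using alg_closed_imp_poly_has_root by blast
    hence "q (\<pi> (z + a *s x)) = 0"
      unfolding \<pi>_lin q_add q_scale by (simp add: algebra_simps power2_eq_square)
    moreover have "\<pi> (z + a *s x) \<noteq> 0"
    proof
      assume "\<pi> (z + a *s x) = 0"
      hence "z + a *s x \<in> vec.span W" using \<pi>W[of "z + a *s x"] by simp
      hence "z + a *s x \<in> vec.span (insert x W)" using vec.span_mono[of W "insert x W"] by blast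
      moreover have "a *s x \<in> vec.span (insert x W)" by (intro vec.span_scale vec.span_base) simp
      ultimately have "(z + a *s x) - a *s x \<in> vec.span (insert x W)" by (rule vec.span_diff)
      thus False using z by simp
    qed
    ultimately show ?thesis by blast
  qed
  then obtain u where u: "\<pi> u \<noteq> 0" "q (\<pi> u) = 0" by blast
  obtain y where y: "b (\<pi> u) y \<noteq> 0" using b_nondegenerate u(1) by blast
  define w where "w = \<pi> (inverse (b (\<pi> u) y) *s y)"
  have "b (\<pi> u) w = b (\<pi> u) (inverse (b (\<pi> u) y) *s y)"
    unfolding w_def \<pi>_def[of "_ *s y"] by (simp add: b_sum b_\<pi>')
  hence uw: "b (\<pi> u) w = 1" using y by simp
  define v where "v = w - q w *s \<pi> u"
  have uu: "b (\<pi> u) (\<pi> u) = 0" using q_eq u(2) by simp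
  have wu: "b w (\<pi> u) = 1" using uw b_commute by simp
  have uv: "b (\<pi> u) v = 1" unfolding v_def by (simp add: uw uu)
  have vv: "b v v = 0" unfolding v_def by (simp add: uw uu wu q_eq[of w])
  have vj: "b (e j) v = 0" "b (f j) v = 0" "b v (e j) = 0" "b v (f j) = 0" if "j < n" for j
    using that by (simp_all add: v_def w_def b_\<pi> b_\<pi>')
  have "hyperbolic (Suc n) (e(n := \<pi> u)) (f(n := v))"
    unfolding hyperbolic_def
    by (auto simp: less_Suc_eq h b_\<pi> b_\<pi>' uu uv vv vj)
  thus ?case by blast
qed

lemma hyperbolic_expand:
  assumes "hyperbolic 5 e f"
  shows "v = (\<Sum>i<5. b v (f i) *s e i + b v (e i) *s f i)"
proof -
  note h = hyperbolicD[OF assms]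
  define g where "g k = (if k < 5 then e k else f (k - 5))" for k
  have split: "(\<Sum>k<10. x k *s g k) = (\<Sum>i<5. x i *s e i) + (\<Sum>i<5. x (i + 5) *s f i)" for x
    by (simp add: lessThan_nat_numeral g_def)
  have be: "b (\<Sum>k<10. x k *s g k) (f j) = x j" "b (\<Sum>k<10. x k *s g k) (e j) = x (j + 5)"
    if "j < 5" for x j
    using that unfolding split by (simp_all add: b_sum h mult_delta_right mult_delta_left sum.distrib)
  have "lin_indep 10 g"
    unfolding lin_indep_def
  proof (intro allI impI)
    fix x k assume x: "(\<Sum>k<10. x k *s g k) = 0" and k: "k < (10::nat)"
    show "x k = 0"
    proof (cases "k < 5")
      case True
      thus ?thesis using be(1)[of k x] unfolding x by simp
    next
      case False
      define i where "i = k - 5"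
      have "k = i + 5" "i < 5" using k False by (auto simp: i_def)
      thus ?thesis using be(2)[of i x] unfolding x by simp
    qed
  qed
  then obtain x where x: "v = (\<Sum>k<10. x k *s g k)"
    using lin_indep_spans_UNIV[of 10 g v] by auto
  have "v = (\<Sum>i<5. x i *s e i) + (\<Sum>i<5. x (i + 5) *s f i)" using x split by simp
  also have "\<dots> = (\<Sum>i<5. b v (f i) *s e i + b v (e i) *s f i)"
    unfolding sum.distrib by (intro arg_cong2[where f="(+)"] sum.cong) (simp_all add: x be)
  finally show ?thesis .
qed

lemma isotropic_b: "U \<in> OGr5 q \<Longrightarrow> u \<in> U \<Longrightarrow> v \<in> U \<Longrightarrow> b u v = 0"
  by (auto simp: OGr5_def grass_def polar_def vec.subspace_add)

lemma exists_dual_family: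
  assumes "lin_indep n e"
  shows "\<exists>g. \<forall>i<n. \<forall>j. b (e i) (g j) = (if i = j then 1 else 0)"
proof -
  have "\<exists>v. \<forall>i<n. b v (e i) = (if i = j then 1 else 0)" for j
    using dual_functional[OF assms, of j] representable by metis
  then obtain g where "\<And>j. \<forall>i<n. b (g j) (e i) = (if i = j then 1 else 0)" by metis
  thus ?thesis using b_commute by metis
qed

text \<open>A family dual to \<open>e\<close> becomes isotropic after subtracting half of its Gram matrix.\<close>

lemma isotropic_family_extends:
  assumes e: "lin_indep n e" and isotropic: "\<And>i j. i < n \<Longrightarrow> j < n \<Longrightarrow> b (e i) (e j) = 0"
  shows "\<exists>f. hyperbolic n e f"
proof -
  obtain g where g: "\<And>i j. i < n \<Longrightarrow> b (e i) (g j) = (if i = j then 1 else 0)"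
    using exists_dual_family[OF e] by blast
  hence g': "\<And>i j. i < n \<Longrightarrow> b (g j) (e i) = (if i = j then 1 else 0)" using b_commute by metis
  define f where "f j = g j - (\<Sum>k<n. (b (g j) (g k) / 2) *s e k)" for j
  have "hyperbolic n e f"
    unfolding hyperbolic_def
  proof (intro allI impI conjI)
    fix i j assume ij: "i < n" "j < n"
    show "b (e i) (e j) = 0" using isotropic ij by simp
    show "b (e i) (f j) = (if i = j then 1 else 0)" using g ij by (simp add: f_def b_sum isotropic)
    show "b (f i) (f j) = 0"
      using ij by (simp add: f_def b_sum isotropic g g' mult_delta_right mult_delta_left b_commute)
  qed
  thus ?thesis by blast
qed

end

lemma less_16_cases:
  fixes k :: nat
  assumes "k < 16" "P 0" "P 1" "P 2" "P 3" "P 4" "P 5" "P 6" "P 7" "P 8" "P 9" "P 10" "P 11" "P 12"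
    "P 13" "P 14" "P 15"
  shows "P k"
proof -
  have "k \<in> {..<16}" using assms(1) by simp
  hence "k = 0 \<or> k = 1 \<or> k = 2 \<or> k = 3 \<or> k = 4 \<or> k = 5 \<or> k = 6 \<or> k = 7 \<or> k = 8 \<or> k = 9
    \<or> k = 10 \<or> k = 11 \<or> k = 12 \<or> k = 13 \<or> k = 14 \<or> k = 15"
    by (simp add: lessThan_nat_numeral) blast
  thus ?thesis using assms(2-) by (elim disjE) simp_all
qed

text \<open>In a frame the vectors \<open>e\<^sub>i\<close> act as annihilation operators, the \<open>f\<^sub>i\<close> as creation operators and \<open>t\<close> is the
  vacuum. The vacuum lies in the module on which \<open>c'\<close> acts; frames whose vacuum lies in the other module
  are frames for the data with \<open>c\<close> and \<open>c'\<close> exchanged.\<close>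

locale vacuum_frame = spinor_modules +
  fixes e f :: "nat \<Rightarrow> 'a ^ 10" and t :: "'a ^ 16"
  assumes hyp: "hyperbolic 5 e f" and t_nonzero: "t \<noteq> 0" and vacuum: "\<And>i. i < 5 \<Longrightarrow> c' (e i) t = 0"
begin

lemmas hyp_b [simp] = hyperbolicD[OF hyp]

lemma annihilate_create:
  assumes "i < 5" "j < 5"
  shows "c (e i) (c' (f j) x) = (if i = j then x else 0) - c (f j) (c' (e i) x)"
    "c' (e i) (c (f j) x) = (if i = j then x else 0) - c' (f j) (c (e i) x)"
  using clifford[of "e i" "f j" x] clifford'[of "e i" "f j" x] assms by (auto simp: eq_diff_eq)

lemma create_create:
  assumes "i < 5" "j < 5"
  shows "c (f i) (c' (f j) x) = - c (f j) (c' (f i) x)" "c' (f i) (c (f j) x) = - c' (f j) (c (f i) x)"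
  using clifford[of "f i" "f j" x] clifford'[of "f i" "f j" x] assms by (auto simp: eq_neg_iff_add_eq_0)

lemma create_twice:
  assumes "i < 5"
  shows "c (f i) (c' (f i) x) = 0" "c' (f i) (c (f i) x) = 0"
  using assms q_eq[of "f i"] by (simp_all add: square)

text \<open>As rewrite rules these sort products of creation operators. Together with \<open>annihilate_create\<close>
  they bring every product applied to the vacuum to a normal form.\<close>

lemma create_sort:
  assumes "j < i" "i < 5"
  shows "c (f i) (c' (f j) x) = - c (f j) (c' (f i) x)" "c' (f i) (c (f j) x) = - c' (f j) (c (f i) x)"
  using create_create[of i j] assms by auto

lemma create_sort_twice:
  assumes "i < 5" "j < 5"
  shows "c (f i) (c' (f j) (c (f i) x)) = 0" "c' (f i) (c (f j) (c' (f i) x)) = 0"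
  by (simp_all add: create_create[OF assms] create_twice assms)

lemmas normal_order = annihilate_create create_sort create_twice create_sort_twice vacuum

abbreviation A where "A i \<equiv> c' (f i) t"
abbreviation B where "B i j \<equiv> c (f i) (c' (f j) t)"
abbreviation C where "C i j k \<equiv> c' (f i) (c (f j) (c' (f k) t))"
abbreviation D where "D i j k l \<equiv> c (f i) (c' (f j) (c (f k) (c' (f l) t)))"
abbreviation E where "E \<equiv> c' (f 0) (c (f 1) (c' (f 2) (c (f 3) (c' (f 4) t))))"

text \<open>The monomials of even degree span one half-spinor module and those of odd degree the other. The signs
  make the two bases dual to each other; the order is: degree zero (respectively five), the ten
  bivectors \<open>f\<^sub>i f\<^sub>j t\<close>, and the five monomials of degree four.\<close>

definition \<tau> :: "nat \<Rightarrow> 'a ^ 16" where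
  "\<tau> = (!) [t, B 0 1, B 0 2, B 0 3, B 0 4, B 1 2, B 1 3, B 1 4, B 2 3, B 2 4, B 3 4,
     D 1 2 3 4, - D 0 2 3 4, D 0 1 3 4, - D 0 1 2 4, D 0 1 2 3]"

definition \<sigma> :: "nat \<Rightarrow> 'a ^ 16" where
  "\<sigma> = (!) [E, - C 2 3 4, C 1 3 4, - C 1 2 4, C 1 2 3, - C 0 3 4, C 0 2 4, - C 0 2 3,
     - C 0 1 4, C 0 1 3, - C 0 1 2, A 0, A 1, A 2, A 3, A 4]"

text \<open>Products of annihilation operators isolate the coefficients, beginning with the monomial of top degree.
  As the modules have dimension sixteen, the sixteen independent vectors are then a basis.\<close>

lemma \<sigma>_indep: "lin_indep 16 \<sigma>"
  unfolding lin_indep_def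
proof (intro allI impI)
  fix x k assume "(\<Sum>k<16. x k *s \<sigma> k) = 0" and k: "k < (16::nat)"
  hence Z: "x 0 *s E - x 1 *s C 2 3 4 + x 2 *s C 1 3 4 - x 3 *s C 1 2 4 + x 4 *s C 1 2 3
    - x 5 *s C 0 3 4 + x 6 *s C 0 2 4 - x 7 *s C 0 2 3 - x 8 *s C 0 1 4 + x 9 *s C 0 1 3
    - x 10 *s C 0 1 2 + x 11 *s A 0 + x 12 *s A 1 + x 13 *s A 2 + x 14 *s A 3 + x 15 *s A 4 = 0"
    (is "?Z = 0") by (simp add: lessThan_nat_numeral \<sigma>_def algebra_simps)
  note [simp] = normal_order t_nonzero and [simp del] = One_nat_def
  have three: "c (e l) (c' (e j) (c (e i) ?Z)) = 0" for i j l unfolding Z by simp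
  have "c (e 4) (c' (e 3) (c (e 2) (c' (e 1) (c (e 0) ?Z)))) = 0" unfolding Z by simp
  hence x0: "x 0 = 0" by simp
  note [simp] = x0
  have x1: "x 1 = 0" using three[of 4 3 2] by simp
  have x2: "x 2 = 0" using three[of 4 3 1] by simp
  have x3: "x 3 = 0" using three[of 4 2 1] by simp
  have x4: "x 4 = 0" using three[of 3 2 1] by simp
  have x5: "x 5 = 0" using three[of 4 3 0] by simp
  have x6: "x 6 = 0" using three[of 4 2 0] by simp
  have x7: "x 7 = 0" using three[of 3 2 0] by simp
  have x8: "x 8 = 0" using three[of 4 1 0] by simp
  have x9: "x 9 = 0" using three[of 3 1 0] by simp
  have x10: "x 10 = 0" using three[of 2 1 0] by simp
  note [simp] = x1 x2 x3 x4 x5 x6 x7 x8 x9 x10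
  have one: "c (e i) ?Z = 0" for i unfolding Z by simp
  have "x 11 = 0" using one[of 0] by simp
  moreover have "x 12 = 0" using one[of 1] by simp
  moreover have "x 13 = 0" using one[of 2] by simp
  moreover have "x 14 = 0" using one[of 3] by simp
  moreover have "x 15 = 0" using one[of 4] by simp
  ultimately show "x k = 0" by (intro less_16_cases[OF k, of "\<lambda>k. x k = 0"]) simp_all
qed

text \<open>As \<open>e\<^sub>j\<close> annihilates \<open>x\<close>, the vector \<open>x\<close> is \<open>e\<^sub>j f\<^sub>j x\<close>, and the adjoint of \<open>e\<^sub>j f\<^sub>j\<close> is \<open>f\<^sub>j e\<^sub>j\<close>.\<close>

lemma annihilated_pair_eq_0:
  assumes "j < 5" "c' (e j) x = 0" "c (e j) s = 0"
  shows "x \<star> s = 0"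
proof -
  have "x = c (e j) (c' (f j) x)" using assms by (simp add: normal_order)
  hence "x \<star> s = c (e j) (c' (f j) x) \<star> s" by simp
  thus ?thesis using assms by (simp add: adjoint)
qed

lemma annihilated_pair_A:
  assumes "\<And>i. i < 5 \<Longrightarrow> c' (e i) x = 0" "i < 5"
  shows "x \<star> A i = 0"
  by (rule annihilated_pair_eq_0[of "if i = 0 then 1 else 0"]) (use assms in \<open>auto simp: annihilate_create vacuum\<close>)

lemma annihilated_pair_C:
  assumes x: "\<And>i. i < 5 \<Longrightarrow> c' (e i) x = 0" and "i < 5" "j < 5" "k < 5"
  shows "x \<star> C i j k = 0"
proof -
  have "card {i, j, k} < card {..<5::nat}" by (simp add: card_insert_if)
  hence "\<not> {..<5} \<subseteq> {i, j, k}" using card_mono[of "{i, j, k}" "{..<5}"] by (meson finite.intros leD)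
  then obtain l where "l < 5" "l \<noteq> i" "l \<noteq> j" "l \<noteq> k" by blast
  thus ?thesis using assms by (intro annihilated_pair_eq_0[of l]) (auto simp: annihilate_create vacuum)
qed

lemmas t_pair_A = annihilated_pair_A[OF vacuum] and t_pair_C = annihilated_pair_C[OF vacuum]

lemma biorthogonal:
  assumes "j < 16" "k < 16"
  shows "\<tau> j \<star> \<sigma> k = (if j = k then t \<star> E else 0)"
  by (rule less_16_cases[OF assms(1)]; rule less_16_cases[OF assms(2)];
      simp add: \<tau>_def \<sigma>_def adjoint normal_order t_pair_A t_pair_C)

text \<open>Otherwise the vacuum would be orthogonal to the whole basis \<open>\<sigma>\<close>.\<close>

lemma t_pair_E: "t \<star> E \<noteq> 0"
proof
  assume zero: "t \<star> E = 0"
  have "t \<star> s = 0" for s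
  proof -
    obtain x where s: "s = (\<Sum>k<16. x k *s \<sigma> k)"
      using lin_indep_spans_UNIV[OF \<sigma>_indep] by auto
    have "t \<star> \<sigma> k = 0" if "k < 16" for k
      using biorthogonal[of 0 k] that zero by (simp add: \<tau>_def split: if_splits)
    thus ?thesis unfolding s by (simp add: scalar_product_sum)
  qed
  hence "t = 0" by (intro scalar_product_eqI) simp
  thus False using t_nonzero by simp
qed

lemma \<sigma>_spans: "\<exists>x. s = (\<Sum>k<16. x k *s \<sigma> k)"
  using lin_indep_spans_UNIV[OF \<sigma>_indep] by simp

lemma pair_\<sigma>_eqI:
  assumes "\<And>k. k < 16 \<Longrightarrow> x \<star> \<sigma> k = y \<star> \<sigma> k"
  shows "x = y"
proof (rule scalar_product_eqI)
  fix s
  obtain z where "s = (\<Sum>k<16. z k *s \<sigma> k)" using \<sigma>_spans by blast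
  thus "x \<star> s = y \<star> s" using assms by (simp add: scalar_product_sum)
qed

text \<open>A vector killed by all \<open>e\<^sub>i\<close> is orthogonal to all elements of \<open>\<sigma>\<close> except the one of top degree. So a maximal
  isotropic space kills a single line.\<close>

lemma annihilated_eq_vacuum:
  assumes "\<And>i. i < 5 \<Longrightarrow> c' (e i) x = 0"
  shows "x = (x \<star> E / (t \<star> E)) *s t"
proof (rule pair_\<sigma>_eqI)
  fix k :: nat assume "k < 16"
  thus "x \<star> \<sigma> k = (x \<star> E / (t \<star> E)) *s t \<star> \<sigma> k"
    by (rule less_16_cases)
      (simp_all add: \<sigma>_def annihilated_pair_A[OF assms] annihilated_pair_C[OF assms] t_pair_A t_pair_C t_pair_E del: One_nat_def)
qed

end

lemma nth_Cons_1 [simp]: "(x # xs) ! 1 = xs ! 0"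
  by simp

lemma lessThan_1 [simp]: "{..<1::nat} = {0}"
  by auto

(* Monomials carry numerals as indices; the index 1 must stay in this form too. *)
declare One_nat_def [simp del]

section \<open>The quadratic map from spinors to vectors in coordinates\<close>

text \<open>In coordinates with respect to \<open>\<tau>\<close>, these are \<open>x \<star> c' (f i) y\<close> and, below, \<open>x \<star> c' (e i) y\<close>. For a spinor with
  components \<open>a\<close>, \<open>\<omega>\<close>, \<open>p\<close> in degrees zero, two and four they are the polar forms of the entries of
  \<open>a p - Pf(\<omega>)\<close> and \<open>\<omega> p\<close>.\<close>

definition create_form :: "(nat \<Rightarrow> 'k) \<Rightarrow> (nat \<Rightarrow> 'k) \<Rightarrow> nat \<Rightarrow> 'k::comm_ring_1" where
  "create_form X Y = (!)
    [X 11 * Y 0 - X 10 * Y 5 + X 9 * Y 6 - X 8 * Y 7 - X 7 * Y 8 + X 6 * Y 9 - X 5 * Y 10 + X 0 * Y 11,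
     X 12 * Y 0 + X 10 * Y 2 - X 9 * Y 3 + X 8 * Y 4 + X 4 * Y 8 - X 3 * Y 9 + X 2 * Y 10 + X 0 * Y 12,
     X 13 * Y 0 - X 10 * Y 1 + X 7 * Y 3 - X 6 * Y 4 - X 4 * Y 6 + X 3 * Y 7 - X 1 * Y 10 + X 0 * Y 13,
     X 14 * Y 0 + X 9 * Y 1 - X 7 * Y 2 + X 5 * Y 4 + X 4 * Y 5 - X 2 * Y 7 + X 1 * Y 9 + X 0 * Y 14,
     X 15 * Y 0 - X 8 * Y 1 + X 6 * Y 2 - X 5 * Y 3 - X 3 * Y 5 + X 2 * Y 6 - X 1 * Y 8 + X 0 * Y 15]"

definition annihilate_form :: "(nat \<Rightarrow> 'k) \<Rightarrow> (nat \<Rightarrow> 'k) \<Rightarrow> nat \<Rightarrow> 'k::comm_ring_1" where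
  "annihilate_form X Y = (!)
    [X 12 * Y 1 + X 13 * Y 2 + X 14 * Y 3 + X 15 * Y 4 + X 1 * Y 12 + X 2 * Y 13 + X 3 * Y 14 + X 4 * Y 15,
     - X 11 * Y 1 + X 13 * Y 5 + X 14 * Y 6 + X 15 * Y 7 - X 1 * Y 11 + X 5 * Y 13 + X 6 * Y 14 + X 7 * Y 15,
     - X 11 * Y 2 - X 12 * Y 5 + X 14 * Y 8 + X 15 * Y 9 - X 2 * Y 11 - X 5 * Y 12 + X 8 * Y 14 + X 9 * Y 15,
     - X 11 * Y 3 - X 12 * Y 6 - X 13 * Y 8 + X 15 * Y 10 - X 3 * Y 11 - X 6 * Y 12 - X 8 * Y 13 + X 10 * Y 15,
     - X 11 * Y 4 - X 12 * Y 7 - X 13 * Y 9 - X 14 * Y 10 - X 4 * Y 11 - X 7 * Y 12 - X 9 * Y 13 - X 10 * Y 14]"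

definition quartic :: "(nat \<Rightarrow> 'k) \<Rightarrow> (nat \<Rightarrow> 'k) \<Rightarrow> 'k::comm_ring_1" where
  "quartic X Y = (\<Sum>i<5. create_form X X i * annihilate_form Y Y i + annihilate_form X X i * create_form Y Y i)"

lemma less_5_cases:
  fixes k :: nat
  assumes "k < 5" "P 0" "P 1" "P 2" "P 3" "P 4"
  shows "P k"
proof -
  have "k = 0 \<or> k = 1 \<or> k = 2 \<or> k = 3 \<or> k = 4" using assms(1) by linarith
  thus ?thesis using assms(2-) by (elim disjE) simp_all
qed

lemma create_form_commute: "i < 5 \<Longrightarrow> create_form X Y i = create_form Y X i"
  by (erule less_5_cases; simp add: create_form_def algebra_simps)

lemma annihilate_form_commute: "i < 5 \<Longrightarrow> annihilate_form X Y i = annihilate_form Y X i"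
  by (erule less_5_cases; simp add: annihilate_form_def algebra_simps)

text \<open>The vector attached to a spinor has the components \<open>a p - Pf(\<omega>)\<close> and \<open>\<omega> p\<close>, and it is isotropic since
  \<open>p\<close> is orthogonal to \<open>\<omega> p\<close> and \<open>Pf(\<omega>)\<close> lies in the kernel of \<open>\<omega>\<close>.\<close>

lemma create_annihilate_isotropic: "(\<Sum>i<5. create_form X X i * annihilate_form X X i) = 0"
  by (simp add: lessThan_nat_numeral create_form_def annihilate_form_def algebra_simps)

lemma create_form_add:
  "i < 5 \<Longrightarrow> create_form (\<lambda>k. X k + a * Y k) (\<lambda>k. X k + a * Y k) i =
     create_form X X i + 2 * a * create_form X Y i + a * a * create_form Y Y i"
  by (erule less_5_cases; simp add: create_form_def algebra_simps)

lemma annihilate_form_add: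
  "i < 5 \<Longrightarrow> annihilate_form (\<lambda>k. X k + a * Y k) (\<lambda>k. X k + a * Y k) i =
     annihilate_form X X i + 2 * a * annihilate_form X Y i + a * a * annihilate_form Y Y i"
  by (erule less_5_cases; simp add: annihilate_form_def algebra_simps)

lemma quartic_polarized:
  fixes X Y :: "nat \<Rightarrow> 'k::field_char_0"
  shows "quartic X Y + 4 * (\<Sum>i<5. create_form X Y i * annihilate_form X Y i) = 0"
proof -
  define G where "G a = (\<Sum>i<5. create_form (\<lambda>k. X k + a * Y k) (\<lambda>k. X k + a * Y k) i *
    annihilate_form (\<lambda>k. X k + a * Y k) (\<lambda>k. X k + a * Y k) i)" for a
  have "G 1 + G (- 1) = 2 * ((\<Sum>i<5. create_form X X i * annihilate_form X X i)
      + (\<Sum>i<5. create_form Y Y i * annihilate_form Y Y i)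
      + (quartic X Y + 4 * (\<Sum>i<5. create_form X Y i * annihilate_form X Y i)))"
    unfolding G_def quartic_def sum_distrib_left sum.distrib[symmetric]
    by (rule sum.cong) (simp_all only: create_form_add annihilate_form_add lessThan_iff, simp add: algebra_simps)
  hence "2 * (quartic X Y + 4 * (\<Sum>i<5. create_form X Y i * annihilate_form X Y i)) = 0"
    unfolding G_def create_annihilate_isotropic by (simp only: add_0_left)
  thus ?thesis unfolding mult_eq_0_iff by simp
qed

text \<open>The scalar product of the vacuum with the top monomial scales quadratically, so it can be made one.\<close>

locale frame = vacuum_frame +
  assumes normalized: "t \<star> E = 1"
begin

definition coord :: "'a ^ 16 \<Rightarrow> nat \<Rightarrow> 'a" where
  "coord x k = x \<star> \<sigma> k"

lemma coord_simps [simp]: "coord (x + y) k = coord x k + coord y k" "coord (a *s x) k = a * coord x k"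
  "coord (x - y) k = coord x k - coord y k" "coord 0 k = 0" "coord (- x) k = - coord x k"
  by (simp_all add: coord_def)

lemma coord_\<tau>: "j < 16 \<Longrightarrow> k < 16 \<Longrightarrow> coord (\<tau> j) k = (if j = k then 1 else 0)"
  by (simp add: coord_def biorthogonal normalized)

lemma coord_eqI: "(\<And>k. k < 16 \<Longrightarrow> coord x k = coord y k) \<Longrightarrow> x = y"
  unfolding coord_def by (rule pair_\<sigma>_eqI)

lemma coord_combination: "k < 16 \<Longrightarrow> coord (\<Sum>j<16. Y j *s \<tau> j) k = Y k"
  unfolding coord_def by (simp add: scalar_product_sum biorthogonal normalized mult_delta_right)

lemma expand: "x = (\<Sum>j<16. coord x j *s \<tau> j)"
  by (rule coord_eqI) (simp add: coord_combination)

lemma coord_t: "k < 16 \<Longrightarrow> coord t k = (if k = 0 then 1 else 0)"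
  using coord_\<tau>[of 0 k] by (auto simp: \<tau>_def)

lemma pair_create:
  assumes "i < 5"
  shows "x \<star> c' (f i) y = create_form (coord x) (coord y) i"
proof -
  have "x \<star> c' (f i) (\<Sum>j<16. Y j *s \<tau> j) = create_form (coord x) Y i" for Y
    by (rule less_5_cases[OF assms];
        simp add: lessThan_nat_numeral \<tau>_def normal_order create_form_def coord_def \<sigma>_def algebra_simps
         )
  from this[of "coord y"] show ?thesis by (simp flip: expand)
qed

lemma pair_annihilate:
  assumes "i < 5"
  shows "x \<star> c' (e i) y = annihilate_form (coord x) (coord y) i"
proof -
  have "x \<star> c' (e i) (\<Sum>j<16. Y j *s \<tau> j) = annihilate_form (coord x) Y i" for Y
    by (rule less_5_cases[OF assms];
        simp add: lessThan_nat_numeral \<tau>_def normal_order annihilate_form_def coord_def \<sigma>_def algebra_simps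
         )
  from this[of "coord y"] show ?thesis by (simp flip: expand)
qed

lemma pair_commute: "x \<star> c' v y = y \<star> c' v x"
proof -
  have v: "v = (\<Sum>i<5. b v (f i) *s e i + b v (e i) *s f i)" by (rule hyperbolic_expand[OF hyp])
  show ?thesis
    by (subst (1 2) v) (simp add: c'_sum scalar_product_sum pair_create pair_annihilate
        create_form_commute[of _ "coord x"] annihilate_form_commute[of _ "coord x"])
qed

end

lemma one_to_ten_cases:
  fixes k :: nat
  assumes k: "k \<in> {1..10}" and P: "P 1" "P 2" "P 3" "P 4" "P 5" "P 6" "P 7" "P 8" "P 9" "P 10"
  shows "P k"
proof -
  have "k < 16" using k by auto
  hence "k \<in> {1..10} \<longrightarrow> P k" by (rule less_16_cases) (use P in auto)
  thus ?thesis using k by blast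
qed

context frame begin

text \<open>The unipotent change of frame that makes the \<open>\<Lambda>\<^sup>2\<close>-component of a given spinor vanish: the new
  vacuum is the exponential of this component.\<close>

lemma unipotent_frame:
  assumes x: "coord x 0 = 1"
  shows "\<exists>e' t'. frame q c c' e' f t' \<and> frame.coord c c' f t' x 0 = 1 \<and>
    (\<forall>k\<in>{1..10}. frame.coord c c' f t' x k = 0)"
proof -
  define X where "X = coord x"
  \<comment> \<open>The coordinates of the exponential: \<open>1\<close>, \<open>\<omega>\<close> and the Pfaffians of \<open>\<omega>\<close>.\<close>
  define T where "T = (!) [1, X 1, X 2, X 3, X 4, X 5, X 6, X 7, X 8, X 9, X 10,
    X 5 * X 10 - X 6 * X 9 + X 7 * X 8,
    - X 2 * X 10 + X 3 * X 9 - X 4 * X 8,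
    X 1 * X 10 - X 3 * X 7 + X 4 * X 6,
    - X 1 * X 9 + X 2 * X 7 - X 4 * X 5,
    X 1 * X 8 - X 2 * X 6 + X 3 * X 5]"
  define t' where "t' = (\<Sum>j<16. T j *s \<tau> j)"
  define e' where "e' = (!)
     [e 0 - T 1 *s f 1 - T 2 *s f 2 - T 3 *s f 3 - T 4 *s f 4,
      e 1 + T 1 *s f 0 - T 5 *s f 2 - T 6 *s f 3 - T 7 *s f 4,
      e 2 + T 2 *s f 0 + T 5 *s f 1 - T 8 *s f 3 - T 9 *s f 4,
      e 3 + T 3 *s f 0 + T 6 *s f 1 + T 8 *s f 2 - T 10 *s f 4,
      e 4 + T 4 *s f 0 + T 7 *s f 1 + T 9 *s f 2 + T 10 *s f 3]"
  have T0: "T 0 = 1" by (simp add: T_def)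
  have T: "coord t' k = T k" if "k < 16" for k
    using that by (simp add: t'_def coord_combination)
  have hyp': "hyperbolic 5 e' f"
    unfolding hyperbolic_def
    by (intro allI impI; erule less_5_cases; erule less_5_cases)
      (simp_all add: e'_def)
  have vac': "c' (e' i) t' = 0" if "i < 5" for i
  proof (rule scalar_product_eqI)
    fix g
    show "c' (e' i) t' \<star> g = 0 \<star> g"
      unfolding scalar_product_commute[of _ g]
      by (rule less_5_cases[OF that];
          simp add: e'_def pair_create pair_annihilate create_form_def annihilate_form_def T;
          simp add: T_def algebra_simps)
  qed
  have E': "c' (f 0) (c (f 1) (c' (f 2) (c (f 3) (c' (f 4) t')))) = E"
    by (simp add: t'_def lessThan_nat_numeral \<tau>_def normal_order T_def)
  have "t' \<star> E = 1" using T[of 0] by (simp add: coord_def \<sigma>_def T_def)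
  moreover from this have "t' \<noteq> 0" by auto
  ultimately interpret n: frame q c c' e' f t'
    by unfold_locales (use hyp' vac' E' in auto)
  have "n.coord x 0 = 1" using x by (simp add: n.coord_def n.\<sigma>_def E' coord_def \<sigma>_def)
  moreover have "n.coord x k = 0" if "k \<in> {1..10}" for k
  proof -
    have xE: "x \<star> E = 1" using x by (simp add: coord_def \<sigma>_def)
    have T_k: "T k = coord x k" if "k \<in> {1..10}" for k
      using that by (rule one_to_ten_cases) (simp_all add: T_def X_def)
    have *: "n.\<sigma> k = \<sigma> k - T k *s E" if "k \<in> {1..10}" for k
      unfolding n.\<sigma>_def using that by (rule one_to_ten_cases)
        (simp_all add: t'_def lessThan_nat_numeral \<tau>_def normal_order T0 \<sigma>_def)
    show ?thesis using that by (simp add: n.coord_def * T_k[symmetric] xE) (simp add: T_k coord_def xE)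
  qed
  ultimately show ?thesis using n.frame_axioms by blast
qed

end

section \<open>Changes of frame\<close>

context vacuum_frame begin

lemma normalize: "\<exists>\<mu>. \<mu> \<noteq> 0 \<and> frame q c c' e f (\<mu> *s t)"
proof -
  obtain \<mu> where \<mu>: "\<mu> ^ 2 = inverse (t \<star> E)" using nth_root_exists[of 2 "inverse (t \<star> E)"] by auto
  have nz: "\<mu> \<noteq> 0" using \<mu> t_pair_E by auto
  have "frame q c c' e f (\<mu> *s t)"
  proof
    show "\<mu> *s t \<star> c' (f 0) (c (f 1) (c' (f 2) (c (f 3) (c' (f 4) (\<mu> *s t))))) = 1"
      using \<mu> t_pair_E by (simp add: power2_eq_square field_simps)
  qed (use hyp vacuum t_nonzero nz in \<open>auto simp: vec_eq_iff\<close>)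
  thus ?thesis using nz by blast
qed

lemma pair_commute: "x \<star> c' v y = y \<star> c' v x"
  using normalize frame.pair_commute by blast

lemma f_indep: "lin_indep 5 f"
  unfolding lin_indep_def
proof (intro allI impI)
  fix x i assume x: "(\<Sum>i<5. x i *s f i) = 0" and i: "i < (5::nat)"
  have "b (e i) (\<Sum>i<5. x i *s f i) = x i" using i by (simp add: b_sum mult_delta_right)
  thus "x i = 0" unfolding x by simp
qed

lemma e_indep: "lin_indep 5 e"
  unfolding lin_indep_def
proof (intro allI impI)
  fix x i assume x: "(\<Sum>i<5. x i *s e i) = 0" and i: "i < (5::nat)"
  have "b (f i) (\<Sum>i<5. x i *s e i) = x i" using i by (simp add: b_sum mult_delta_right)
  thus "x i = 0" unfolding x by simp
qed

lemma span_f_expand: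
  assumes "v \<in> vec.span (f ` {..<5})"
  shows "v = (\<Sum>i<5. b v (e i) *s f i)"
proof -
  have "b v (f i) = 0" if "i < 5" for i
    using assms that by (induction rule: vec.span_induct_alt) auto
  thus ?thesis using hyperbolic_expand[OF hyp, of v] by simp
qed

text \<open>The space of the creation operators may be given another basis, with the dual basis in the space of the
  annihilation operators; the vacuum stays the same.\<close>

lemma change_basis:
  assumes v: "lin_indep m v" "\<And>i. i < m \<Longrightarrow> v i \<in> vec.span (f ` {..<5})"
  shows "\<exists>e' f'. vacuum_frame q c c' e' f' t \<and> (\<forall>i<m. f' i = v i) \<and> (\<forall>i<5. f' i \<in> vec.span (f ` {..<5}))"
proof -
  let ?U = "vec.span (f ` {..<5})"
  obtain f' where f': "lin_indep 5 f'" "\<And>i. i < 5 \<Longrightarrow> f' i \<in> ?U" "\<And>i. i < m \<Longrightarrow> f' i = v i"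
    using extend_family[OF v vec.subspace_span dim_span_family[OF f_indep]] by blast
  obtain g where g: "\<And>i j. i < 5 \<Longrightarrow> b (f' i) (g j) = (if i = j then 1 else 0)"
    using exists_dual_family[OF f'(1)] by blast
  define e' where "e' j = (\<Sum>k<5. b (g j) (f k) *s e k)" for j
  have f_exp: "f' i = (\<Sum>k<5. b (f' i) (e k) *s f k)" if "i < 5" for i
    by (rule span_f_expand[OF f'(2)[OF that]])
  have ee: "b (e' i) (e k) = 0" if "k < 5" for i k
    using that by (simp add: e'_def b_sum)
  have "hyperbolic 5 e' f'"
    unfolding hyperbolic_def
  proof (intro allI impI conjI)
    fix i j :: nat assume ij: "i < 5" "j < 5"
    show "b (e' i) (e' j) = 0" by (subst (2) e'_def) (simp add: b_sum ee)
    show "b (f' i) (f' j) = 0" using ij by (subst f_exp, simp, subst f_exp, simp) (simp add: b_sum)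
    have "b (e' i) (f' j) = (\<Sum>k<5. b (f' j) (e k) * b (g i) (f k))"
      by (subst f_exp[OF ij(2)]) (simp add: b_sum e'_def mult_delta_right)
    also have "\<dots> = b (g i) (f' j)" by (subst (2) f_exp[OF ij(2)]) (simp add: b_sum)
    finally show "b (e' i) (f' j) = (if i = j then 1 else 0)" using g[OF ij(2), of i] b_commute by auto
  qed
  moreover have "c' (e' i) t = 0" for i by (simp add: e'_def c'_sum vacuum)
  ultimately have "vacuum_frame q c c' e' f' t"
    using t_nonzero by unfold_locales auto
  thus ?thesis using f' by blast
qed

text \<open>Exchanging the roles of \<open>e\<^sub>j\<close> and \<open>f\<^sub>j\<close> moves the vacuum to \<open>f\<^sub>j t\<close>, in the other module.\<close>

lemma swap_one:
  assumes "j < 5"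
  shows "vacuum_frame q c' c (e(j := f j)) (f(j := e j)) (A j)"
proof -
  interpret s: spinor_modules q c' c by (rule swap)
  show ?thesis
  proof
    show "hyperbolic 5 (e(j := f j)) (f(j := e j))" unfolding hyperbolic_def using assms by auto
    have "c (e j) (A j) = t" using assms by (simp add: normal_order)
    thus "A j \<noteq> 0" using t_nonzero by auto
    show "c ((e(j := f j)) i) (A j) = 0" if "i < 5" for i
      using that assms by (simp add: normal_order)
  qed
qed

lemma swap_two:
  assumes "i < 5" "j < 5" "i \<noteq> j"
  shows "vacuum_frame q c c' (e(j := f j, i := f i)) (f(j := e j, i := e i)) (B i j)"
  using vacuum_frame.swap_one[OF swap_one[OF assms(2)] assms(1)] assms(3) by simp

text \<open>The one-parameter subgroup of a root: the new vacuum is \<open>exp(a f\<^sub>j f\<^sub>k) t\<close>.\<close>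

lemma shear:
  assumes "j < 5" "k < 5" "j \<noteq> k"
  shows "vacuum_frame q c c' (e(j := e j - a *s f k, k := e k + a *s f j)) f (t + a *s B j k)"
proof
  show "hyperbolic 5 (e(j := e j - a *s f k, k := e k + a *s f j)) f"
    unfolding hyperbolic_def using assms by auto
  show "t + a *s B j k \<noteq> 0"
  proof
    assume z: "t + a *s B j k = 0"
    have "a *s t = c (e k) (c' (e j) (t + a *s B j k))" using assms by (simp add: normal_order)
    hence "a = 0" unfolding z using t_nonzero by simp
    thus False using z t_nonzero by simp
  qed
  show "c' ((e(j := e j - a *s f k, k := e k + a *s f j)) i) (t + a *s B j k) = 0" if "i < 5" for i
    using that assms by (auto simp: normal_order)
qed

end

context spinor_modules begin

text \<open>Applying those \<open>e\<^sub>i\<close> that do not kill it turns any nonzero spinor into a vacuum. If it is in the wrong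
  module, one pair of the hyperbolic basis is swapped.\<close>

lemma exists_vacuum_frame: "\<exists>e f t. vacuum_frame q c c' e f t"
proof -
  obtain e f where ef: "hyperbolic 5 e f" using exists_hyperbolic by blast
  note h = hyperbolicD[OF ef]
  have "\<exists>x. x \<noteq> 0 \<and> ((\<forall>i<n. c' (e i) x = 0) \<or> (\<forall>i<n. c (e i) x = 0))" if "n \<le> 5" for n
    using that
  proof (induction n)
    case 0
    show ?case by (intro exI[of _ "axis 0 1"]) (simp add: axis_eq_0_iff)
  next
    case (Suc n)
    have step: "\<exists>x. x \<noteq> 0 \<and> ((\<forall>i<Suc n. d' (e i) x = 0) \<or> (\<forall>i<Suc n. d (e i) x = 0))"
      if "spinor_modules q d d'" and x: "x \<noteq> 0" "\<forall>i<n. d' (e i) x = 0" for d d' x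
    proof -
      interpret d: spinor_modules q d d' by fact
      show ?thesis
      proof (cases "d' (e n) x = 0")
        case True
        thus ?thesis using x by (auto simp: less_Suc_eq)
      next
        case False
        have "d (e i) (d' (e n) x) = 0" if "i < Suc n" for i
        proof (cases "i = n")
          case True
          thus ?thesis using Suc.prems q_eq[of "e n"] h(1)[of n n] by (simp add: d.square)
        next
          case False
          thus ?thesis using d.clifford'[of "e i" "e n" x] h(1)[of i n] x that Suc.prems by auto
        qed
        thus ?thesis using False by blast
      qed
    qed
    obtain x where "x \<noteq> 0" "(\<forall>i<n. c' (e i) x = 0) \<or> (\<forall>i<n. c (e i) x = 0)"
      using Suc by auto
    thus ?case using step[OF spinor_modules_axioms, of x] step[OF swap, of x] by blast
  qed
  then obtain x where x: "x \<noteq> 0" "(\<forall>i<5. c' (e i) x = 0) \<or> (\<forall>i<5. c (e i) x = 0)" by blast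
  from x(2) show ?thesis
  proof
    assume "\<forall>i<5. c' (e i) x = 0"
    hence "vacuum_frame q c c' e f x" using x ef by unfold_locales auto
    thus ?thesis by blast
  next
    assume *: "\<forall>i<5. c (e i) x = 0"
    interpret s: spinor_modules q c' c by (rule swap)
    have "vacuum_frame q c' c e f x" using * x ef by unfold_locales auto
    from vacuum_frame.swap_one[OF this, of 0] show ?thesis by auto
  qed
qed

lemma pure_frame:
  assumes U: "U \<in> OGr5 q" and t: "t \<noteq> 0" "\<And>u. u \<in> U \<Longrightarrow> c' u t = 0"
  shows "\<exists>e f. vacuum_frame q c c' e f t \<and> (\<forall>i<5. e i \<in> U)"
proof -
  have "vec.subspace U" "vec.dim U = 5" using U by (auto simp: OGr5_def grass_def)
  then obtain e where e: "lin_indep 5 e" "\<And>i. i < 5 \<Longrightarrow> e i \<in> U" using subspace_family by blast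
  obtain f where "hyperbolic 5 e f" using isotropic_family_extends[OF e(1)] isotropic_b[OF U] e(2) by blast
  hence "vacuum_frame q c c' e f t" using t e by unfold_locales auto
  thus ?thesis using e by blast
qed

text \<open>The points of the spinor variety are the lines of vacua, because a basis of a maximal isotropic space
  extends to a hyperbolic basis.\<close>

lemma spinor_variety_iff:
  "l \<in> spinor_variety q c' \<longleftrightarrow> (\<exists>e f t. vacuum_frame q c c' e f t \<and> l = vec.span {t})"
proof
  assume "l \<in> spinor_variety q c'"
  then obtain U where U: "U \<in> OGr5 q" "l = {s. \<forall>u\<in>U. c' u s = 0}" and l: "vec.dim l = 1" "vec.subspace l"
    by (auto simp: spinor_variety_def grass_def)
  have "l \<noteq> {0}" using l(1) by auto
  then obtain t where t: "t \<in> l" "t \<noteq> 0" using vec.subspace_0[OF l(2)] by blast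
  then obtain e f where "vacuum_frame q c c' e f t" and eU: "\<forall>i<5. e i \<in> U" using pure_frame[OF U(1)] U(2) by blast
  then interpret vacuum_frame q c c' e f t by blast
  have "l \<subseteq> vec.span {t}"
  proof
    fix x assume "x \<in> l"
    hence "x = (x \<star> E / (t \<star> E)) *s t" by (intro annihilated_eq_vacuum) (use eU U(2) in auto)
    thus "x \<in> vec.span {t}" by (metis vec.span_base vec.span_scale singletonI)
  qed
  moreover have "vec.span {t} \<subseteq> l" using t l(2) by (intro vec.span_minimal) auto
  ultimately show "\<exists>e f t. vacuum_frame q c c' e f t \<and> l = vec.span {t}"
    using vacuum_frame_axioms by blast
next
  assume "\<exists>e f t. vacuum_frame q c c' e f t \<and> l = vec.span {t}"
  then obtain e f t where "vacuum_frame q c c' e f t" and l: "l = vec.span {t}" by blast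
  then interpret vacuum_frame q c c' e f t by blast
  define U where "U = vec.span (e ` {..<5})"
  have iso: "b u v = 0" if "u \<in> U" "v \<in> U" for u v
  proof -
    have *: "b u (e i) = 0" if "i < 5" for i
      using \<open>u \<in> U\<close>[unfolded U_def] by (induction rule: vec.span_induct_alt) (use that in auto)
    show ?thesis
      using \<open>v \<in> U\<close>[unfolded U_def] by (induction rule: vec.span_induct_alt) (use * in auto)
  qed
  have "q u = 0" if "u \<in> U" for u using iso[OF that that] q_eq[of u] by simp
  hence "U \<in> OGr5 q"
    using dim_span_family[OF e_indep] by (simp add: OGr5_def grass_def U_def)
  moreover have kill: "c' u t = 0" if "u \<in> U" for u
    using that unfolding U_def by (induction rule: vec.span_induct_alt) (auto simp: vacuum)
  have "vec.span {t} = {s. \<forall>u\<in>U. c' u s = 0}"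
  proof (intro equalityI subsetI)
    fix x assume "x \<in> {s. \<forall>u\<in>U. c' u s = 0}"
    hence "x = (x \<star> E / (t \<star> E)) *s t"
      by (intro annihilated_eq_vacuum) (auto simp: U_def intro: vec.span_base)
    thus "x \<in> vec.span {t}" by (metis vec.span_base vec.span_scale singletonI)
  next
    fix x assume "x \<in> vec.span {t}"
    thus "x \<in> {s. \<forall>u\<in>U. c' u s = 0}" using kill by (auto simp: vec.span_singleton)
  qed
  moreover have "vec.dim (vec.span {t}) = 1"
    using t_nonzero by (simp add: vec.dim_eq_card_independent vec.dependent_single)
  hence "vec.span {t} \<in> proj UNIV" by (simp add: grass_def)
  ultimately show "l \<in> spinor_variety q c'"
    unfolding spinor_variety_def l by blast
qed

end

lemma lin_indep_1I: "v 0 \<noteq> 0 \<Longrightarrow> lin_indep 1 v"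
  by (auto simp: lin_indep_def)

lemma lin_indep_2I:
  assumes "\<And>a b. a *s v 0 + b *s v 1 = 0 \<Longrightarrow> a = 0 \<and> b = 0"
  shows "lin_indep 2 v"
  unfolding lin_indep_def
proof (intro allI impI)
  fix x k assume x: "(\<Sum>k<2. x k *s v k) = 0" and k: "k < (2::nat)"
  have "x 0 *s v 0 + x 1 *s v 1 = 0" using x by (simp add: lessThan_nat_numeral add.commute)
  moreover have "k = 0 \<or> k = 1" using k by linarith
  ultimately show "x k = 0" using assms by blast
qed

lemma lin_indep_3I:
  assumes "\<And>a b d. a *s v 0 + b *s v 1 + d *s v 2 = 0 \<Longrightarrow> a = 0 \<and> b = 0 \<and> d = 0"
  shows "lin_indep 3 v"
  unfolding lin_indep_def
proof (intro allI impI)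
  fix x k assume x: "(\<Sum>k<3. x k *s v k) = 0" and k: "k < (3::nat)"
  have "x 0 *s v 0 + x 1 *s v 1 + x 2 *s v 2 = 0"
    using x by (simp add: lessThan_nat_numeral ac_simps)
  moreover have "k = 0 \<or> k = 1 \<or> k = 2" using k by linarith
  ultimately show "x k = 0" using assms by blast
qed

section \<open>Skew tensors as skew forms on spinors\<close>

definition two_form :: "'k::field ^ ('n::finite \<times> 'n) \<Rightarrow> 'k ^ 'n \<Rightarrow> 'k ^ 'n \<Rightarrow> 'k" where
  "two_form w s s' = (\<Sum>j\<in>UNIV. \<Sum>k\<in>UNIV. w $ (j, k) * s $ j * s' $ k)"

lemma two_form_simps [simp]:
  "two_form (w + w') s s' = two_form w s s' + two_form w' s s'"
  "two_form (a *s w) s s' = a * two_form w s s'"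
  "two_form w (x + y) s' = two_form w x s' + two_form w y s'"
  "two_form w (a *s x) s' = a * two_form w x s'"
  "two_form w s (x + y) = two_form w s x + two_form w s y"
  "two_form w s (a *s x) = a * two_form w s x"
  "two_form w (- x) s' = - two_form w x s'" "two_form w s (- x) = - two_form w s x"
  "two_form w 0 s' = 0" "two_form w s 0 = 0" "two_form 0 s s' = 0"
  by (simp_all add: two_form_def sum.distrib sum_distrib_left sum_negf algebra_simps)

lemma two_form_diff [simp]:
  "two_form w (x - y) s' = two_form w x s' - two_form w y s'"
  "two_form w s (x - y) = two_form w s x - two_form w s y"
  using two_form_simps(3)[of w x "- y"] two_form_simps(5)[of w s x "- y"] by simp_all

lemma two_form_sum:
  "two_form w (\<Sum>i\<in>I. x i) s' = (\<Sum>i\<in>I. two_form w (x i) s')"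
  "two_form w s (\<Sum>i\<in>I. x i) = (\<Sum>i\<in>I. two_form w s (x i))"
  by (induction I rule: infinite_finite_induct) simp_all

lemma two_form_axis: "two_form w (axis j 1) (axis k 1) = w $ (j, k)"
  by (simp add: two_form_def axis_def mult_delta_right if_distribR if_distrib[of "\<lambda>x. _ * x"] sum.delta cong: if_cong)

lemma two_form_wedge: "two_form (wedge x y) s s' = (x \<star> s) * (y \<star> s') - (x \<star> s') * (y \<star> s)"
proof -
  have "(x \<star> s) * (y \<star> s') = (\<Sum>j\<in>UNIV. \<Sum>k\<in>UNIV. x $ j * y $ k * s $ j * s' $ k)"
    by (simp add: scalar_product_def sum_product ac_simps)
  moreover have "(x \<star> s') * (y \<star> s) = (\<Sum>j\<in>UNIV. \<Sum>k\<in>UNIV. x $ k * y $ j * s $ j * s' $ k)"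
    by (simp add: scalar_product_def sum_product ac_simps)
  ultimately show ?thesis
    by (simp add: two_form_def wedge_def algebra_simps sum_subtractf)
qed

lemma two_form_linear: "Vector_Spaces.linear (*s) (*) (\<lambda>w. two_form w s s')"
  by unfold_locales (simp_all)

lemma two_form_skew: "w \<in> ext2 \<Longrightarrow> two_form w s s' = - two_form w s' s"
  unfolding ext2_def
  by (induction rule: vec.span_induct_alt) (auto simp: two_form_wedge algebra_simps)

lemma two_form_same: "w \<in> ext2 \<Longrightarrow> two_form w s s = (0 :: 'k::field_char_0)"
  using two_form_skew[of w s s] by (simp add: eq_neg_iff_add_eq_0)

lemma two_form_eq_0I: "(\<And>s s'. two_form w s s' = 0) \<Longrightarrow> w = 0"
  by (metis two_form_axis surj_pair vec_eq_iff zero_index)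

text \<open>The exterior square of a half-spinor module is spanned by the lines on the spinor variety: a skew form
  that vanishes on all pairs \<open>f\<^sub>i t, f\<^sub>j t\<close> with \<open>t\<close> a pure spinor is zero.
  A shear of the frame shows that it then also vanishes on all pairs of monomials of degrees one
  and three, and every pair of monomials has these degrees for a suitable vacuum.\<close>

locale vanishing_form = spinor_modules +
  fixes w :: "'a ^ (16 \<times> 16)"
  assumes w: "w \<in> ext2"
    and vanish: "\<And>e f t i j. vacuum_frame q c c' e f t \<Longrightarrow> i < 5 \<Longrightarrow> j < 5 \<Longrightarrow>
      two_form w (c' (f i) t) (c' (f j) t) = 0"
begin

lemma shear_relation:
  assumes "vacuum_frame q c c' e f t" "i < 5" "l < 5" "j < 5" "k < 5" "j \<noteq> k"
  shows "two_form w (c' (f l) t) (c' (f i) (c (f j) (c' (f k) t)))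
     = two_form w (c' (f i) t) (c' (f l) (c (f j) (c' (f k) t)))"
proof -
  interpret vacuum_frame q c c' e f t by fact
  let ?W = "two_form w"
  have eq: "a * (?W (A i) (C l j k) + ?W (C i j k) (A l)) + a * a * ?W (C i j k) (C l j k) = 0" for a
    using vanish[OF shear[OF assms(4-6), of a] assms(2,3)] vanish[OF assms(1-3)]
    by (simp add: algebra_simps)
  \<comment> \<open>The values at \<open>a = 1\<close> and \<open>a = - 1\<close> isolate the linear coefficient.\<close>
  have "2 * (?W (A i) (C l j k) + ?W (C i j k) (A l)) = 0"
    using eq[of 1] eq[of "- 1"] by (simp add: algebra_simps)
  thus ?thesis using two_form_skew[OF w, of "C i j k" "A l"] by simp
qed

text \<open>By \<open>shear_relation\<close> the expression is symmetric in the first two indices, while it is antisymmetric in the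
  second and third one. Three transpositions of each kind show that it is its own negative.\<close>

lemma vanish_A_C:
  assumes frame: "vacuum_frame q c c' e f t" and "l < 5" and ijk: "i < 5" "j < 5" "k < 5" "i \<noteq> k" "j \<noteq> k"
  shows "two_form w (c' (f l) t) (c' (f i) (c (f j) (c' (f k) t))) = 0"
proof -
  interpret vacuum_frame q c c' e f t by (rule frame)
  let ?G = "\<lambda>l i j k. two_form w (A l) (C i j k)"
  note move = shear_relation[OF frame]
  have swap: "?G l i j k = - ?G l j i k" if "i < 5" "j < 5" for l i j k
    using create_create(2)[OF that, of "A k"] by simp
  show ?thesis
  proof (cases "l = k")
    case True
    show ?thesis unfolding True using ijk move[of i k j k] by (simp add: create_sort_twice)
  next
    case False
    have "?G l i j k = ?G i l j k" using ijk \<open>l < 5\<close> by (intro move) auto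
    also have "\<dots> = - ?G i j l k" using ijk \<open>l < 5\<close> by (intro swap) auto
    also have "?G i j l k = ?G j i l k" using ijk \<open>l < 5\<close> False by (intro move) auto
    also have "\<dots> = - ?G j l i k" using ijk \<open>l < 5\<close> by (intro swap) auto
    also have "?G j l i k = ?G l j i k" using ijk \<open>l < 5\<close> by (intro move) auto
    also have "\<dots> = - ?G l i j k" using ijk by (intro swap) auto
    finally show ?thesis by (simp add: eq_neg_iff_add_eq_0)
  qed
qed

text \<open>The remaining monomial is the one of top degree; with respect to the vacuum \<open>f\<^sub>k f\<^sub>j t\<close> the two monomials have
  degrees one and three.\<close>

lemma vanish_A:
  assumes frame: "vacuum_frame q c c' e f t" and k: "k < 5"
  shows "two_form w (c' (f k) t) s = 0"
proof -
  interpret vacuum_frame q c c' e f t by (rule frame)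
  have E: "two_form w (A k) E = 0"
  proof -
    note s = vanish_A_C[OF swap_two]
    show ?thesis
      using k
    proof (rule less_5_cases)
      show "two_form w (A 0) E = 0" using s[of 0 1 1 2 3 4] by (simp add: normal_order)
      show "two_form w (A 1) E = 0" using s[of 1 0 0 2 3 4] by (simp add: normal_order)
      show "two_form w (A 2) E = 0" using s[of 2 0 0 1 3 4] by (simp add: normal_order)
      show "two_form w (A 3) E = 0" using s[of 3 0 0 1 2 4] by (simp add: normal_order)
      show "two_form w (A 4) E = 0" using s[of 4 0 0 1 2 3] by (simp add: normal_order)
    qed
  qed
  obtain x where s: "s = (\<Sum>k<16. x k *s \<sigma> k)" using \<sigma>_spans by blast
  have "two_form w (A k) (\<sigma> j) = 0" if "j < 16" for j
    using that by (rule less_16_cases)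
      (simp_all add: \<sigma>_def E vanish_A_C[OF frame k] vanish[OF frame k])
  thus ?thesis unfolding s by (simp add: two_form_sum)
qed

lemma w_eq_0: "w = 0"
proof -
  obtain e f t where frame: "vacuum_frame q c c' e f t" using exists_vacuum_frame by blast
  interpret vacuum_frame q c c' e f t by (rule frame)
  have C: "two_form w (C k i j) s = 0" if "i < 5" "j < 5" "k < 5" "i \<noteq> j" "k \<noteq> i" "k \<noteq> j" for i j k s
    using vanish_A[OF swap_two[of i j], of k] that by simp
  have not_E: "two_form w (\<sigma> j) s = 0" if "j < 16" "j \<noteq> 0" for j s
  proof -
    have "j \<noteq> 0 \<longrightarrow> two_form w (\<sigma> j) s = 0"
      using that(1) by (rule less_16_cases) (simp_all add: \<sigma>_def C vanish_A[OF frame])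
    thus ?thesis using that by blast
  qed
  have *: "two_form w (\<sigma> j) (\<sigma> k) = 0" if "j < 16" "k < 16" for j k
    using not_E[OF that(1), of "\<sigma> k"] not_E[OF that(2), of "\<sigma> j"] two_form_skew[OF w, of "\<sigma> j" "\<sigma> k"]
      two_form_same[OF w, of "\<sigma> 0"] by (cases "j = 0"; cases "k = 0") auto
  show ?thesis
  proof (rule two_form_eq_0I)
    fix s s'
    obtain x where s: "s = (\<Sum>k<16. x k *s \<sigma> k)" using \<sigma>_spans by blast
    obtain x' where s': "s' = (\<Sum>k<16. x' k *s \<sigma> k)" using \<sigma>_spans by blast
    show "two_form w s s' = 0" unfolding s s' by (simp add: two_form_sum *)
  qed
qed

end

context spinor_modules begin

lemma frame_detects:
  assumes w: "w \<in> ext2" "w \<noteq> 0"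
  shows "\<exists>e f t. frame q c c' e f t \<and> two_form w (c' (f 0) t) (c' (f 1) t) \<noteq> 0"
proof -
  have "\<not> vanishing_form q c c' w" using vanishing_form.w_eq_0 w(2) by blast
  then obtain e f t i j where frame: "vacuum_frame q c c' e f t" and ij: "i < 5" "j < 5"
    and nz: "two_form w (c' (f i) t) (c' (f j) t) \<noteq> 0"
    using w(1) spinor_modules_axioms by (auto simp: vanishing_form_def vanishing_form_axioms_def)
  interpret vacuum_frame q c c' e f t by (rule frame)
  have "i \<noteq> j" using nz two_form_same[OF w(1)] by auto
  define v where "v k = (if k = 0 then f i else f j)" for k :: nat
  have "lin_indep 2 v"
  proof (rule lin_indep_2I)
    fix x y assume "x *s v 0 + y *s v 1 = 0"
    hence "b (e i) (x *s f i + y *s f j) = 0" "b (e j) (x *s f i + y *s f j) = 0" by (simp_all add: v_def)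
    thus "x = 0 \<and> y = 0" using ij \<open>i \<noteq> j\<close> by simp
  qed
  moreover have "v k \<in> vec.span (f ` {..<5})" for k using ij by (auto simp: v_def intro: vec.span_base)
  ultimately obtain e' f' where frame': "vacuum_frame q c c' e' f' t" and f': "\<forall>k<2. f' k = v k"
    using change_basis by blast
  obtain \<mu> where \<mu>: "\<mu> \<noteq> 0" "frame q c c' e' f' (\<mu> *s t)" using vacuum_frame.normalize[OF frame'] by blast
  have "f' 0 = f i" "f' 1 = f j" using f' by (simp_all add: v_def)
  hence "two_form w (c' (f' 0) (\<mu> *s t)) (c' (f' 1) (\<mu> *s t)) \<noteq> 0" using nz \<mu>(1) by simp
  thus ?thesis using \<mu>(2) by blast
qed

section \<open>The invariant quadric\<close>

text \<open>The tensor \<open>\<Sum> e\<^sub>i \<otimes> f\<^sub>i + f\<^sub>i \<otimes> e\<^sub>i\<close> is the inverse of the polar form, so it does not depend on the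
  hyperbolic basis.\<close>

lemma hyperbolic_trace_independent:
  fixes \<phi> :: "'k ^ 10 \<Rightarrow> 'k ^ 10 \<Rightarrow> 'k"
  assumes h: "hyperbolic 5 e f" and h': "hyperbolic 5 e' f'"
    and add: "\<And>u v w. \<phi> (u + v) w = \<phi> u w + \<phi> v w" "\<And>u v w. \<phi> w (u + v) = \<phi> w u + \<phi> w v"
    and scale: "\<And>a u w. \<phi> (a *s u) w = a * \<phi> u w" "\<And>a u w. \<phi> w (a *s u) = a * \<phi> w u"
  shows "(\<Sum>i<5. \<phi> (e i) (f i) + \<phi> (f i) (e i)) = (\<Sum>i<5. \<phi> (e' i) (f' i) + \<phi> (f' i) (e' i))"
proof -
  have zero: "\<phi> 0 u = 0" "\<phi> u 0 = 0" for u using scale(1)[of 0 u u] scale(2)[of u 0 u] by simp_all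
  have sum1: "\<phi> (\<Sum>i\<in>I. v i) u = (\<Sum>i\<in>I. \<phi> (v i) u)" for I :: "nat set" and v u
    by (induction I rule: infinite_finite_induct) (simp_all add: add zero)
  have sum2: "\<phi> u (\<Sum>i\<in>I. v i) = (\<Sum>i\<in>I. \<phi> u (v i))" for I :: "nat set" and v u
    by (induction I rule: infinite_finite_induct) (simp_all add: add zero)
  have exp1: "\<phi> u v = (\<Sum>i<5. b v (f i) * \<phi> u (e i) + b v (e i) * \<phi> u (f i))" for u v
    by (subst (1) hyperbolic_expand[OF h, of v]) (simp add: sum2 add scale)
  have exp2: "\<phi> v u = (\<Sum>j<5. b v (f' j) * \<phi> (e' j) u + b v (e' j) * \<phi> (f' j) u)" for u v
    by (subst (1) hyperbolic_expand[OF h', of v]) (simp add: sum1 add scale)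
  have "(\<Sum>j<5. \<phi> (e' j) (f' j) + \<phi> (f' j) (e' j)) =
    (\<Sum>j<5. \<Sum>i<5. (b (f' j) (f i) * \<phi> (e' j) (e i) + b (f' j) (e i) * \<phi> (e' j) (f i))
       + (b (e' j) (f i) * \<phi> (f' j) (e i) + b (e' j) (e i) * \<phi> (f' j) (f i)))"
    by (subst (1 2) exp1) (simp add: sum.distrib)
  also have "\<dots> = (\<Sum>i<5. \<Sum>j<5. (b (f' j) (f i) * \<phi> (e' j) (e i) + b (f' j) (e i) * \<phi> (e' j) (f i))
       + (b (e' j) (f i) * \<phi> (f' j) (e i) + b (e' j) (e i) * \<phi> (f' j) (f i)))"
    by (rule sum.swap)
  also have "\<dots> = (\<Sum>i<5. \<phi> (f i) (e i) + \<phi> (e i) (f i))"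
    by (rule sum.cong[OF refl], subst (2 3) exp2) (simp add: sum.distrib b_commute algebra_simps)
  finally show ?thesis by (simp add: add.commute)
qed

text \<open>The contraction of \<open>w\<close> with the inverse of the polar form of \<open>q\<close>. For a skew tensor \<open>w\<close> it is a quarter of the
  polar form of the quadric defined below, evaluated at \<open>w\<close> and \<open>x \<and> y\<close>.\<close>

definition casimir :: "(nat \<Rightarrow> 'k ^ 10) \<Rightarrow> (nat \<Rightarrow> 'k ^ 10) \<Rightarrow> 'k ^ (16 \<times> 16) \<Rightarrow> 'k ^ 16 \<Rightarrow> 'k ^ 16 \<Rightarrow> 'k" where
  "casimir e f w x y = (\<Sum>i<5. two_form w (c' (e i) x) (c' (f i) y) + two_form w (c' (f i) x) (c' (e i) y))"

lemma casimir_independent: "hyperbolic 5 e f \<Longrightarrow> hyperbolic 5 e' f' \<Longrightarrow> casimir e f = casimir e' f'"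
  unfolding casimir_def by (intro ext hyperbolic_trace_independent) simp_all

lemma casimir_simps [simp]:
  "casimir e f (w + w') x y = casimir e f w x y + casimir e f w' x y" "casimir e f (a *s w) x y = a * casimir e f w x y"
  "casimir e f w (x + x') y = casimir e f w x y + casimir e f w x' y" "casimir e f w (a *s x) y = a * casimir e f w x y"
  "casimir e f w x (y + y') = casimir e f w x y + casimir e f w x y'" "casimir e f w x (a *s y) = a * casimir e f w x y"
  "casimir e f w 0 y = 0" "casimir e f w x 0 = 0"
  by (simp_all add: casimir_def sum.distrib sum_distrib_left algebra_simps)

lemma casimir_sum:
  "casimir e f w (\<Sum>i\<in>I. x i) y = (\<Sum>i\<in>I. casimir e f w (x i) y)"
  "casimir e f w y (\<Sum>i\<in>I. x i) = (\<Sum>i\<in>I. casimir e f w y (x i))"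
  by (induction I rule: infinite_finite_induct) simp_all

definition quadric_polar where
  "quadric_polar e f w w' = (\<Sum>l\<in>UNIV. \<Sum>m\<in>UNIV. w' $ (l, m) * casimir e f w (axis l 1) (axis m 1))"

definition quadric :: "(nat \<Rightarrow> 'k ^ 10) \<Rightarrow> (nat \<Rightarrow> 'k ^ 10) \<Rightarrow> 'k ^ (16 \<times> 16) \<Rightarrow> 'k" where
  "quadric e f w = quadric_polar e f w w"

lemma quadric_independent:
  "hyperbolic 5 e f \<Longrightarrow> hyperbolic 5 e' f' \<Longrightarrow> quadric e f = quadric e' f'"
  using casimir_independent[of e f e' f'] by (simp add: fun_eq_iff quadric_def quadric_polar_def)

lemma casimir_expand: "casimir e f w x y = (\<Sum>l\<in>UNIV. \<Sum>m\<in>UNIV. x $ l * y $ m * casimir e f w (axis l 1) (axis m 1))"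
proof -
  have "casimir e f w x y = (\<Sum>l\<in>UNIV. x $ l * casimir e f w (axis l 1) y)"
    by (subst (1) basis_expansion[of x, symmetric]) (simp add: casimir_sum)
  also have "\<dots> = (\<Sum>l\<in>UNIV. x $ l * (\<Sum>m\<in>UNIV. y $ m * casimir e f w (axis l 1) (axis m 1)))"
    by (subst (1) basis_expansion[of y, symmetric]) (simp add: casimir_sum)
  finally show ?thesis by (simp add: sum_distrib_left mult.assoc)
qed

lemma casimir_skew: "w \<in> ext2 \<Longrightarrow> casimir e f w y x = - casimir e f w x y"
  unfolding casimir_def sum_negf[symmetric]
  by (rule sum.cong[OF refl]) (simp add: two_form_skew[of w "c' _ y"])

lemma quadric_polar_wedge:
  assumes "w \<in> ext2"
  shows "quadric_polar e f w (wedge x y) = 2 * casimir e f w x y"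
proof -
  have "quadric_polar e f w (wedge x y) = casimir e f w x y -
     (\<Sum>l\<in>UNIV. \<Sum>m\<in>UNIV. x $ m * y $ l * casimir e f w (axis l 1) (axis m 1))"
    unfolding casimir_expand[of e f w x y] quadric_polar_def
    by (simp add: wedge_def sum_subtractf algebra_simps)
  also have "(\<Sum>l\<in>UNIV. \<Sum>m\<in>UNIV. x $ m * y $ l * casimir e f w (axis l 1) (axis m 1)) = casimir e f w y x"
    unfolding casimir_expand[of e f w y x] by (simp add: ac_simps)
  also have "casimir e f w y x = - casimir e f w x y" by (rule casimir_skew[OF assms])
  finally show ?thesis by simp
qed

lemma quadric_hom_poly: "quadric e f \<in> hom_poly 2"
proof -
  have "quadric e f \<in> poly_fun"
    unfolding quadric_def quadric_polar_def casimir_def two_form_def by (intro poly_fun_intros)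
  moreover have "quadric e f (a *s w) = a ^ 2 * quadric e f w" for a w
    by (simp add: quadric_def quadric_polar_def sum_distrib_left power2_eq_square ac_simps)
  ultimately show ?thesis by (simp add: hom_poly_def)
qed

end

context vacuum_frame begin

lemma quadric_polar_wedge_left:
  assumes w: "w \<in> ext2"
  shows "quadric_polar e f (wedge x y) w = 2 * casimir e f w x y"
proof -
  have nth: "x \<star> c' v (axis l 1) = c' v x $ l" for x v l
    by (simp add: pair_commute[of x] scalar_product_commute[of "axis l 1"] scalar_product_axis)
  define g where "g i l m = w $ (l, m) * (c' (e i) x $ l * c' (f i) y $ m - c' (e i) y $ l * c' (f i) x $ m
      + (c' (f i) x $ l * c' (e i) y $ m - c' (f i) y $ l * c' (e i) x $ m))" for i l m
  have "quadric_polar e f (wedge x y) w = (\<Sum>l\<in>UNIV. \<Sum>m\<in>UNIV. \<Sum>i<5. g i l m)"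
    unfolding quadric_polar_def casimir_def two_form_wedge nth g_def
    by (simp add: sum_distrib_left algebra_simps)
  also have "\<dots> = (\<Sum>l\<in>UNIV. \<Sum>i<5. \<Sum>m\<in>UNIV. g i l m)" by (intro sum.cong refl sum.swap)
  also have "\<dots> = (\<Sum>i<5. \<Sum>l\<in>UNIV. \<Sum>m\<in>UNIV. g i l m)" by (rule sum.swap)
  also have "\<dots> = casimir e f w x y - casimir e f w y x"
    unfolding casimir_def two_form_def g_def sum_subtractf[symmetric] sum.distrib[symmetric]
    by (intro sum.cong refl) (simp add: algebra_simps)
  finally show ?thesis using casimir_skew[OF w, of e f y x] by simp
qed

lemma polar_quadric_wedge:
  assumes w: "w \<in> ext2"
  shows "polar (quadric e f) w (wedge x y) = 4 * casimir e f w x y"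
proof -
  have add: "quadric_polar e f (u + v) w = quadric_polar e f u w + quadric_polar e f v w"
    "quadric_polar e f w (u + v) = quadric_polar e f w u + quadric_polar e f w v" for u v w
    by (simp_all add: quadric_polar_def sum.distrib algebra_simps)
  have "polar (quadric e f) w (wedge x y) = quadric_polar e f w (wedge x y) + quadric_polar e f (wedge x y) w"
    by (simp add: polar_def quadric_def add)
  thus ?thesis using quadric_polar_wedge[OF w] quadric_polar_wedge_left[OF w] by simp
qed

lemma casimir_vacuum:
  assumes "w \<in> ext2"
  shows "casimir e f w t (B 0 1) = 2 * two_form w (A 0) (A 1)"
  using two_form_skew[OF assms, of "A 1" "A 0"]
  by (simp add: casimir_def lessThan_nat_numeral normal_order)

end

lemma wedge_in_ext2: "wedge x y \<in> ext2"
  unfolding ext2_def by (rule vec.span_base) blast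

context frame begin

text \<open>The contraction gives \<open>b (\<beta>(x, x)) (\<beta>(y, y)) - b (\<beta>(x, y)) (\<beta>(x, y))\<close> up to a factor. The second term is a
  multiple of the first one because \<open>\<beta>(x + a y, x + a y)\<close> is isotropic for all \<open>a\<close>.\<close>

lemma quadric_wedge: "quadric e f (wedge x y) = 3 * quartic (coord x) (coord y)"
proof -
  let ?F = create_form and ?E = annihilate_form and ?X = "coord x" and ?Y = "coord y"
  have "quadric e f (wedge x y) = 2 * casimir e f (wedge x y) x y"
    unfolding quadric_def by (rule quadric_polar_wedge[OF wedge_in_ext2])
  also have "casimir e f (wedge x y) x y = quartic ?X ?Y - 2 * (\<Sum>i<5. ?F ?X ?Y i * ?E ?X ?Y i)"
    unfolding casimir_def two_form_wedge quartic_def sum_distrib_left sum_subtractf[symmetric]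
    by (rule sum.cong[OF refl])
      (simp add: pair_create pair_annihilate create_form_commute[of _ ?Y ?X] annihilate_form_commute[of _ ?Y ?X]
        algebra_simps)
  also have "\<dots> = quartic ?X ?Y + quartic ?X ?Y / 2"
    using quartic_polarized[of ?X ?Y] by (simp add: field_simps)
  finally show ?thesis by (simp add: field_simps)
qed

end

context spinor_modules begin

text \<open>In a frame where \<open>w (f\<^sub>0 t, f\<^sub>1 t)\<close> is nonzero, the vector \<open>t \<and> f\<^sub>0 f\<^sub>1 t\<close> has the opposite weight and is not
  orthogonal to \<open>w\<close>.\<close>

lemma quadric_smooth:
  assumes h: "hyperbolic 5 e f"
  shows "smooth_quadric ext2 (quadric e f)"
  unfolding smooth_quadric_def
proof (intro conjI ballI impI quadric_hom_poly)
  fix w :: "'k ^ (16 \<times> 16)" assume w: "w \<in> ext2" "w \<noteq> 0"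
  obtain e' f' t where fr: "frame q c c' e' f' t" and nz: "two_form w (c' (f' 0) t) (c' (f' 1) t) \<noteq> 0"
    using frame_detects[OF w] by blast
  interpret n: frame q c c' e' f' t by (rule fr)
  have eq: "quadric e f = quadric e' f'"
    by (rule quadric_independent[OF h n.hyp])
  have "polar (quadric e' f') w (wedge t (n.B 0 1)) \<noteq> 0"
    unfolding n.polar_quadric_wedge[OF w(1)] n.casimir_vacuum[OF w(1)] using nz by simp
  thus "\<exists>u\<in>ext2. polar (quadric e f) w u \<noteq> 0" unfolding eq using wedge_in_ext2 by blast
qed

end

section \<open>Linear spaces on the spinor variety\<close>

lemma dim_line: "s \<noteq> 0 \<Longrightarrow> vec.dim (vec.span {s}) = 1"
  by (simp add: vec.dim_eq_card_independent vec.dependent_single)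

lemma proj_iff: "l \<in> proj W \<longleftrightarrow> (\<exists>s. s \<noteq> 0 \<and> l = vec.span {s} \<and> vec.span {s} \<subseteq> W)"
proof
  assume l: "l \<in> proj W"
  then obtain v where v: "lin_indep 1 v" "v 0 \<in> l" using subspace_family[of l 1] by (auto simp: grass_def)
  have "v 0 \<noteq> 0" using lin_indepD[OF v(1), of "\<lambda>_. 1" 0] by auto
  moreover have "l = vec.span {v 0}"
  proof
    show "vec.span {v 0} \<subseteq> l" using l v(2) by (intro vec.span_minimal) (auto simp: grass_def)
    show "l \<subseteq> vec.span {v 0}"
    proof
      fix u assume "u \<in> l"
      then obtain x where "u = (\<Sum>i<1. x i *s v i)"
        using lin_indep_spans[OF v(1), of l u] l v(2) by (auto simp: grass_def)
      thus "u \<in> vec.span {v 0}" by (auto simp: vec.span_singleton)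
    qed
  qed
  ultimately show "\<exists>s. s \<noteq> 0 \<and> l = vec.span {s} \<and> vec.span {s} \<subseteq> W"
    using l by (auto simp: grass_def)
next
  assume "\<exists>s. s \<noteq> 0 \<and> l = vec.span {s} \<and> vec.span {s} \<subseteq> W"
  thus "l \<in> proj W" by (auto simp: grass_def dim_line)
qed

lemma outside_span:
  assumes "vec.dim L = n" "length xs < n"
  shows "\<exists>s\<in>L. s \<notin> vec.span (set xs)"
proof (rule ccontr)
  assume "\<not> ?thesis"
  hence "vec.dim L \<le> card (set xs)" by (intro vec.dim_le_card) auto
  thus False using assms card_length[of xs] by simp
qed

context vacuum_frame begin

lemma scale_vacuum: "a \<noteq> 0 \<Longrightarrow> vacuum_frame q c c' e f (a *s t)"
  using hyp vacuum t_nonzero by unfold_locales auto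

lemma adapt:
  assumes "lin_indep m v" "\<And>i. i < m \<Longrightarrow> v i \<in> vec.span (f ` {..<5})"
  shows "\<exists>e' f' \<mu>. \<mu> \<noteq> 0 \<and> frame q c c' e' f' (\<mu> *s t) \<and> (\<forall>i<m. f' i = v i)"
proof -
  obtain e' f' where 1: "vacuum_frame q c c' e' f' t" "\<forall>i<m. f' i = v i"
    using change_basis[OF assms] by blast
  show ?thesis using vacuum_frame.normalize[OF 1(1)] 1(2) by blast
qed

end

context frame begin

lemma vacuum_isotropic_frame: "t \<star> c' v t = 0"
proof -
  have "create_form (coord t) (coord t) i = 0" "annihilate_form (coord t) (coord t) i = 0" if "i < 5" for i
    by (rule less_5_cases[OF that]; simp add: create_form_def annihilate_form_def coord_t)+
  thus ?thesis
    by (subst hyperbolic_expand[OF hyp, of v])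
      (simp add: c'_sum scalar_product_sum pair_create pair_annihilate)
qed

lemma coord_product:
  assumes "k < 16"
  shows "coord (c (\<Sum>l<5. a l *s f l) (c' (\<Sum>m<5. d m *s f m) t)) k =
    [0, a 0 * d 1 - a 1 * d 0, a 0 * d 2 - a 2 * d 0, a 0 * d 3 - a 3 * d 0, a 0 * d 4 - a 4 * d 0, a 1 * d 2 - a 2 * d 1, a 1 * d 3 - a 3 * d 1, a 1 * d 4 - a 4 * d 1, a 2 * d 3 - a 3 * d 2, a 2 * d 4 - a 4 * d 2, a 3 * d 4 - a 4 * d 3, 0, 0, 0, 0, 0] ! k"
  by (rule less_16_cases[OF assms];
      simp add: lessThan_nat_numeral coord_def \<sigma>_def adjoint normal_order t_pair_A t_pair_C normalized algebra_simps)

text \<open>The equations say that the Pfaffians of the skew matrix of \<open>y\<close> vanish, so it has rank two and is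
  spanned by two of its rows.\<close>

lemma decomposable:
  assumes y0: "coord y 0 = 0" and yp: "coord y 11 = 0" "coord y 12 = 0" "coord y 13 = 0" "coord y 14 = 0" "coord y 15 = 0"
    and iso: "\<And>i. i < 5 \<Longrightarrow> create_form (coord y) (coord y) i = 0" and y: "y \<noteq> 0"
  shows "\<exists>\<alpha>\<in>vec.span (f ` {..<5}). \<exists>\<beta>\<in>vec.span (f ` {..<5}).
    y = c \<alpha> (c' \<beta> t) \<and> (\<forall>a d. a *s \<alpha> + d *s \<beta> = 0 \<longrightarrow> a = 0 \<and> d = 0)"
proof -
  define X where "X = coord y"
  define om where "om i j = [[0, X 1, X 2, X 3, X 4], [- X 1, 0, X 5, X 6, X 7], [- X 2, - X 5, 0, X 8, X 9], [- X 3, - X 6, - X 8, 0, X 10], [- X 4, - X 7, - X 9, - X 10, 0]] ! i ! j" for i j :: nat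
  have "2 * (X 5 * X 10 - X 6 * X 9 + X 7 * X 8) = 0" "2 * (X 2 * X 10 - X 3 * X 9 + X 4 * X 8) = 0"
    "2 * (X 1 * X 10 - X 3 * X 7 + X 4 * X 6) = 0" "2 * (X 1 * X 9 - X 2 * X 7 + X 4 * X 5) = 0"
    "2 * (X 1 * X 8 - X 2 * X 6 + X 3 * X 5) = 0"
    using iso[of 0] iso[of 1] iso[of 2] iso[of 3] iso[of 4] y0
    unfolding create_form_def X_def[symmetric] by (simp_all, algebra+)
  hence P: "X 5 * X 10 - X 6 * X 9 + X 7 * X 8 = 0" "X 2 * X 10 - X 3 * X 9 + X 4 * X 8 = 0"
    "X 1 * X 10 - X 3 * X 7 + X 4 * X 6 = 0" "X 1 * X 9 - X 2 * X 7 + X 4 * X 5 = 0"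
    "X 1 * X 8 - X 2 * X 6 + X 3 * X 5 = 0" unfolding mult_eq_0_iff by simp_all
  have pluecker: "om i j * om l m = om i l * om j m - om i m * om j l"
    if "i < 5" "j < 5" "l < 5" "m < 5" for i j l m
    by (rule less_5_cases[OF that(1)]; rule less_5_cases[OF that(2)]; rule less_5_cases[OF that(3)];
        rule less_5_cases[OF that(4)]; (simp add: om_def, (use P in algebra)?))
  have skew: "om j i = - om i j" if "i < 5" "j < 5" for i j
    by (rule less_5_cases[OF that(1)]; rule less_5_cases[OF that(2)]; simp add: om_def)
  have "\<exists>i j. i < 5 \<and> j < 5 \<and> om i j \<noteq> 0"
  proof (rule ccontr)
    assume "\<not> ?thesis"
    hence om0: "om i j = 0" if "i < 5" "j < 5" for i j using that by blast
    have "coord y k = coord 0 k" if "k < 16" for k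
      by (rule less_16_cases[OF that])
        (use om0[of 0 1] om0[of 0 2] om0[of 0 3] om0[of 0 4] om0[of 1 2] om0[of 1 3] om0[of 1 4]
           om0[of 2 3] om0[of 2 4] om0[of 3 4] y0 yp in \<open>simp_all add: om_def X_def\<close>)
    thus False using y coord_eqI by blast
  qed
  then obtain i j where ij: "i < 5" "j < 5" "om i j \<noteq> 0" by blast
  have om_X: "om 0 1 = coord y 1" "om 0 2 = coord y 2" "om 0 3 = coord y 3" "om 0 4 = coord y 4" "om 1 2 = coord y 5" "om 1 3 = coord y 6" "om 1 4 = coord y 7" "om 2 3 = coord y 8" "om 2 4 = coord y 9" "om 3 4 = coord y 10"
    by (simp_all add: om_def X_def)
  define \<alpha> where "\<alpha> = (\<Sum>l<5. om i l *s f l)"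
  define \<beta> where "\<beta> = (\<Sum>m<5. (om j m / om i j) *s f m)"
  have entry: "om i l * om j m / om i j - om i m * om j l / om i j = om l m" if "l < 5" "m < 5" for l m
    using pluecker[OF ij(1,2) that] ij(3) by (simp add: field_simps)
  have "y = c \<alpha> (c' \<beta> t)"
  proof (rule coord_eqI)
    fix k :: nat assume "k < 16"
    thus "coord y k = coord (c \<alpha> (c' \<beta> t)) k"
      unfolding \<alpha>_def \<beta>_def coord_product[OF \<open>k < 16\<close>]
      by (rule less_16_cases) (simp_all add: entry om_X y0 yp)
  qed
  moreover have "\<alpha> \<in> vec.span (f ` {..<5})" "\<beta> \<in> vec.span (f ` {..<5})"
    unfolding \<alpha>_def \<beta>_def by (rule span_familyI)+
  moreover have "a = 0 \<and> d = 0" if z: "a *s \<alpha> + d *s \<beta> = 0" for a d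
  proof -
    have "b (e m) (a *s \<alpha> + d *s \<beta>) = a * om i m + d * (om j m / om i j)" if "m < 5" for m
      using that by (simp add: \<alpha>_def \<beta>_def b_sum mult_delta_right)
    hence "a * om i m + d * (om j m / om i j) = 0" if "m < 5" for m using that unfolding z by simp
    from this[of j] this[of i] have "a * om i j + d * (om j j / om i j) = 0" "a * om i i + d * (om j i / om i j) = 0"
      using ij by blast+
    moreover have "om i i = 0" "om j j = 0" using skew[of i i] skew[of j j] ij by (simp_all add: eq_neg_iff_add_eq_0)
    ultimately show ?thesis using ij skew[OF ij(1,2)] by simp
  qed
  ultimately show ?thesis by blast
qed

end

text \<open>A five-dimensional space \<open>L\<close> of spinors on which all vectors attached to spinors vanish is of the
  form \<open>c(V) t\<close> for a pure spinor \<open>t\<close> of the other kind. For the proof, the frame is adapted to more and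
  more elements of \<open>L\<close>.\<close>

locale isotropic_space = frame +
  fixes L :: "('a ^ 16) set"
  assumes L: "vec.subspace L" "vec.dim L = 5" and t_L: "t \<in> L"
    and isotropic: "\<And>s s' v. s \<in> L \<Longrightarrow> s' \<in> L \<Longrightarrow> s \<star> c' v s' = 0"
begin

lemmas L_closed = vec.subspace_add[OF L(1)] vec.subspace_diff[OF L(1)] vec.subspace_scale[OF L(1)]
  vec.subspace_neg[OF L(1)] vec.subspace_0[OF L(1)]

lemma create_form_L: "s \<in> L \<Longrightarrow> s' \<in> L \<Longrightarrow> i < 5 \<Longrightarrow> create_form (coord s) (coord s') i = 0"
  using isotropic pair_create by metis

lemma coord_p:
  assumes "s \<in> L"
  shows "coord s 11 = 0" "coord s 12 = 0" "coord s 13 = 0" "coord s 14 = 0" "coord s 15 = 0"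
  using create_form_L[OF t_L assms, of 0] create_form_L[OF t_L assms, of 1] create_form_L[OF t_L assms, of 2]
    create_form_L[OF t_L assms, of 3] create_form_L[OF t_L assms, of 4]
  by (simp_all add: create_form_def coord_t)

lemma adapt_L:
  assumes "lin_indep m v" "\<And>i. i < m \<Longrightarrow> v i \<in> vec.span (f ` {..<5})"
  shows "\<exists>e' f' \<mu>. \<mu> \<noteq> 0 \<and> isotropic_space q c c' e' f' (\<mu> *s t) L \<and> (\<forall>i<m. f' i = v i)"
proof -
  obtain e' f' \<mu> where 1: "\<mu> \<noteq> 0" "frame q c c' e' f' (\<mu> *s t)" "\<forall>i<m. f' i = v i"
    using adapt[OF assms] by blast
  have "isotropic_space q c c' e' f' (\<mu> *s t) L"
    using 1(2) L isotropic L_closed(3)[OF t_L] by (simp add: isotropic_space_def isotropic_space_axioms_def)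
  thus ?thesis using 1 by blast
qed

text \<open>An element of \<open>L\<close> outside the line of \<open>t\<close> may be chosen of degree two; it is then decomposable.\<close>

lemma frame_with_one_edge: "\<exists>e' f' t'. isotropic_space q c c' e' f' t' L \<and> c (f' 0) (c' (f' 1) t') \<in> L"
proof -
  obtain s where s: "s \<in> L" "s \<notin> vec.span {t}" using outside_span[OF L(2), of "[t]"] by auto
  define y where "y = s - coord s 0 *s t"
  have yL: "y \<in> L" unfolding y_def by (intro L_closed s t_L)
  have "y \<noteq> 0" using s(2) by (auto simp: y_def vec.span_singleton)
  moreover have "coord y 0 = 0" by (simp add: y_def coord_t)
  ultimately obtain \<alpha> \<beta> where ab: "\<alpha> \<in> vec.span (f ` {..<5})" "\<beta> \<in> vec.span (f ` {..<5})"
    "y = c \<alpha> (c' \<beta> t)" "\<forall>a d. a *s \<alpha> + d *s \<beta> = 0 \<longrightarrow> a = 0 \<and> d = 0"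
    using decomposable[OF _ coord_p[OF yL]] create_form_L[OF yL yL] by blast
  define v where "v = (!) [\<alpha>, \<beta>]"
  have "lin_indep 2 v" by (rule lin_indep_2I) (use ab(4) in \<open>simp add: v_def\<close>)
  moreover have "v i \<in> vec.span (f ` {..<5})" if "i < 2" for i
  proof -
    have "i = 0 \<or> i = 1" using that by linarith
    thus ?thesis using ab by (auto simp: v_def)
  qed
  ultimately obtain e' f' \<mu> where 1: "isotropic_space q c c' e' f' (\<mu> *s t) L" "\<forall>i<2. f' i = v i"
    using adapt_L by blast
  have "c (f' 0) (c' (f' 1) (\<mu> *s t)) = \<mu> *s y" using 1(2) ab by (simp add: v_def)
  hence "c (f' 0) (c' (f' 1) (\<mu> *s t)) \<in> L" using L_closed(3)[OF yL, of \<mu>] by (simp only:)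
  thus ?thesis using 1 by blast
qed

text \<open>A third element of \<open>L\<close> is of the form \<open>f\<^sub>0 \<and> u + f\<^sub>1 \<and> u'\<close> with proportional \<open>u\<close>, \<open>u'\<close>, so it shares a
  factor \<open>\<alpha>\<close> with \<open>f\<^sub>0 \<and> f\<^sub>1\<close>.\<close>

lemma frame_with_two_edges:
  assumes B01: "B 0 1 \<in> L"
  shows "\<exists>e' f' t'. isotropic_space q c c' e' f' t' L \<and> c (f' 0) (c' (f' 1) t') \<in> L \<and> c (f' 0) (c' (f' 2) t') \<in> L"
proof -
  have cB: "coord (B 0 1) k = (if k = 1 then 1 else 0)" if "k < 16" for k
    using coord_\<tau>[of 1 k] that by (auto simp: \<tau>_def)
  obtain s where s: "s \<in> L" "s \<notin> vec.span {t, B 0 1}"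
    using outside_span[OF L(2), of "[t, B 0 1]"] by auto
  define y where "y = s - coord s 0 *s t - coord s 1 *s B 0 1"
  have yL: "y \<in> L" unfolding y_def by (intro L_closed s t_L B01)
  have y_nz: "y \<noteq> 0"
  proof
    assume "y = 0"
    hence "s = coord s 0 *s t + coord s 1 *s B 0 1" by (simp add: y_def algebra_simps)
    moreover have "coord s 0 *s t + coord s 1 *s B 0 1 \<in> vec.span {t, B 0 1}"
      by (intro vec.span_add vec.span_scale vec.span_base) auto
    ultimately show False using s(2) by simp
  qed
  define Y where "Y = coord y"
  have Y01: "Y 0 = 0" "Y 1 = 0" by (simp_all add: Y_def y_def coord_t cB)
  have Y8: "Y 8 = 0" "Y 9 = 0" "Y 10 = 0"
    using create_form_L[OF B01 yL, of 2] create_form_L[OF B01 yL, of 3] create_form_L[OF B01 yL, of 4]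
    by (simp_all add: create_form_def cB Y_def)
  note Yp = coord_p[OF yL, folded Y_def]
  have "2 * (Y 3 * Y 7 - Y 4 * Y 6) = 0" "2 * (Y 4 * Y 5 - Y 2 * Y 7) = 0" "2 * (Y 2 * Y 6 - Y 3 * Y 5) = 0"
    using create_form_L[OF yL yL, of 2] create_form_L[OF yL yL, of 3] create_form_L[OF yL yL, of 4]
    by (simp_all add: create_form_def Y01 Y8 Yp flip: Y_def)
  hence minors: "Y 3 * Y 7 = Y 4 * Y 6" "Y 4 * Y 5 = Y 2 * Y 7" "Y 2 * Y 6 = Y 3 * Y 5"
    unfolding mult_eq_0_iff by simp_all
  have y_eq: "y = Y 2 *s B 0 2 + Y 3 *s B 0 3 + Y 4 *s B 0 4 + Y 5 *s B 1 2 + Y 6 *s B 1 3 + Y 7 *s B 1 4"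
    by (subst expand[of y])
      (simp add: lessThan_nat_numeral \<tau>_def Y01 Y8 Yp algebra_simps flip: Y_def)
  obtain \<nu> \<mu> z2 z3 z4 where Yz: "Y 2 = \<nu> * z2" "Y 3 = \<nu> * z3" "Y 4 = \<nu> * z4" "Y 5 = \<mu> * z2" "Y 6 = \<mu> * z3" "Y 7 = \<mu> * z4"
  proof -
    consider "Y 2 \<noteq> 0" | "Y 3 \<noteq> 0" | "Y 4 \<noteq> 0" | "Y 2 = 0" "Y 3 = 0" "Y 4 = 0" by blast
    thus thesis
    proof cases
      case 1 thus ?thesis using that[of 1 "Y 2" "Y 3" "Y 4" "Y 5 / Y 2"] minors by (simp add: field_simps)
    next
      case 2 thus ?thesis using that[of 1 "Y 2" "Y 3" "Y 4" "Y 6 / Y 3"] minors by (simp add: field_simps)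
    next
      case 3 thus ?thesis using that[of 1 "Y 2" "Y 3" "Y 4" "Y 7 / Y 4"] minors by (simp add: field_simps)
    next
      case 4 thus ?thesis using that[of 0 "Y 5" "Y 6" "Y 7" 1] by simp
    qed
  qed
  have lm: "\<nu> \<noteq> 0 \<or> \<mu> \<noteq> 0" and zz: "z2 \<noteq> 0 \<or> z3 \<noteq> 0 \<or> z4 \<noteq> 0" using y_nz unfolding y_eq Yz by auto
  define \<alpha> where "\<alpha> = \<nu> *s f 0 + \<mu> *s f 1"
  define \<beta> where "\<beta> = (if \<nu> \<noteq> 0 then f 1 else f 0)"
  define \<zeta> where "\<zeta> = z2 *s f 2 + z3 *s f 3 + z4 *s f 4"
  define v where "v = (!) [\<alpha>, \<beta>, \<zeta>]"
  have "lin_indep 3 v"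
  proof (rule lin_indep_3I)
    fix x y z assume "x *s v 0 + y *s v 1 + z *s v 2 = 0"
    hence 0: "x *s \<alpha> + y *s \<beta> + z *s \<zeta> = 0" by (simp add: v_def)
    have e: "b (e i) (x *s \<alpha> + y *s \<beta> + z *s \<zeta>) = 0" for i unfolding 0 by simp
    show "x = 0 \<and> y = 0 \<and> z = 0"
      using e[of 0] e[of 1] e[of 2] e[of 3] e[of 4] lm zz
      by (auto simp: \<alpha>_def \<beta>_def \<zeta>_def split: if_splits)
  qed
  moreover have "v i \<in> vec.span (f ` {..<5})" if "i < 3" for i
  proof -
    have f: "f j \<in> vec.span (f ` {..<5})" if "j < 5" for j using that by (intro vec.span_base) auto
    have "\<alpha> \<in> vec.span (f ` {..<5})" "\<beta> \<in> vec.span (f ` {..<5})" "\<zeta> \<in> vec.span (f ` {..<5})"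
      unfolding \<alpha>_def \<beta>_def \<zeta>_def by (auto intro!: vec.span_add vec.span_scale f)
    moreover have "i = 0 \<or> i = 1 \<or> i = 2" using that by linarith
    ultimately show ?thesis by (auto simp: v_def)
  qed
  ultimately obtain e' f' \<kappa> where 1: "isotropic_space q c c' e' f' (\<kappa> *s t) L" "\<forall>i<3. f' i = v i"
    using adapt_L by blast
  have f': "f' 0 = \<alpha>" "f' 1 = \<beta>" "f' 2 = \<zeta>" using 1(2) by (simp_all add: v_def)
  have "c (f' 0) (c' (f' 1) (\<kappa> *s t)) = (if \<nu> \<noteq> 0 then \<kappa> * \<nu> else - \<kappa> * \<mu>) *s B 0 1"
    unfolding f' by (simp add: \<alpha>_def \<beta>_def normal_order)
  moreover have "c (f' 0) (c' (f' 2) (\<kappa> *s t)) = \<kappa> *s y"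
    unfolding f' y_eq Yz by (simp add: \<alpha>_def \<zeta>_def normal_order algebra_simps)
  ultimately show ?thesis using 1(1) L_closed(3)[OF B01] L_closed(3)[OF yL] by metis
qed

text \<open>Now the elements of \<open>L\<close> are combinations of \<open>t\<close>, the \<open>f\<^sub>0 f\<^sub>j t\<close> and \<open>f\<^sub>1 f\<^sub>2 t\<close>. If the last one occurred, \<open>L\<close> would
  be contained in the span of \<open>t\<close> and the three products of \<open>f\<^sub>0\<close>, \<open>f\<^sub>1\<close>, \<open>f\<^sub>2\<close>, which has dimension four only.\<close>

lemma contains_clifford_image:
  assumes B01: "B 0 1 \<in> L" and B02: "B 0 2 \<in> L"
  shows "c v (A 0) \<in> L"
proof -
  have cB: "coord (B 0 1) k = (if k = 1 then 1 else 0)" "coord (B 0 2) k = (if k = 2 then 1 else 0)" if "k < 16" for k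
    using coord_\<tau>[of 1 k] coord_\<tau>[of 2 k] that by (auto simp: \<tau>_def)
  have zero: "coord s 6 = 0" "coord s 7 = 0" "coord s 8 = 0" "coord s 9 = 0" "coord s 10 = 0" if "s \<in> L" for s
    using create_form_L[OF B01 that, of 2] create_form_L[OF B01 that, of 3] create_form_L[OF B01 that, of 4]
      create_form_L[OF B02 that, of 3] create_form_L[OF B02 that, of 4]
    by (simp_all add: create_form_def cB)
  have L_eq: "s = coord s 0 *s t + coord s 1 *s B 0 1 + coord s 2 *s B 0 2 + coord s 3 *s B 0 3 + coord s 4 *s B 0 4
      + coord s 5 *s B 1 2" if "s \<in> L" for s
    by (subst (1) expand[of s]) (simp add: lessThan_nat_numeral \<tau>_def zero[OF that] coord_p[OF that] algebra_simps)
  have rel: "coord s 5 * coord s' 4 + coord s 4 * coord s' 5 = 0" "coord s 5 * coord s' 3 + coord s 3 * coord s' 5 = 0"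
    if "s \<in> L" "s' \<in> L" for s s'
    using create_form_L[OF that, of 3] create_form_L[OF that, of 4]
    by (simp_all add: create_form_def zero[OF that(1)] zero[OF that(2)] coord_p[OF that(1)] coord_p[OF that(2)] algebra_simps) algebra
  have five: "coord s 5 = 0" if s: "s \<in> L" for s
  proof (rule ccontr)
    assume nz: "coord s 5 \<noteq> 0"
    have s34: "coord s 3 = 0" "coord s 4 = 0" using rel[OF s s] nz by (simp_all add: mult.commute flip: mult_2)
    have L34: "coord s' 3 = 0" "coord s' 4 = 0" if "s' \<in> L" for s' using rel[OF s that] nz s34 by simp_all
    obtain s' where s': "s' \<in> L" "s' \<notin> vec.span {t, B 0 1, B 0 2, B 1 2}"
      using outside_span[OF L(2), of "[t, B 0 1, B 0 2, B 1 2]"] by auto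
    have "s' = coord s' 0 *s t + coord s' 1 *s B 0 1 + coord s' 2 *s B 0 2 + coord s' 5 *s B 1 2"
      using L_eq[OF s'(1)] L34[OF s'(1)] by simp
    also have "\<dots> \<in> vec.span {t, B 0 1, B 0 2, B 1 2}"
      by (intro vec.span_add vec.span_scale vec.span_base) auto
    finally show False using s'(2) by simp
  qed
  let ?S = "{t, B 0 1, B 0 2, B 0 3, B 0 4}"
  have sub: "L \<subseteq> vec.span ?S"
  proof
    fix s assume s: "s \<in> L"
    have "s = coord s 0 *s t + coord s 1 *s B 0 1 + coord s 2 *s B 0 2 + coord s 3 *s B 0 3 + coord s 4 *s B 0 4"
      using L_eq[OF s] five[OF s] by simp
    also have "\<dots> \<in> vec.span ?S" by (intro vec.span_add vec.span_scale vec.span_base) auto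
    finally show "s \<in> vec.span ?S" .
  qed
  have "card ?S \<le> 5" using card_length[of "[t, B 0 1, B 0 2, B 0 3, B 0 4]"] by simp
  moreover have "vec.dim (vec.span ?S) \<le> card ?S" by (rule vec.dim_le_card) (simp_all only: finite.intros order_refl)
  ultimately have "vec.dim (vec.span ?S) \<le> vec.dim L" unfolding L(2) by (rule order_trans[rotated])
  hence "L = vec.span ?S" by (rule vec.subspace_dim_equal[OF L(1) vec.subspace_span sub])
  hence "?S \<subseteq> L" using vec.span_superset[of ?S] by simp
  hence S: "B 0 1 \<in> L" "B 0 2 \<in> L" "B 0 3 \<in> L" "B 0 4 \<in> L" by simp_all
  have "c (e i) (A 0) \<in> L" "c (f i) (A 0) \<in> L" if "i < 5" for i
    by (rule less_5_cases[OF that]; simp add: normal_order S L_closed t_L)+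
  thus ?thesis
    by (subst hyperbolic_expand[OF hyp, of v]) (auto simp: c_sum intro!: vec.subspace_sum[OF L(1)] L_closed)
qed

end

context spinor_modules begin

lemma pair_commute: "x \<star> c' v y = y \<star> c' v x"
  using exists_vacuum_frame vacuum_frame.pair_commute by blast

lemma vacuum_isotropic:
  assumes "vacuum_frame q c c' e f t"
  shows "t \<star> c' v t = 0"
proof -
  obtain \<mu> where "\<mu> \<noteq> 0" "frame q c c' e f (\<mu> *s t)" using vacuum_frame.normalize[OF assms] by blast
  thus ?thesis using frame.vacuum_isotropic_frame[of q c c' e f "\<mu> *s t" v] by simp
qed

lemma five_space_of_pure_spinors:
  assumes L: "vec.subspace L" "vec.dim L = 5"
    and pure: "\<And>s. s \<in> L \<Longrightarrow> s \<noteq> 0 \<Longrightarrow> \<exists>e f. vacuum_frame q c c' e f s"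
  shows "\<exists>e f t. vacuum_frame q c' c e f t \<and> (\<forall>v. c v t \<in> L)"
proof -
  have iso: "s \<star> c' v s = 0" if "s \<in> L" for s v
    using pure[OF that] vacuum_isotropic by (cases "s = 0") auto
  have isotropic: "s \<star> c' v s' = 0" if "s \<in> L" "s' \<in> L" for s s' v
  proof -
    have "(s + s') \<star> c' v (s + s') = 0" by (intro iso vec.subspace_add L that)
    hence "2 * (s \<star> c' v s') = 0" using iso[OF that(1)] iso[OF that(2)] pair_commute[of s' v s] by simp
    thus ?thesis by simp
  qed
  obtain s where s: "s \<in> L" "s \<notin> vec.span {}" using outside_span[OF L(2), of "[]"] by auto
  hence "s \<noteq> 0" by simp
  then obtain e f where "vacuum_frame q c c' e f s" using pure s(1) by blast
  then obtain \<mu> where "frame q c c' e f (\<mu> *s s)" using vacuum_frame.normalize by blast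
  hence "isotropic_space q c c' e f (\<mu> *s s) L"
    using L isotropic vec.subspace_scale[OF L(1) s(1)] by (simp add: isotropic_space_def isotropic_space_axioms_def)
  then obtain e1 f1 t1 where "isotropic_space q c c' e1 f1 t1 L" "c (f1 0) (c' (f1 1) t1) \<in> L"
    using isotropic_space.frame_with_one_edge by blast
  then obtain e2 f2 t2 where 2: "isotropic_space q c c' e2 f2 t2 L" "c (f2 0) (c' (f2 1) t2) \<in> L"
    "c (f2 0) (c' (f2 2) t2) \<in> L" using isotropic_space.frame_with_two_edges by blast
  interpret isotropic_space q c c' e2 f2 t2 L by (rule 2(1))
  have "vacuum_frame q c' c (e2(0 := f2 0)) (f2(0 := e2 0)) (c' (f2 0) t2)" by (rule swap_one) simp
  thus ?thesis using contains_clifford_image[OF 2(2,3)] by blast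
qed

section \<open>The special locus and the quadric\<close>

lemma special_orthogonal:
  assumes "K \<in> special_locus_open q c c'"
  shows "\<exists>e f t. frame q c c' e f t \<and> (\<forall>k\<in>K. \<forall>v. k \<star> c' v t = 0)"
proof -
  interpret s: spinor_modules q c' c by (rule swap)
  obtain L where L: "L \<in> grass 5 UNIV" "proj L \<subseteq> linear_section (spinor_variety q c) K"
    using assms by (auto simp: special_locus_open_def)
  have line: "vec.span {s} \<in> proj L" if "s \<in> L" "s \<noteq> 0" for s
    using that L(1) vec.span_minimal[of "{s}" L] by (auto simp: grass_def dim_line)
  have pure: "\<exists>e f. vacuum_frame q c' c e f s" if s: "s \<in> L" "s \<noteq> 0" for s
  proof -
    have "vec.span {s} \<in> spinor_variety q c" using line[OF s] L(2) by (auto simp: linear_section_def)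
    then obtain e f t where t: "vacuum_frame q c' c e f t" "vec.span {s} = vec.span {t}"
      using s.spinor_variety_iff by blast
    have "s \<in> vec.span {t}" using t(2) vec.span_base[of s "{s}"] by auto
    then obtain a where "s = a *s t" by (auto simp: vec.span_singleton)
    moreover from this have "a \<noteq> 0" using s by auto
    ultimately show ?thesis using vacuum_frame.scale_vacuum[OF t(1)] by blast
  qed
  have ann: "k \<star> s = 0" if "k \<in> K" "s \<in> L" for k s
  proof (cases "s = 0")
    case False
    hence "vec.span {s} \<subseteq> annihilator K" using line[OF that(2)] L(2) by (auto simp: linear_section_def grass_def)
    hence "s \<in> annihilator K" using vec.span_base[of s "{s}"] by auto
    thus ?thesis using that(1) by (auto simp: annihilator_def)
  qed simp
  obtain e f t where t: "vacuum_frame q c c' e f t" "\<And>v. c' v t \<in> L"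
    using s.five_space_of_pure_spinors[of L] L(1) pure by (auto simp: grass_def)
  obtain \<mu> where "frame q c c' e f (\<mu> *s t)" using vacuum_frame.normalize[OF t(1)] by blast
  moreover have "k \<star> c' v (\<mu> *s t) = 0" if "k \<in> K" for k v using ann[OF that t(2)] by simp
  ultimately show ?thesis by blast
qed

text \<open>Orthogonality to \<open>c'(V) t\<close> means that the component in degree four vanishes with respect to the frame
  of \<open>t\<close>; so all attached vectors lie in one isotropic space.\<close>

lemma special_quadric:
  assumes K: "K \<in> special_locus_open q c c'" and xy: "x \<in> K" "y \<in> K" and h: "hyperbolic 5 e f"
  shows "quadric e f (wedge x y) = 0"
proof -
  obtain e' f' t where "frame q c c' e' f' t" and orth: "\<And>k v. k \<in> K \<Longrightarrow> k \<star> c' v t = 0"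
    using special_orthogonal[OF K] by blast
  then interpret n: frame q c c' e' f' t by blast
  have p: "n.coord k 11 = 0" "n.coord k 12 = 0" "n.coord k 13 = 0" "n.coord k 14 = 0" "n.coord k 15 = 0"
    if "k \<in> K" for k using orth[OF that] by (simp_all add: n.coord_def n.\<sigma>_def)
  have "annihilate_form (n.coord x) (n.coord x) i = 0" "annihilate_form (n.coord y) (n.coord y) i = 0" if "i < 5" for i
    by (rule less_5_cases[OF that]; simp add: annihilate_form_def p[OF xy(1)] p[OF xy(2)])+
  hence "quadric e' f' (wedge x y) = 0" unfolding n.quadric_wedge quartic_def by simp
  moreover have "quadric e f = quadric e' f'"
    by (rule quadric_independent[OF h n.hyp])
  ultimately show ?thesis by simp
qed

text \<open>A nonzero spinor in \<open>c'(V) t\<close> is \<open>c' v t\<close> with \<open>v\<close> in the span of the \<open>f\<^sub>i\<close>. In a frame with \<open>f\<^sub>0 = v\<close> and the same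
  vacuum, swapping \<open>e\<^sub>0\<close> and \<open>f\<^sub>0\<close> turns it into a vacuum. So \<open>c'(V) t\<close> is a linear space on the spinor variety.\<close>

lemma special_if_orthogonal:
  assumes K: "K \<in> grass 2 UNIV" and no_pure: "\<And>k. k \<in> K \<Longrightarrow> k \<noteq> 0 \<Longrightarrow> \<exists>v. k \<star> c' v k \<noteq> 0"
    and t: "vacuum_frame q c c' e f t" and orth: "\<And>k v. k \<in> K \<Longrightarrow> k \<star> c' v t = 0"
  shows "K \<in> special_locus_open q c c'"
proof -
  interpret vacuum_frame q c c' e f t by (rule t)
  have "proj K \<inter> spinor_variety q c' = {}"
  proof (rule ccontr)
    assume "\<not> ?thesis"
    then obtain l where l: "l \<in> proj K" "l \<in> spinor_variety q c'" by blast
    obtain e1 f1 t1 where 1: "vacuum_frame q c c' e1 f1 t1" "l = vec.span {t1}"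
      using l(2)[unfolded spinor_variety_iff] by blast
    have "t1 \<in> l" unfolding 1(2) by (rule vec.span_base) simp
    hence "t1 \<in> K" using l(1) by (auto simp: grass_def)
    moreover have "t1 \<noteq> 0" using 1(1) by (simp add: vacuum_frame_def vacuum_frame_axioms_def)
    ultimately show False using no_pure vacuum_isotropic[OF 1(1)] by blast
  qed
  moreover have "\<exists>L\<in>grass 5 UNIV. proj L \<subseteq> linear_section (spinor_variety q c) K"
  proof
    define a where "a i = A i" for i
    have a_indep: "lin_indep 5 a"
      unfolding lin_indep_def
    proof (intro allI impI)
      fix x i assume x: "(\<Sum>i<5. x i *s a i) = 0" and i: "i < (5::nat)"
      have "c (e i) (\<Sum>i<5. x i *s a i) = (\<Sum>j<5. if i = j then x j *s t else 0)"
        unfolding c_sum by (rule sum.cong) (use i in \<open>auto simp: a_def normal_order\<close>)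
      hence "x i *s t = 0" using i unfolding x by simp
      thus "x i = 0" using t_nonzero by simp
    qed
    let ?L = "vec.span (a ` {..<5})"
    show "?L \<in> grass 5 UNIV" using dim_span_family[OF a_indep] by (simp add: grass_def)
    show "proj ?L \<subseteq> linear_section (spinor_variety q c) K"
    proof
      fix l assume "l \<in> proj ?L"
      then obtain s where s: "s \<noteq> 0" "l = vec.span {s}" "vec.span {s} \<subseteq> ?L" by (auto simp: proj_iff)
      hence "s \<in> ?L" using vec.span_base[of s "{s}"] by auto
      then obtain x where x: "s = (\<Sum>i<5. x i *s a i)"
        using lin_indep_spans[OF a_indep, of ?L s] dim_span_family[OF a_indep] by (auto intro: vec.span_base)
      define v where "v = (\<Sum>i<5. x i *s f i)"
      have sv: "s = c' v t" by (simp add: x v_def c'_sum a_def)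
      have "lin_indep 1 (\<lambda>_::nat. v)" by (rule lin_indep_1I) (use s(1) sv in auto)
      moreover have "v \<in> vec.span (f ` {..<5})" unfolding v_def by (rule span_familyI)
      ultimately obtain e1 f1 where 1: "vacuum_frame q c c' e1 f1 t" "\<forall>i<1. f1 i = v"
        using change_basis[of 1 "\<lambda>_. v"] by auto
      have "vacuum_frame q c' c (e1(0 := f1 0)) (f1(0 := e1 0)) s"
        using vacuum_frame.swap_one[OF 1(1), of 0] 1(2) sv by simp
      hence "l \<in> spinor_variety q c" unfolding s(2) spinor_modules.spinor_variety_iff[OF swap] by blast
      moreover have "vec.span {s} \<subseteq> annihilator K"
        using orth by (auto simp: vec.span_singleton annihilator_def sv)
      ultimately show "l \<in> linear_section (spinor_variety q c) K"
        using s by (auto simp: linear_section_def proj_iff)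
    qed
  qed
  ultimately show ?thesis using K by (simp add: special_locus_open_def)
qed

end

section \<open>Spinor planes on the quadric are generically special\<close>

text \<open>For a plane spanned by \<open>x\<close>, \<open>y\<close> in general position the vectors attached to \<open>x\<close>, to the pair, and to \<open>y\<close>
  have linearly independent components in the span of the \<open>f\<^sub>i\<close>. The following minor detects this.\<close>

definition minor :: "(nat \<Rightarrow> 'k) \<Rightarrow> (nat \<Rightarrow> 'k) \<Rightarrow> 'k::comm_ring_1" where
  "minor X Y = (let u = create_form X X; v = create_form X Y; w = create_form Y Y in
     u 2 * (v 3 * w 4 - v 4 * w 3) - v 2 * (u 3 * w 4 - u 4 * w 3) + w 2 * (u 3 * v 4 - u 4 * v 3))"

lemma create_form_cong:
  assumes "\<And>k. k < 16 \<Longrightarrow> X k = X' k" "\<And>k. k < 16 \<Longrightarrow> Y k = Y' k" "i < 5"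
  shows "create_form X Y i = create_form X' Y' i"
  by (rule less_5_cases[OF assms(3)]; simp add: create_form_def assms(1,2))

lemma annihilate_form_cong:
  assumes "\<And>k. k < 16 \<Longrightarrow> X k = X' k" "\<And>k. k < 16 \<Longrightarrow> Y k = Y' k" "i < 5"
  shows "annihilate_form X Y i = annihilate_form X' Y' i"
  by (rule less_5_cases[OF assms(3)]; simp add: annihilate_form_def assms(1,2))

lemma quartic_cong:
  assumes "\<And>k. k < 16 \<Longrightarrow> X k = X' k" "\<And>k. k < 16 \<Longrightarrow> Y k = Y' k"
  shows "quartic X Y = quartic X' Y'"
  unfolding quartic_def
  by (intro sum.cong refl arg_cong2[where f="(+)"] arg_cong2[where f="(*)"] create_form_cong annihilate_form_cong)
    (simp_all add: assms)

lemma minor_cong: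
  assumes "\<And>k. k < 16 \<Longrightarrow> X k = X' k" "\<And>k. k < 16 \<Longrightarrow> Y k = Y' k"
  shows "minor X Y = minor X' Y'"
proof -
  have "create_form X Y i = create_form X' Y' i" "create_form X X i = create_form X' X' i"
    "create_form Y Y i = create_form Y' Y' i" if "i < 5" for i
    by (rule create_form_cong; simp add: assms that)+
  thus ?thesis by (simp add: minor_def Let_def)
qed

lemma span_pair: "k \<in> vec.span {x, y} \<longleftrightarrow> (\<exists>a d. k = a *s x + d *s y)"
proof
  assume "k \<in> vec.span {x, y}"
  then obtain a where "k - a *s x \<in> vec.span {y}" using vec.span_breakdown_eq[of k x "{y}"] by blast
  then obtain d where "k - a *s x = d *s y" by (auto simp: vec.span_singleton)
  hence "k = a *s x + d *s y" by (simp add: algebra_simps)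
  thus "\<exists>a d. k = a *s x + d *s y" by blast
next
  assume "\<exists>a d. k = a *s x + d *s y"
  moreover have "a *s x + d *s y \<in> vec.span {x, y}" for a d
    by (intro vec.span_add vec.span_scale vec.span_base) simp_all
  ultimately show "k \<in> vec.span {x, y}" by blast
qed

lemma span_pair_grass:
  assumes "\<And>a d. a *s x + d *s y = 0 \<Longrightarrow> a = 0 \<and> d = 0"
  shows "vec.span {x, y} \<in> grass 2 UNIV"
proof -
  have "lin_indep 2 ((!) [x, y])" by (rule lin_indep_2I) (use assms in simp)
  moreover have "(!) [x, y] ` {..<2} = {x, y}" by (auto simp: lessThan_nat_numeral)
  ultimately have "vec.dim (vec.span {x, y}) = 2" using dim_span_family by metis
  thus ?thesis by (simp add: grass_def)
qed

lemma grass_2_pair: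
  assumes "K \<in> grass 2 UNIV"
  shows "\<exists>x y. K = vec.span {x, y} \<and> (\<forall>a d. a *s x + d *s y = 0 \<longrightarrow> a = 0 \<and> d = 0)"
proof -
  obtain v where v: "lin_indep 2 v" "\<And>i. i < 2 \<Longrightarrow> v i \<in> K"
    using subspace_family[of K 2] assms by (auto simp: grass_def)
  have indep: "a = 0 \<and> d = 0" if "a *s v 0 + d *s v 1 = 0" for a d
    using lin_indepD[OF v(1), of "(!) [a, d]" 0] lin_indepD[OF v(1), of "(!) [a, d]" 1] that
    by (simp add: lessThan_nat_numeral add.commute)
  have "K = vec.span {v 0, v 1}"
  proof
    show "vec.span {v 0, v 1} \<subseteq> K" using assms v(2) by (intro vec.span_minimal) (auto simp: grass_def)
    show "K \<subseteq> vec.span {v 0, v 1}"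
    proof
      fix u assume "u \<in> K"
      then obtain x where "u = (\<Sum>i<2. x i *s v i)"
        using lin_indep_spans[OF v(1), of K u] assms v(2) by (auto simp: grass_def)
      hence "u = x 0 *s v 0 + x 1 *s v 1" by (simp add: lessThan_nat_numeral add.commute)
      thus "u \<in> vec.span {v 0, v 1}" unfolding span_pair by blast
    qed
  qed
  thus ?thesis using indep by blast
qed

lemma wedge_combination: "wedge (a *s x) (y - d *s (a *s x)) = a *s wedge x y"
  by (simp add: wedge_def vec_eq_iff algebra_simps)

context frame begin

text \<open>If \<open>x = t + p\<close> and \<open>y = \<Omega> + r\<close>, where \<open>\<Omega>\<close> has degree two and \<open>p\<close>, \<open>r\<close> have degree four, and if \<open>n\<close> is the
  Pfaffian vector of \<open>\<Omega>\<close>, then the equation of the quadric says that \<open>\<Omega>(p, r) = 0\<close>. As \<open>n\<close> lies in the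
  kernel of \<open>\<Omega>\<close>, the space spanned by \<open>p\<close>, \<open>r\<close>, \<open>n\<close> is isotropic for \<open>\<Omega>\<close>, and the bivector \<open>z\<close> that
  corresponds to this space is a pure spinor orthogonal to \<open>x\<close> and \<open>y\<close>.\<close>

lemma orthogonal_pure_spinor:
  assumes x0: "coord x 0 = 1" and x: "\<And>k. k \<in> {1..10} \<Longrightarrow> coord x k = 0" and y0: "coord y 0 = 0"
    and quartic: "quartic (coord x) (coord y) = 0" and minor: "minor (coord x) (coord y) \<noteq> 0"
  shows "\<exists>e' f' z. vacuum_frame q c c' e' f' z \<and> (\<forall>v. x \<star> c' v z = 0 \<and> y \<star> c' v z = 0)"
proof -
  define X where "X = coord x"
  define Y where "Y = coord y"
  define N where "N = create_form Y Y"
  define det3 where "det3 l m n = X (11 + l) * (Y (11 + m) * N n - Y (11 + n) * N m)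
    - X (11 + m) * (Y (11 + l) * N n - Y (11 + n) * N l) + X (11 + n) * (Y (11 + l) * N m - Y (11 + m) * N l)" for l m n
  \<comment> \<open>The bivector dual to the trivector of the vectors \<open>p\<close>, \<open>r\<close>, \<open>n\<close>.\<close>
  define Z where "Z = (!) [0, det3 2 3 4, - det3 1 3 4, det3 1 2 4, - det3 1 2 3, det3 0 3 4, - det3 0 2 4,
    det3 0 2 3, det3 0 1 4, - det3 0 1 3, det3 0 1 2, 0, 0, 0, 0, 0]"
  define z where "z = (\<Sum>j<16. Z j *s \<tau> j)"
  have X: "X 0 = 1" "X 1 = 0" "X 2 = 0" "X 3 = 0" "X 4 = 0" "X 5 = 0" "X 6 = 0" "X 7 = 0" "X 8 = 0" "X 9 = 0" "X 10 = 0"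
    using x x0 by (simp_all add: X_def)
  have Y0: "Y 0 = 0" using y0 by (simp add: Y_def)
  have Z: "coord z k = Z k" if "k < 16" for k using that by (simp add: z_def coord_combination)
  have Zv: "Z 0 = 0" "Z 11 = 0" "Z 12 = 0" "Z 13 = 0" "Z 14 = 0" "Z 15 = 0" by (simp_all add: Z_def)
  have "quartic X Y = 2 * (\<Sum>i<5. X (11 + i) * annihilate_form Y Y i)"
    by (simp add: quartic_def lessThan_nat_numeral create_form_def[of X X] annihilate_form_def[of X X] X algebra_simps)
  hence h: "(\<Sum>i<5. X (11 + i) * annihilate_form Y Y i) = 0" using quartic by (simp add: X_def Y_def)
  have XZ_c: "create_form X Z i = 0" if "i < 5" for i
    by (rule less_5_cases[OF that]; simp add: create_form_def X Zv)
  have XZ_a: "annihilate_form X Z i = 0" if "i < 5" for i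
    by (rule less_5_cases[OF that]; simp add: annihilate_form_def X Zv; simp add: Z_def det3_def algebra_simps)
  have YZ_a: "annihilate_form Y Z i = 0" if "i < 5" for i
    by (rule less_5_cases[OF that]; simp add: annihilate_form_def Zv; simp add: Z_def det3_def algebra_simps)
  define W where "W = (!) [0, 0, 0, 0, 0, 0, 0, 0, 0, 0, 0, N 0, N 1, N 2, N 3, N 4]"
  have kernel: "annihilate_form Y W i = 0" if "i < 5" for i
    by (rule less_5_cases[OF that]; simp add: annihilate_form_def W_def;
        simp add: N_def create_form_def Y0 algebra_simps)
  have YZ_c: "create_form Y Z i = 0" if "i < 5" for i
  proof -
    \<comment> \<open>Contracting \<open>p \<and> r \<and> n\<close> with \<open>\<Omega>\<close> gives \<open>\<Omega>(p, r) n + \<Omega>(r, n) p + \<Omega>(n, p) r\<close>.\<close>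
    have "2 * create_form Y Z i = - (\<Sum>i<5. X (11 + i) * annihilate_form Y Y i) * N i
        - 2 * (\<Sum>i<5. Y (11 + i) * annihilate_form Y W i) * X (11 + i)
        + 2 * (\<Sum>i<5. X (11 + i) * annihilate_form Y W i) * Y (11 + i)"
      by (rule less_5_cases[OF that];
          simp add: create_form_def Zv Y0 annihilate_form_def lessThan_nat_numeral Z_def det3_def W_def algebra_simps)
    thus ?thesis unfolding h by (simp add: kernel)
  qed
  have ZZ: "create_form (coord z) (coord z) i = 0" if "i < 5" for i
  proof -
    have "create_form (coord z) (coord z) i = create_form Z Z i"
      by (rule create_form_cong) (simp_all add: Z that)
    also have "\<dots> = 0"
      by (rule less_5_cases[OF that]; simp add: create_form_def Zv; simp add: Z_def det3_def algebra_simps)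
    finally show ?thesis .
  qed
  have orth: "x \<star> c' v z = 0 \<and> y \<star> c' v z = 0" for v
  proof -
    have "create_form (coord x) (coord z) i = 0" "create_form (coord y) (coord z) i = 0"
      "annihilate_form (coord x) (coord z) i = 0" "annihilate_form (coord y) (coord z) i = 0" if "i < 5" for i
      using XZ_c[OF that] XZ_a[OF that] YZ_c[OF that] YZ_a[OF that] create_form_cong[of "coord x" X "coord z" Z i]
        create_form_cong[of "coord y" Y "coord z" Z i] annihilate_form_cong[of "coord x" X "coord z" Z i]
        annihilate_form_cong[of "coord y" Y "coord z" Z i] that Z by (simp_all add: X_def Y_def)
    thus ?thesis
      by (subst (1 2) hyperbolic_expand[OF hyp, of v])
        (simp add: c'_sum scalar_product_sum pair_create pair_annihilate)
  qed
  have "minor X Y = 2 * Z 1"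
    by (simp add: minor_def Let_def create_form_def[of X] X Z_def det3_def N_def Y0 algebra_simps)
  hence "z \<noteq> 0" using minor Z[of 1] by (auto simp: X_def Y_def)
  then obtain \<alpha> \<beta> where ab: "\<alpha> \<in> vec.span (f ` {..<5})" "\<beta> \<in> vec.span (f ` {..<5})"
    "z = c \<alpha> (c' \<beta> t)" "\<forall>a d. a *s \<alpha> + d *s \<beta> = 0 \<longrightarrow> a = 0 \<and> d = 0"
    using decomposable[OF _ _ _ _ _ _ ZZ] Z Zv by auto
  define v where "v = (!) [\<alpha>, \<beta>]"
  have "lin_indep 2 v" by (rule lin_indep_2I) (use ab(4) in \<open>simp add: v_def\<close>)
  moreover have "v i \<in> vec.span (f ` {..<5})" if "i < 2" for i
  proof -
    have "i = 0 \<or> i = 1" using that by linarith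
    thus ?thesis using ab by (auto simp: v_def)
  qed
  ultimately obtain e' f' where 1: "vacuum_frame q c c' e' f' t" "\<forall>i<2. f' i = v i"
    using change_basis by blast
  have "c (f' 0) (c' (f' 1) t) = z" using 1(2) ab by (simp add: v_def)
  hence "\<exists>e' f'. vacuum_frame q c c' e' f' z" using vacuum_frame.swap_two[OF 1(1), of 0 1] by auto
  thus ?thesis using orth by blast
qed

text \<open>If the vector attached to \<open>a x + d y\<close> vanishes, the coefficients \<open>a\<^sup>2\<close>, \<open>2 a d\<close>, \<open>d\<^sup>2\<close> are a linear relation
  between the three columns of the minor.\<close>

lemma minor_detects:
  assumes minor: "minor (coord x) (coord y) \<noteq> 0"
    and zero: "\<And>i. i < 5 \<Longrightarrow> create_form (coord (a *s x + d *s y)) (coord (a *s x + d *s y)) i = 0"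
  shows "a = 0 \<and> d = 0"
proof -
  define u v w where "u = create_form (coord x) (coord x)" and "v = create_form (coord x) (coord y)"
    and "w = create_form (coord y) (coord y)"
  have "a * a * u i + 2 * a * d * v i + d * d * w i = 0" if "i < 5" for i
  proof -
    have "0 = (a *s x + d *s y) \<star> c' (f i) (a *s x + d *s y)"
      using zero[OF that] by (simp only: pair_create[OF that])
    also have "\<dots> = a * a * (x \<star> c' (f i) x) + 2 * a * d * (x \<star> c' (f i) y) + d * d * (y \<star> c' (f i) y)"
      using pair_commute[of y "f i" x] by (simp add: algebra_simps)
    finally show ?thesis by (simp add: u_def v_def w_def pair_create[OF that])
  qed
  from this[of 2] this[of 3] this[of 4]
  have eqs: "a * a * u 2 + 2 * a * d * v 2 + d * d * w 2 = 0" "a * a * u 3 + 2 * a * d * v 3 + d * d * w 3 = 0"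
    "a * a * u 4 + 2 * a * d * v 4 + d * d * w 4 = 0" by simp_all
  have m: "minor (coord x) (coord y) = u 2 * (v 3 * w 4 - v 4 * w 3) - v 2 * (u 3 * w 4 - u 4 * w 3)
    + w 2 * (u 3 * v 4 - u 4 * v 3)" by (simp add: minor_def Let_def u_def v_def w_def)
  have "a * a * minor (coord x) (coord y) = 0" unfolding m using eqs by algebra
  moreover have "d * d * minor (coord x) (coord y) = 0" unfolding m using eqs by algebra
  ultimately show ?thesis using minor by simp
qed

text \<open>After a unipotent change of frame and a change of the basis of the plane, \<open>orthogonal_pure_spinor\<close> applies.
  The same minor shows that the plane contains no pure spinor.\<close>

lemma generic_special:
  assumes x0: "coord x 0 \<noteq> 0" and quartic: "quartic (coord x) (coord y) = 0"
    and minor: "minor (coord x) (coord y) \<noteq> 0"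
  shows "vec.span {x, y} \<in> special_locus_open q c c'"
proof -
  define a where "a = inverse (coord x 0)"
  have a: "a \<noteq> 0" using x0 by (simp add: a_def)
  define x1 where "x1 = a *s x"
  have "coord x1 0 = 1" using x0 by (simp add: x1_def a_def)
  then obtain e' t' where n: "frame q c c' e' f t'" "frame.coord c c' f t' x1 0 = 1"
    "\<And>k. k \<in> {1..10} \<Longrightarrow> frame.coord c c' f t' x1 k = 0" using unipotent_frame by blast
  interpret n: frame q c c' e' f t' by (rule n(1))
  define d where "d = n.coord y 0"
  define y1 where "y1 = y - d *s x1"
  have "wedge x1 y1 = a *s wedge x y" unfolding x1_def y1_def by (rule wedge_combination)
  moreover have "quadric e' f (a *s w) = a ^ 2 * quadric e' f w" for w
    using quadric_hom_poly[of e' f] unfolding hom_poly_def by blast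
  ultimately have "quadric e' f (wedge x1 y1) = a ^ 2 * quadric e' f (wedge x y)" by simp
  also have "quadric e' f = quadric e f"
    by (rule quadric_independent[OF n.hyp hyp])
  also have "quadric e f (wedge x y) = 0" by (simp add: quadric_wedge quartic)
  finally have "quartic (n.coord x1) (n.coord y1) = 0"
    using n.quadric_wedge[of x1 y1] \<open>quadric e' f = quadric e f\<close> by simp
  moreover have "minor (n.coord x1) (n.coord y1) = a ^ 3 * minor (coord x) (coord y)"
  proof -
    define u v w where "u = create_form (coord x) (coord x)" and "v = create_form (coord x) (coord y)"
      and "w = create_form (coord y) (coord y)"
    have 1: "create_form (n.coord x1) (n.coord x1) i = a * a * u i"
      "create_form (n.coord x1) (n.coord y1) i = a * v i - d * (a * a * u i)"
      "create_form (n.coord y1) (n.coord y1) i = w i - 2 * d * a * v i + d * d * a * a * u i" if "i < 5" for i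
      unfolding u_def v_def w_def pair_create[OF that, symmetric] n.pair_create[OF that, symmetric]
      using pair_commute[of y "f i" x] by (simp_all add: x1_def y1_def algebra_simps)
    show ?thesis
      by (simp add: minor_def Let_def 1 flip: u_def v_def w_def) (simp add: power3_eq_cube algebra_simps)
  qed
  hence "minor (n.coord x1) (n.coord y1) \<noteq> 0" using a minor by simp
  moreover have "n.coord y1 0 = 0" using n(2) by (simp add: y1_def d_def)
  ultimately obtain e2 f2 z where z: "vacuum_frame q c c' e2 f2 z" "\<And>v. x1 \<star> c' v z = 0" "\<And>v. y1 \<star> c' v z = 0"
    using n.orthogonal_pure_spinor[OF n(2,3)] by blast
  have xz: "x \<star> c' v z = 0" for v using z(2)[of v] a by (simp add: x1_def)
  have yz: "y \<star> c' v z = 0" for v using z(3)[of v] z(2)[of v] by (simp add: y1_def)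
  show ?thesis
  proof (rule special_if_orthogonal[OF _ _ z(1)])
    show "vec.span {x, y} \<in> grass 2 UNIV"
    proof (rule span_pair_grass)
      fix r s assume 0: "r *s x + s *s y = 0"
      have "create_form (coord 0) (coord 0) i = 0" if "i < 5" for i by (simp flip: pair_create[OF that])
      thus "r = 0 \<and> s = 0" using minor_detects[OF minor, of r s] 0 by simp
    qed
    show "k \<star> c' v z = 0" if "k \<in> vec.span {x, y}" for k v
      using that xz yz by (auto simp: span_pair)
    fix k assume k: "k \<in> vec.span {x, y}" "k \<noteq> 0"
    show "\<exists>v. k \<star> c' v k \<noteq> 0"
    proof (rule ccontr)
      assume "\<not> ?thesis"
      hence "create_form (coord k) (coord k) i = 0" if "i < 5" for i by (simp flip: pair_create[OF that])
      moreover obtain r s where "k = r *s x + s *s y" using k(1) by (auto simp: span_pair)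
      ultimately show False using minor_detects[OF minor, of r s] k(2) by auto
    qed
  qed
qed

end

section \<open>Affine charts of the Grassmannian\<close>

lemma poly_fun_create_form:
  assumes "\<And>k. (\<lambda>z. X z k) \<in> poly_fun" "\<And>k. (\<lambda>z. Y z k) \<in> poly_fun" "i < 5"
  shows "(\<lambda>z. create_form (X z) (Y z) i) \<in> poly_fun"
  by (rule less_5_cases[OF assms(3)]; simp add: create_form_def; intro poly_fun_intros assms(1,2))

lemma poly_fun_annihilate_form:
  assumes "\<And>k. (\<lambda>z. X z k) \<in> poly_fun" "\<And>k. (\<lambda>z. Y z k) \<in> poly_fun" "i < 5"
  shows "(\<lambda>z. annihilate_form (X z) (Y z) i) \<in> poly_fun"
  by (rule less_5_cases[OF assms(3)]; simp add: annihilate_form_def; intro poly_fun_intros assms(1,2))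

lemma poly_fun_quartic:
  assumes "\<And>k. (\<lambda>z. X z k) \<in> poly_fun" "\<And>k. (\<lambda>z. Y z k) \<in> poly_fun"
  shows "(\<lambda>z. quartic (X z) (Y z)) \<in> poly_fun"
  unfolding quartic_def
  by (intro poly_fun_sum poly_fun.add poly_fun.mult poly_fun_create_form poly_fun_annihilate_form assms) auto

lemma poly_fun_minor:
  assumes "\<And>k. (\<lambda>z. X z k) \<in> poly_fun" "\<And>k. (\<lambda>z. Y z k) \<in> poly_fun"
  shows "(\<lambda>z. minor (X z) (Y z)) \<in> poly_fun"
  unfolding minor_def Let_def
  by (intro poly_fun_intros poly_fun_create_form assms; simp)

text \<open>Any enumeration of the coordinates of a spinor will do.\<close>

definition idx :: "nat \<Rightarrow> 16" where
  "idx = (SOME h. bij_betw h {..<16} UNIV)"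

lemma idx_bij: "bij_betw idx {..<16} UNIV"
proof -
  have "\<exists>h. bij_betw h {..<16::nat} (UNIV :: 16 set)"
    by (rule finite_same_card_bij) simp_all
  thus ?thesis unfolding idx_def by (rule someI_ex)
qed

lemma idx_eq_iff [simp]: "j < 16 \<Longrightarrow> k < 16 \<Longrightarrow> idx j = idx k \<longleftrightarrow> j = k"
  using idx_bij by (auto simp: bij_betw_def inj_on_def)

text \<open>The chart consists of the planes for which the coordinates \<open>11\<close> and \<open>12\<close>, the pairings with \<open>f\<^sub>0 t\<close> and \<open>f\<^sub>1 t\<close>,
  give a nonzero Pluecker coordinate. Such a plane has a unique basis with coordinates \<open>(1, 0)\<close> and \<open>(0, 1)\<close>
  there, and the other coordinates of the basis are the variables. The variables with an index \<open>11\<close> or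
  \<open>12\<close> are dummies.\<close>

definition first_row :: "'k::field ^ (bool \<times> 16) \<Rightarrow> nat \<Rightarrow> 'k" where
  "first_row z k = (if k = 11 then 1 else if k = 12 then 0 else if k < 16 then z $ (False, idx k) else 0)"

definition second_row :: "'k::field ^ (bool \<times> 16) \<Rightarrow> nat \<Rightarrow> 'k" where
  "second_row z k = (if k = 11 then 0 else if k = 12 then 1 else if k < 16 then z $ (True, idx k) else 0)"

definition chart_vec :: "(nat \<Rightarrow> 'k::field) \<Rightarrow> (nat \<Rightarrow> 'k) \<Rightarrow> 'k ^ (bool \<times> 16)" where
  "chart_vec X Y = (\<chi> p. (if fst p then Y else X) (inv_into {..<16} idx (snd p)))"

lemma rows_chart_vec:
  assumes "k < 16"
  shows "first_row (chart_vec X Y) k = (if k = 11 then 1 else if k = 12 then 0 else X k)"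
    "second_row (chart_vec X Y) k = (if k = 11 then 0 else if k = 12 then 1 else Y k)"
  using assms bij_betw_inv_into_left[OF idx_bij, of k]
  by (simp_all add: first_row_def second_row_def chart_vec_def)

lemma poly_fun_rows: "(\<lambda>z. first_row z k) \<in> poly_fun" "(\<lambda>z. second_row z k) \<in> poly_fun"
proof -
  show "(\<lambda>z. first_row z k) \<in> poly_fun"
    by (cases "k = 11"; cases "k = 12"; cases "k < 16"; simp add: first_row_def poly_fun.const poly_fun.coord)
  show "(\<lambda>z. second_row z k) \<in> poly_fun"
    by (cases "k = 11"; cases "k = 12"; cases "k < 16"; simp add: second_row_def poly_fun.const poly_fun.coord)
qed

lemma rows_vec_upd:
  "first_row (vec_upd z (False, idx 0) a) = (first_row z)(0 := a)"
  "second_row (vec_upd z (False, idx 0) a) = second_row z"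
  "first_row (vec_upd z (True, idx 1) a) = first_row z"
  "second_row (vec_upd z (True, idx 1) a) = (second_row z)(1 := a)"
  by (auto simp: first_row_def second_row_def fun_eq_iff)

lemma rows_11_12 [simp]: "first_row z 11 = 1" "first_row z 12 = 0" "second_row z 11 = 0" "second_row z 12 = 1"
  by (simp_all add: first_row_def second_row_def)

definition chart_tail :: "'k::field ^ (bool \<times> 16) \<Rightarrow> 'k" where
  "chart_tail z = (let X = first_row z; Y = second_row z in
     Y 2 * Y 13 + Y 3 * Y 14 + Y 4 * Y 15 - Y 5 * X 13 - Y 6 * X 14 - Y 7 * X 15
     + Y 8 * (X 13 * Y 14 - X 14 * Y 13) + Y 9 * (X 13 * Y 15 - X 15 * Y 13) + Y 10 * (X 14 * Y 15 - X 15 * Y 14))"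

text \<open>The coefficient of the first variable \<open>a\<close> in a quarter of the quartic form is \<open>\<omega>'(p, p')\<close>, where \<open>p\<close> and \<open>p'\<close>
  start with \<open>(1, 0)\<close> and \<open>(0, 1)\<close>. So it contains the coordinate \<open>\<omega>'\<^sub>0\<^sub>1\<close> with coefficient one.\<close>

definition chart_lead where "chart_lead z = z $ (True, idx 1) + chart_tail z"

definition chart_rest :: "'k::field ^ (bool \<times> 16) \<Rightarrow> 'k" where
  "chart_rest z = quartic ((first_row z)(0 := 0)) (second_row z) / 4"

definition chart_quartic :: "'k::field ^ (bool \<times> 16) \<Rightarrow> 'k" where
  "chart_quartic z = quartic (first_row z) (second_row z) / 4"

definition chart_generic :: "'k::field ^ (bool \<times> 16) \<Rightarrow> 'k" where
  "chart_generic z = first_row z 0 * minor (first_row z) (second_row z)"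

lemma quartic_split:
  "quartic X Y = 2 * X 0 * (\<Sum>i<5. X (11 + i) * annihilate_form Y Y i) + quartic (X(0 := 0)) Y"
proof -
  have "create_form X X i = 2 * X 0 * X (11 + i) + create_form (X(0 := 0)) (X(0 := 0)) i" if "i < 5" for i
    by (rule less_5_cases[OF that]; simp add: create_form_def algebra_simps)
  moreover have "annihilate_form X X i = annihilate_form (X(0 := 0)) (X(0 := 0)) i" if "i < 5" for i
    by (rule less_5_cases[OF that]; simp add: annihilate_form_def)
  ultimately show ?thesis
    unfolding quartic_def sum_distrib_left sum.distrib[symmetric]
    by (intro sum.cong) (simp_all add: algebra_simps)
qed

lemma chart_quartic_split:
  fixes z :: "'k::field_char_0 ^ (bool \<times> 16)"
  shows "chart_quartic z = z $ (False, idx 0) * chart_lead z + chart_rest z"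
proof -
  have "(\<Sum>i<5. first_row z (11 + i) * annihilate_form (second_row z) (second_row z) i) = 2 * chart_lead z"
    by (simp add: lessThan_nat_numeral annihilate_form_def chart_lead_def chart_tail_def Let_def algebra_simps)
      (simp add: second_row_def)
  moreover have "first_row z 0 = z $ (False, idx 0)" by (simp add: first_row_def)
  ultimately show ?thesis
    unfolding chart_quartic_def chart_rest_def
    by (subst quartic_split) (simp add: add_divide_distrib)
qed

interpretation chart: linear_in_variable "(False, idx 0)" "(True, idx 1)" chart_lead chart_tail chart_rest
  "chart_quartic :: 'k::field_char_0 ^ (bool \<times> 16) \<Rightarrow> 'k"
proof
  show "chart_tail \<in> poly_fun"
    unfolding chart_tail_def Let_def by (intro poly_fun_intros poly_fun_rows)
  have "(\<lambda>z. ((first_row z)(0 := 0)) k) \<in> poly_fun" for k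
    by (cases "k = 0") (simp_all add: poly_fun_rows poly_fun.const)
  hence "(\<lambda>z. quartic ((first_row z)(0 := 0)) (second_row z) * (1 / 4)) \<in> poly_fun"
    by (intro poly_fun.mult poly_fun_quartic poly_fun_rows poly_fun.const)
  thus "chart_rest \<in> poly_fun" unfolding chart_rest_def by simp
  show "(False, idx 0) \<noteq> (True, idx 1)" by simp
  fix z :: "'k ^ (bool \<times> 16)" and a :: 'k
  show "chart_tail (vec_upd z (False, idx 0) a) = chart_tail z"
    "chart_tail (vec_upd z (True, idx 1) a) = chart_tail z"
    "chart_rest (vec_upd z (False, idx 0) a) = chart_rest z"
    by (simp_all add: chart_tail_def chart_rest_def rows_vec_upd Let_def)
  show "chart_lead z = z $ (True, idx 1) + chart_tail z" by (simp add: chart_lead_def)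
  show "chart_quartic z = z $ (False, idx 0) * chart_lead z + chart_rest z" by (rule chart_quartic_split)
next
  define X Y :: "nat \<Rightarrow> 'k" where "X = (\<lambda>k. 0)(1 := 1)" and "Y = (\<lambda>k. 0)(0 := 1)"
  define z where "z = chart_vec X Y"
  have r: "first_row z k = (if k = 11 then 1 else X k)" "second_row z k = (if k = 12 then 1 else Y k)" if "k < 16" for k
    unfolding z_def using rows_chart_vec[OF that, of X Y] by (auto simp: X_def Y_def)
  have "z $ (True, idx 1) = 0" using r(2)[of 1] by (simp add: second_row_def Y_def)
  hence "chart_lead z = 0" by (simp add: chart_lead_def chart_tail_def Let_def r X_def Y_def)
  moreover have "chart_rest z = - 1"
    by (simp add: chart_rest_def quartic_def lessThan_nat_numeral create_form_def annihilate_form_def r X_def Y_def)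
  ultimately show "\<exists>z :: 'k ^ (bool \<times> 16). chart_lead z = 0 \<and> chart_rest z \<noteq> 0" by (intro exI[of _ z]) simp
qed

lemma chart_generic_poly: "chart_generic \<in> poly_fun"
  unfolding chart_generic_def by (intro poly_fun.mult poly_fun_minor poly_fun_rows)

text \<open>A point with \<open>a = 1\<close>, \<open>\<omega> = - f\<^sub>0 f\<^sub>4\<close>, \<open>p = (1, 0, 0, - 1, 0)\<close> and \<open>a' = 0\<close>, \<open>\<omega>' = - f\<^sub>0 f\<^sub>2 + f\<^sub>1 f\<^sub>3\<close>,
  \<open>p' = (0, 1, 0, 0, 0)\<close>.\<close>

lemma chart_generic_nonzero:
  "\<exists>z :: 'k::field_char_0 ^ (bool \<times> 16). chart_quartic z = 0 \<and> chart_lead z \<noteq> 0 \<and> chart_generic z \<noteq> 0"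
proof -
  define X Y :: "nat \<Rightarrow> 'k" where "X = (\<lambda>k. 0)(0 := 1, 4 := - 1, 14 := - 1)"
    and "Y = (\<lambda>k. 0)(2 := - 1, 6 := 1)"
  define z where "z = chart_vec X Y"
  have r: "first_row z k = (if k = 11 then 1 else X k)" "second_row z k = (if k = 12 then 1 else Y k)" if "k < 16" for k
    unfolding z_def using rows_chart_vec[OF that, of X Y] by (auto simp: X_def Y_def)
  have "z $ (True, idx 1) = 0" using r(2)[of 1] by (simp add: second_row_def Y_def)
  hence "chart_lead z = 1" by (simp add: chart_lead_def chart_tail_def Let_def r X_def Y_def)
  moreover have "chart_quartic z = 0"
    by (simp add: chart_quartic_def quartic_def lessThan_nat_numeral create_form_def annihilate_form_def r X_def Y_def)
  moreover have "chart_generic z \<noteq> 0"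
    by (simp add: chart_generic_def minor_def Let_def create_form_def r X_def Y_def)
  ultimately show ?thesis by (intro exI[of _ z]) simp
qed

context frame begin

definition chart_x where "chart_x z = (\<Sum>k<16. first_row z k *s \<tau> k)"
definition chart_y where "chart_y z = (\<Sum>k<16. second_row z k *s \<tau> k)"
definition chart_point where "chart_point z = wedge (chart_x z) (chart_y z)"
definition chart_form where "chart_form w = two_form w (A 0) (A 1)"

text \<open>The variables are themselves Pluecker coordinates.\<close>

definition chart_coord :: "'a ^ (16 \<times> 16) \<Rightarrow> 'a ^ (bool \<times> 16)" where
  "chart_coord w = chart_vec (\<lambda>k. two_form w (\<sigma> k) (A 1)) (\<lambda>k. two_form w (A 0) (\<sigma> k))"

lemma coord_chart: "k < 16 \<Longrightarrow> coord (chart_x z) k = first_row z k" "k < 16 \<Longrightarrow> coord (chart_y z) k = second_row z k"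
  by (simp_all add: chart_x_def chart_y_def coord_combination)

lemma pair_A: "x \<star> A 0 = coord x 11" "x \<star> A 1 = coord x 12"
  by (simp_all add: coord_def \<sigma>_def)

lemma chart_form_wedge: "chart_form (wedge x y) = coord x 11 * coord y 12 - coord x 12 * coord y 11"
  by (simp add: chart_form_def two_form_wedge pair_A)

lemma chart_form_linear: "Vector_Spaces.linear (*s) (*) chart_form"
  unfolding chart_form_def by (rule two_form_linear)

lemma chart_form_point: "chart_form (chart_point z) = 1"
  by (simp add: chart_point_def chart_form_wedge coord_chart)

lemma chart_quadric: "quadric e f (chart_point z) = 12 * chart_quartic z"
  unfolding chart_point_def quadric_wedge chart_quartic_def
  using quartic_cong[of "coord (chart_x z)" "first_row z" "coord (chart_y z)" "second_row z"]
  by (simp add: coord_chart)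

lemma chart_special:
  assumes "chart_quartic z = 0" "chart_generic z \<noteq> 0"
  shows "vec.span {chart_x z, chart_y z} \<in> special_locus_open q c c'"
proof (rule generic_special)
  show "coord (chart_x z) 0 \<noteq> 0" using assms(2) by (auto simp: chart_generic_def coord_chart)
  show "quartic (coord (chart_x z)) (coord (chart_y z)) = 0"
    using quartic_cong[of "coord (chart_x z)" "first_row z" "coord (chart_y z)" "second_row z"] assms(1)
    by (simp add: coord_chart chart_quartic_def)
  show "minor (coord (chart_x z)) (coord (chart_y z)) \<noteq> 0"
    using minor_cong[of "coord (chart_x z)" "first_row z" "coord (chart_y z)" "second_row z"] assms(2)
    by (auto simp: coord_chart chart_generic_def)
qed

lemma chart_poly:
  assumes "P \<in> poly_fun"
  shows "(\<lambda>z. P (chart_point z)) \<in> poly_fun"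
proof (rule poly_fun_compose[OF assms])
  fix p
  have "(\<lambda>z. chart_x z $ i) \<in> poly_fun" "(\<lambda>z. chart_y z $ i) \<in> poly_fun" for i
    unfolding chart_x_def chart_y_def sum_component vector_smult_component
    by (intro poly_fun_intros poly_fun_rows)+
  thus "(\<lambda>z. chart_point z $ p) \<in> poly_fun"
    unfolding chart_point_def wedge_def by (simp, intro poly_fun_intros)
qed

lemma chart_coord_poly:
  assumes "P \<in> poly_fun"
  shows "(\<lambda>w. P (chart_coord w)) \<in> poly_fun"
proof (rule poly_fun_compose[OF assms])
  fix p :: "bool \<times> 16"
  show "(\<lambda>w. chart_coord w $ p) \<in> poly_fun"
    by (cases "fst p") (simp_all add: chart_coord_def chart_vec_def poly_fun_linear[OF two_form_linear])
qed

lemma chart_point_coord: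
  assumes "chart_form (wedge x y) = 1"
  shows "chart_point (chart_coord (wedge x y)) = wedge x y"
proof -
  let ?w = "wedge x y" and ?z = "chart_coord (wedge x y)"
  have one: "coord x 11 * coord y 12 - coord x 12 * coord y 11 = 1" using assms by (simp add: chart_form_wedge)
  have "chart_x ?z = coord y 12 *s x - coord x 12 *s y"
  proof (rule coord_eqI)
    fix k :: nat assume k: "k < 16"
    have "two_form ?w (\<sigma> k) (A 1) = coord (coord y 12 *s x - coord x 12 *s y) k"
      by (simp add: two_form_wedge pair_A flip: coord_def)
    thus "coord (chart_x ?z) k = coord (coord y 12 *s x - coord x 12 *s y) k"
      using one k by (auto simp: coord_chart chart_coord_def rows_chart_vec algebra_simps)
  qed
  moreover have "chart_y ?z = coord x 11 *s y - coord y 11 *s x"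
  proof (rule coord_eqI)
    fix k :: nat assume k: "k < 16"
    have "two_form ?w (A 0) (\<sigma> k) = coord (coord x 11 *s y - coord y 11 *s x) k"
      by (simp add: two_form_wedge pair_A flip: coord_def)
    thus "coord (chart_y ?z) k = coord (coord x 11 *s y - coord y 11 *s x) k"
      using one k by (auto simp: coord_chart chart_coord_def rows_chart_vec algebra_simps)
  qed
  moreover have "wedge (a *s x - b' *s y) (a' *s y - d *s x) = (a * a' - b' * d) *s wedge x y" for a b' a' d
    by (simp add: wedge_def vec_eq_iff algebra_simps)
  ultimately have "chart_point ?z = (coord y 12 * coord x 11 - coord x 12 * coord y 11) *s wedge x y"
    by (simp add: chart_point_def)
  thus ?thesis using one by (simp add: mult.commute)
qed

lemma chart_independent:
  assumes "chart_form (wedge x y) \<noteq> 0" "a *s x + d *s y = 0"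
  shows "a = 0 \<and> d = 0"
proof -
  have "coord (a *s x + d *s y) 11 = 0" "coord (a *s x + d *s y) 12 = 0" unfolding assms(2) by simp_all
  hence "a * coord x 11 + d * coord y 11 = 0" "a * coord x 12 + d * coord y 12 = 0" by simp_all
  hence "a * chart_form (wedge x y) = 0" "d * chart_form (wedge x y) = 0" unfolding chart_form_wedge by algebra+
  thus ?thesis using assms(1) by simp
qed

end

section \<open>The Zariski topology on the Grassmannian\<close>

lemma wedge_self_combination:
  "wedge (a *s x + b *s y) (a' *s x + b' *s y) = (a * b' - b * a') *s wedge x y"
  by (simp add: wedge_def vec_eq_iff algebra_simps)

lemma pluecker_span: "pluecker (vec.span {x, y}) = vec.span {wedge x y}"
proof
  have "wedge g h \<in> vec.span {wedge x y}" if gh: "g \<in> vec.span {x, y}" "h \<in> vec.span {x, y}" for g h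
  proof -
    obtain a b a' b' where "g = a *s x + b *s y" "h = a' *s x + b' *s y" using gh unfolding span_pair by blast
    hence "wedge g h = (a * b' - b * a') *s wedge x y" by (simp only: wedge_self_combination)
    thus ?thesis unfolding vec.span_singleton by blast
  qed
  thus "pluecker (vec.span {x, y}) \<subseteq> vec.span {wedge x y}"
    unfolding pluecker_def by (intro vec.span_minimal) auto
  have "x \<in> vec.span {x, y}" "y \<in> vec.span {x, y}" by (simp_all add: vec.span_base)
  hence "wedge x y \<in> {wedge g h | g h. g \<in> vec.span {x, y} \<and> h \<in> vec.span {x, y}}" by blast
  thus "vec.span {wedge x y} \<subseteq> pluecker (vec.span {x, y})"
    unfolding pluecker_def by (intro vec.span_mono) simp
qed

lemma wedge_nonzero:
  fixes x y :: "'k::field ^ 'n"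
  assumes "\<And>a d. a *s x + d *s y = 0 \<Longrightarrow> a = 0 \<and> d = 0"
  shows "wedge x y \<noteq> 0"
proof
  assume "wedge x y = 0"
  hence "wedge x y $ (j, k) = 0" for j k by simp
  hence *: "x $ j * y $ k = x $ k * y $ j" for j k by (simp add: wedge_def)
  have "x $ j = 0" for j
  proof -
    have "(y $ j) *s x + (- x $ j) *s y = 0" using *[of j] by (simp add: vec_eq_iff mult.commute)
    thus ?thesis using assms[of "y $ j" "- x $ j"] by simp
  qed
  hence "1 *s x + 0 *s y = 0" by (simp add: vec_eq_iff)
  thus False using assms[of 1 0] by simp
qed

lemma grass_2_wedge:
  assumes "K \<in> grass 2 UNIV"
  shows "\<exists>x y. pluecker K = vec.span {wedge x y} \<and> wedge x y \<noteq> 0 \<and> K = vec.span {x, y}"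
proof -
  obtain x y where xy: "K = vec.span {x, y}" "\<And>a d. a *s x + d *s y = 0 \<Longrightarrow> a = 0 \<and> d = 0"
    using grass_2_pair[OF assms] by blast
  have "wedge x y \<noteq> 0" by (rule wedge_nonzero) (rule xy(2))
  thus ?thesis using xy(1) pluecker_span by blast
qed

lemma pluecker_proj: "K \<in> grass 2 UNIV \<Longrightarrow> pluecker K \<in> proj ext2"
proof -
  assume "K \<in> grass 2 UNIV"
  then obtain x y where "pluecker K = vec.span {wedge x y}" "wedge x y \<noteq> 0" using grass_2_wedge by blast
  moreover have "vec.span {wedge x y} \<subseteq> ext2"
    using wedge_in_ext2 unfolding ext2_def by (intro vec.span_minimal) auto
  ultimately show ?thesis unfolding proj_iff by blast
qed

lemma hom_poly_span:
  assumes "P \<in> hom_poly d"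
  shows "(\<exists>w\<in>vec.span {v}. P w \<noteq> 0) \<longleftrightarrow> P v \<noteq> 0"
proof -
  have "P (a *s v) = a ^ d * P v" for a using assms by (auto simp: hom_poly_def)
  moreover have "v \<in> vec.span {v}" by (rule vec.span_base) simp
  ultimately show ?thesis by (auto simp: vec.span_singleton)
qed

text \<open>For homogeneous \<open>P\<close> these are the basic open sets of the Grassmannian.\<close>

definition nonvanishing :: "('k::field ^ ('n::finite \<times> 'n) \<Rightarrow> 'k) \<Rightarrow> ('k ^ 'n) set set" where
  "nonvanishing P = {K \<in> grass 2 UNIV. \<exists>w\<in>pluecker K. P w \<noteq> 0}"

lemma nonvanishing_iff:
  "P \<in> hom_poly d \<Longrightarrow> K \<in> grass 2 UNIV \<Longrightarrow> pluecker K = vec.span {v} \<Longrightarrow> K \<in> nonvanishing P \<longleftrightarrow> P v \<noteq> 0"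
  by (simp add: nonvanishing_def hom_poly_span)

lemma openin_zariski_proj:
  fixes W :: "('a::field ^ 'b) set"
  assumes "openin (zariski_proj W) U" "l \<in> U"
  shows "\<exists>d. \<exists>P\<in>hom_poly d. l \<in> {l \<in> proj W. \<exists>w\<in>l. P w \<noteq> 0} \<and> {l \<in> proj W. \<exists>w\<in>l. P w \<noteq> 0} \<subseteq> U"
proof -
  define nz where "nz P = {l \<in> proj W. \<exists>w\<in>l. P w \<noteq> 0}" for P :: "'a ^ 'b \<Rightarrow> 'a"
  have "generate_topology_on {nz P | P d. P \<in> hom_poly d} U"
    using assms(1) unfolding zariski_proj_def openin_topology_generated_by_iff nz_def .
  hence "\<exists>d. \<exists>P\<in>hom_poly d. l \<in> nz P \<and> nz P \<subseteq> U" using assms(2)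
  proof induction
    case (Int A B)
    then obtain d P where P: "P \<in> hom_poly d" "l \<in> nz P" "nz P \<subseteq> A" by blast
    obtain d' P' where P': "P' \<in> hom_poly d'" "l \<in> nz P'" "nz P' \<subseteq> B" using Int by blast
    obtain s where s: "l = vec.span {s}" using P(2) by (auto simp: nz_def proj_iff)
    have "P s \<noteq> 0" "P' s \<noteq> 0"
      using P(2) P'(2) hom_poly_span[OF P(1), of s] hom_poly_span[OF P'(1), of s] by (simp_all add: nz_def s)
    moreover have "s \<in> l" unfolding s by (rule vec.span_base) simp
    moreover have "l \<in> proj W" using P(2) by (simp add: nz_def)
    ultimately have "l \<in> nz (\<lambda>w. P w * P' w)" unfolding nz_def by (intro CollectI conjI bexI[of _ s]) simp_all
    moreover have "nz (\<lambda>w. P w * P' w) \<subseteq> nz P \<inter> nz P'" unfolding nz_def by auto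
    hence "nz (\<lambda>w. P w * P' w) \<subseteq> A \<inter> B" using P(3) P'(3) by blast
    ultimately show ?case using hom_poly_mult[OF P(1) P'(1)] by blast
  next
    case (UN \<K>)
    then obtain k where k: "k \<in> \<K>" "l \<in> k" by blast
    then obtain d P where "P \<in> hom_poly d" "l \<in> nz P" "nz P \<subseteq> k" using UN.IH by blast
    thus ?case using k(1) by blast
  next
    case (Basis s)
    thus ?case by blast
  qed simp
  thus ?thesis unfolding nz_def .
qed

lemma openin_nonvanishing:
  assumes "P \<in> hom_poly d"
  shows "openin zariski_gr2 (nonvanishing P)"
proof -
  have "openin (zariski_proj ext2) {l \<in> proj ext2. \<exists>w\<in>l. P w \<noteq> 0}"
    unfolding zariski_proj_def by (rule topology_generated_by_Basis) (use assms in blast)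
  moreover have "nonvanishing P = pluecker -` {l \<in> proj ext2. \<exists>w\<in>l. P w \<noteq> 0} \<inter> grass 2 UNIV"
    using pluecker_proj by (auto simp: nonvanishing_def)
  ultimately show ?thesis unfolding zariski_gr2_def openin_pullback_topology by blast
qed

lemma openin_gr:
  assumes "openin zariski_gr2 U" "K \<in> U"
  shows "\<exists>d. \<exists>P\<in>hom_poly d. K \<in> nonvanishing P \<and> nonvanishing P \<subseteq> U"
proof -
  obtain V where V: "openin (zariski_proj ext2) V" "U = pluecker -` V \<inter> grass 2 UNIV"
    using assms(1) unfolding zariski_gr2_def openin_pullback_topology by blast
  hence "pluecker K \<in> V" "K \<in> grass 2 UNIV" using assms(2) by auto
  then obtain d P where P: "P \<in> hom_poly d" "pluecker K \<in> {l \<in> proj ext2. \<exists>w\<in>l. P w \<noteq> 0}"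
    "{l \<in> proj ext2. \<exists>w\<in>l. P w \<noteq> 0} \<subseteq> V" using openin_zariski_proj[OF V(1)] by blast
  have "nonvanishing P \<subseteq> U"
  proof
    fix K' assume K': "K' \<in> nonvanishing P"
    hence "pluecker K' \<in> {l \<in> proj ext2. \<exists>w\<in>l. P w \<noteq> 0}" using pluecker_proj by (auto simp: nonvanishing_def)
    thus "K' \<in> U" using K' P(3) by (auto simp: V(2) nonvanishing_def)
  qed
  moreover have "K \<in> nonvanishing P" using P(2) \<open>K \<in> grass 2 UNIV\<close> by (simp add: nonvanishing_def)
  ultimately show ?thesis using P(1) by blast
qed

lemma topspace_gr: "topspace (zariski_gr2 :: ('k::field ^ 'n::finite) set topology) = grass 2 UNIV"
proof
  show "topspace zariski_gr2 \<subseteq> (grass 2 UNIV :: ('k ^ 'n) set set)"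
    unfolding zariski_gr2_def by (simp add: topspace_pullback_topology)
  define one :: "'k ^ ('n \<times> 'n) \<Rightarrow> 'k" where "one = (\<lambda>_. 1)"
  have "one \<in> hom_poly 0" by (simp add: one_def hom_poly_def poly_fun.const)
  hence "nonvanishing one \<subseteq> topspace zariski_gr2" using openin_nonvanishing openin_subset by blast
  moreover have "nonvanishing one = grass 2 UNIV"
    using grass_2_wedge by (fastforce simp: nonvanishing_def one_def intro: vec.span_base)
  ultimately show "(grass 2 UNIV :: ('k ^ 'n) set set) \<subseteq> topspace zariski_gr2" by simp
qed

lemma closedin_gr:
  "closedin zariski_gr2 C \<longleftrightarrow> C \<subseteq> grass 2 UNIV \<and>
     (\<forall>K\<in>grass 2 UNIV - C. \<exists>d. \<exists>P\<in>hom_poly d. K \<in> nonvanishing P \<and> C \<inter> nonvanishing P = {})"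
proof
  assume C: "closedin zariski_gr2 C"
  hence op: "openin zariski_gr2 (grass 2 UNIV - C)" and "C \<subseteq> grass 2 UNIV"
    by (auto simp: closedin_def topspace_gr)
  thus "C \<subseteq> grass 2 UNIV \<and> (\<forall>K\<in>grass 2 UNIV - C. \<exists>d. \<exists>P\<in>hom_poly d.
      K \<in> nonvanishing P \<and> C \<inter> nonvanishing P = {})" using openin_gr[OF op] by blast
next
  assume C: "C \<subseteq> grass 2 UNIV \<and> (\<forall>K\<in>grass 2 UNIV - C. \<exists>d. \<exists>P\<in>hom_poly d.
      K \<in> nonvanishing P \<and> C \<inter> nonvanishing P = {})"
  have "openin zariski_gr2 (grass 2 UNIV - C)"
  proof (subst openin_subopen, intro ballI)
    fix K assume "K \<in> grass 2 UNIV - C"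
    then obtain d P where "P \<in> hom_poly d" "K \<in> nonvanishing P" "C \<inter> nonvanishing P = {}" using C by blast
    moreover from this have "nonvanishing P \<subseteq> grass 2 UNIV - C" by (auto simp: nonvanishing_def)
    ultimately show "\<exists>T. openin zariski_gr2 T \<and> K \<in> T \<and> T \<subseteq> grass 2 UNIV - C"
      using openin_nonvanishing by blast
  qed
  thus "closedin zariski_gr2 C" using C by (simp add: closedin_def topspace_gr)
qed

lemma closedin_vanishing:
  assumes "P \<in> hom_poly d"
  shows "closedin zariski_gr2 (grass 2 UNIV - nonvanishing P)"
  using closedin_diff[OF closedin_topspace openin_nonvanishing[OF assms]] by (simp add: topspace_gr)

lemma closedin_same_pluecker:
  assumes "closedin zariski_gr2 C" "K \<in> C" "K' \<in> grass 2 UNIV" "pluecker K = pluecker K'"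
  shows "K' \<in> C"
proof (rule ccontr)
  assume "K' \<notin> C"
  hence "K' \<in> grass 2 UNIV - C" using assms(3) by blast
  then obtain d P where "P \<in> hom_poly d" "K' \<in> nonvanishing P" "C \<inter> nonvanishing P = {}"
    using assms(1) unfolding closedin_gr by blast
  moreover have "K \<in> grass 2 UNIV" using assms by (auto simp: closedin_gr)
  ultimately show False using assms(2,4) by (auto simp: nonvanishing_def)
qed

text \<open>Homogeneous polynomials on the Pluecker space with product zero on the Grassmannian: pull them
  back to the space of pairs of vectors. The linear form \<open>L\<close> takes care of the linearly dependent pairs.\<close>

lemma gr_domain:
  fixes P R L :: "'k::field_char_0 ^ ('n::finite \<times> 'n) \<Rightarrow> 'k"
  assumes P: "P \<in> hom_poly d" and R: "R \<in> hom_poly d'" and L: "L \<in> hom_poly 1"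
    and zero: "\<And>K. K \<in> nonvanishing P \<Longrightarrow> K \<in> nonvanishing R \<Longrightarrow> K \<notin> nonvanishing L"
    and ne: "nonvanishing P \<noteq> {}" "nonvanishing L \<noteq> {}"
  shows "nonvanishing R = {}"
proof (rule ccontr)
  assume "nonvanishing R \<noteq> {}"
  define x y :: "'k ^ (bool \<times> 'n) \<Rightarrow> 'k ^ 'n" where "x z = (\<chi> i. z $ (False, i))" and "y z = (\<chi> i. z $ (True, i))" for z
  have poly: "(\<lambda>z. F (wedge (x z) (y z))) \<in> poly_fun" if "F \<in> hom_poly d" for F d
  proof (rule poly_fun_compose)
    show "F \<in> poly_fun" using that by (simp add: hom_poly_def)
    show "(\<lambda>z. wedge (x z) (y z) $ p) \<in> poly_fun" for p
      unfolding wedge_def x_def y_def by (simp, intro poly_fun_intros)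
  qed
  have point: "\<exists>z. F (wedge (x z) (y z)) \<noteq> 0" if F: "F \<in> hom_poly d" "nonvanishing F \<noteq> {}" for F d
  proof -
    obtain K where K: "K \<in> nonvanishing F" using F(2) by blast
    hence "K \<in> grass 2 UNIV" by (simp add: nonvanishing_def)
    then obtain u v where uv: "pluecker K = vec.span {wedge u v}" using grass_2_wedge by blast
    hence nz: "F (wedge u v) \<noteq> 0" using K nonvanishing_iff[OF F(1) \<open>K \<in> grass 2 UNIV\<close>] by blast
    define z where "z = (\<chi> p. if fst p then v $ snd p else u $ snd p)"
    have "x z = u" "y z = v" by (simp_all add: x_def y_def z_def vec_eq_iff)
    thus ?thesis using nz by blast
  qed
  have "P (wedge (x z) (y z)) * R (wedge (x z) (y z)) * L (wedge (x z) (y z)) = 0" for z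
  proof (cases "\<forall>a d. a *s x z + d *s y z = 0 \<longrightarrow> a = 0 \<and> d = 0")
    case True
    hence "vec.span {x z, y z} \<in> grass 2 UNIV" by (intro span_pair_grass) blast
    thus ?thesis using zero[of "vec.span {x z, y z}"] nonvanishing_iff[OF P _ pluecker_span]
      nonvanishing_iff[OF R _ pluecker_span] nonvanishing_iff[OF L _ pluecker_span] by auto
  next
    case False
    then obtain a d where ad: "a *s x z + d *s y z = 0" "a \<noteq> 0 \<or> d \<noteq> 0" by blast
    have "a *s wedge (x z) (y z) = wedge (a *s x z + d *s y z) (y z)"
      "d *s wedge (x z) (y z) = wedge (x z) (a *s x z + d *s y z)"
      by (simp_all add: wedge_def vec_eq_iff algebra_simps)
    hence "a *s wedge (x z) (y z) = 0" "d *s wedge (x z) (y z) = 0" unfolding ad(1)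
      by (simp_all add: wedge_def vec_eq_iff)
    hence "wedge (x z) (y z) = 0" using ad(2) by auto
    moreover have "L (0 *s 0) = 0 ^ 1 * L 0" using L unfolding hom_poly_def by blast
    ultimately show ?thesis by simp
  qed
  moreover obtain z1 z2 z3 where z: "P (wedge (x z1) (y z1)) \<noteq> 0" "R (wedge (x z2) (y z2)) \<noteq> 0" "L (wedge (x z3) (y z3)) \<noteq> 0"
    using point[OF P ne(1)] point[OF R \<open>nonvanishing R \<noteq> {}\<close>] point[OF L ne(2)] by blast
  ultimately have "P (wedge (x z) (y z)) * R (wedge (x z) (y z)) = 0" for z
    using poly_fun_mult_eq_0[OF poly[OF L] poly_fun.mult[OF poly[OF P] poly[OF R]], of z3] by (simp add: mult.commute)
  hence "R (wedge (x z2) (y z2)) = 0" using poly_fun_mult_eq_0[OF poly[OF P] poly[OF R]] z(1) by blast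
  thus False using z(2) by simp
qed

text \<open>A longer chain would have to continue beyond the whole space.\<close>

lemma codim_eq_1:
  assumes Z: "irreducible_closed T Z" "irreducible_closed T (topspace T)" "Z \<subset> topspace T"
    and max: "\<And>C. irreducible_closed T C \<Longrightarrow> Z \<subset> C \<Longrightarrow> C = topspace T"
  shows "codim T Z = 1"
  unfolding codim_def
proof (rule antisym)
  let ?S = "{enat n | n. \<exists>C. C 0 = Z \<and> (\<forall>i\<le>n. irreducible_closed T (C i)) \<and> (\<forall>i<n. C i \<subset> C (Suc i))}"
  show "Sup ?S \<le> 1"
  proof (rule Sup_least)
    fix m assume "m \<in> ?S"
    then obtain n C where n: "m = enat n" "C 0 = Z" "\<And>i. i \<le> n \<Longrightarrow> irreducible_closed T (C i)"
      "\<And>i. i < n \<Longrightarrow> C i \<subset> C (Suc i)" by blast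
    have "n \<le> 1"
    proof (rule ccontr)
      assume "\<not> n \<le> 1"
      hence "C 1 = topspace T" using n(2) n(3)[of 1] n(4)[of 0] by (intro max) (simp_all add: One_nat_def)
      moreover have "C 1 \<subset> C 2" using n(4)[of 1] \<open>\<not> n \<le> 1\<close> by (simp add: numeral_2_eq_2 One_nat_def)
      moreover have "C 2 \<subseteq> topspace T"
        using n(3)[of 2] \<open>\<not> n \<le> 1\<close> closedin_subset by (auto simp: irreducible_closed_def)
      ultimately show False by blast
    qed
    thus "m \<le> 1" using n(1) by (simp add: one_enat_def)
  qed
  have "enat 1 \<in> ?S"
    using Z by (intro CollectI exI[of _ 1] conjI refl exI[of _ "\<lambda>i::nat. if i = 0 then Z else topspace T"])
      (auto simp: less_Suc_eq One_nat_def)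
  thus "1 \<le> Sup ?S" by (simp add: Sup_upper one_enat_def)
qed

section \<open>The divisor\<close>

lemma span_singleton_scale:
  fixes v :: "'k::field ^ 'n"
  assumes "a \<noteq> 0"
  shows "vec.span {a *s v} = vec.span {v}"
proof
  have "a *s v \<in> vec.span {v}" by (intro vec.span_scale vec.span_base) simp
  thus "vec.span {a *s v} \<subseteq> vec.span {v}" by (intro vec.span_minimal) auto
  have "inverse a *s (a *s v) \<in> vec.span {a *s v}" by (intro vec.span_scale vec.span_base) simp
  hence "v \<in> vec.span {a *s v}" using assms by simp
  thus "vec.span {v} \<subseteq> vec.span {a *s v}" by (intro vec.span_minimal) auto
qed

lemma irreducible_closed_union:
  "irreducible_closed T Z \<Longrightarrow> closedin T A \<Longrightarrow> closedin T B \<Longrightarrow> Z \<subseteq> A \<union> B \<Longrightarrow> Z \<subseteq> A \<or> Z \<subseteq> B"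
  by (auto simp: irreducible_closed_def)

context frame begin

definition chart_plane where "chart_plane z = vec.span {chart_x z, chart_y z}"

lemma chart_plane: "chart_plane z \<in> grass 2 UNIV" "pluecker (chart_plane z) = vec.span {chart_point z}"
proof -
  have "chart_form (wedge (chart_x z) (chart_y z)) \<noteq> 0" using chart_form_point[of z] by (simp add: chart_point_def)
  from chart_independent[OF this] show "chart_plane z \<in> grass 2 UNIV"
    unfolding chart_plane_def by (rule span_pair_grass)
  show "pluecker (chart_plane z) = vec.span {chart_point z}"
    by (simp add: chart_plane_def chart_point_def pluecker_span)
qed

lemma nonvanishing_chart_plane: "P \<in> hom_poly d \<Longrightarrow> chart_plane z \<in> nonvanishing P \<longleftrightarrow> P (chart_point z) \<noteq> 0"
  by (rule nonvanishing_iff[OF _ chart_plane])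

lemma chart_form_hom: "chart_form \<in> hom_poly 1"
  by (rule linear_hom_poly[OF chart_form_linear])

lemma chart_point_of_line:
  assumes "K \<in> grass 2 UNIV" "w \<in> pluecker K" "chart_form w = 1"
  shows "chart_point (chart_coord w) = w"
proof -
  obtain x y where "pluecker K = vec.span {wedge x y}" using grass_2_wedge[OF assms(1)] by blast
  then obtain a where w: "w = a *s wedge x y" using assms(2) by (auto simp: vec.span_singleton)
  have "w = wedge (a *s x) y" unfolding w by (simp add: wedge_def vec_eq_iff algebra_simps)
  thus ?thesis using chart_point_coord[of "a *s x" y] assms(3) by simp
qed

lemma chart_cover:
  assumes K: "K \<in> nonvanishing chart_form"
  shows "\<exists>z. pluecker K = vec.span {chart_point z}"
proof -
  have G: "K \<in> grass 2 UNIV" using K by (simp add: nonvanishing_def)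
  obtain x y where xy: "pluecker K = vec.span {wedge x y}" using grass_2_wedge[OF G] by blast
  have r: "chart_form (wedge x y) \<noteq> 0" using nonvanishing_iff[OF chart_form_hom G xy] K by simp
  define w where "w = inverse (chart_form (wedge x y)) *s wedge x y"
  have span: "pluecker K = vec.span {w}" unfolding xy w_def using r by (simp add: span_singleton_scale)
  have "chart_form w = 1" using r by (simp add: w_def chart_form_def)
  moreover have "w \<in> pluecker K" unfolding span by (rule vec.span_base) simp
  ultimately have "chart_point (chart_coord w) = w" using chart_point_of_line[OF G] by blast
  thus ?thesis using span by metis
qed

lemma quadric_multiple:
  assumes P: "P \<in> poly_fun"
    and vanish: "\<And>z. chart_quartic z = 0 \<Longrightarrow> chart_generic z \<noteq> 0 \<Longrightarrow> P (chart_point z) = 0"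
  shows "\<exists>B\<in>poly_fun. \<forall>z. P (chart_point z) = chart_quartic z * B z"
  by (rule chart.multiple_if_vanishes[OF chart_poly[OF P] chart_generic_poly chart_generic_nonzero vanish])

text \<open>In the end this set is the special locus.\<close>

definition locus where "locus = grass 2 UNIV - nonvanishing (quadric e f)"

lemma locus_closed: "closedin zariski_gr2 locus"
  unfolding locus_def by (rule closedin_vanishing[OF quadric_hom_poly])

lemma locus_iff:
  assumes "K \<in> grass 2 UNIV" "pluecker K = vec.span {chart_point z}"
  shows "K \<in> locus \<longleftrightarrow> chart_quartic z = 0"
  using assms(1) nonvanishing_iff[OF quadric_hom_poly assms, of e f] by (simp add: locus_def chart_quadric)

text \<open>The closure of the part of the divisor in the chart. Irreducibility of the equation makes it
  irreducible and of codimension one.\<close>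

definition chart_component where
  "chart_component = {K \<in> grass 2 UNIV. \<forall>d. \<forall>P\<in>hom_poly d.
     (\<forall>z. chart_quartic z = 0 \<longrightarrow> P (chart_point z) = 0) \<longrightarrow> K \<notin> nonvanishing P}"

lemma chart_component_closed: "closedin zariski_gr2 chart_component"
  unfolding closedin_gr
proof (intro conjI ballI)
  fix K assume "K \<in> grass 2 UNIV - chart_component"
  then obtain d P where "P \<in> hom_poly d" "\<forall>z. chart_quartic z = 0 \<longrightarrow> P (chart_point z) = 0" "K \<in> nonvanishing P"
    by (auto simp: chart_component_def)
  moreover from this have "chart_component \<inter> nonvanishing P = {}" by (auto simp: chart_component_def)
  ultimately show "\<exists>d. \<exists>P\<in>hom_poly d. K \<in> nonvanishing P \<and> chart_component \<inter> nonvanishing P = {}" by blast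
qed (auto simp: chart_component_def)

lemma chart_component_subset: "chart_component \<subseteq> locus"
proof
  fix K assume K: "K \<in> chart_component"
  have "\<forall>z. chart_quartic z = 0 \<longrightarrow> quadric e f (chart_point z) = 0" by (simp add: chart_quadric)
  hence "K \<notin> nonvanishing (quadric e f)" using K quadric_hom_poly[of e f] unfolding chart_component_def by blast
  thus "K \<in> locus" using K by (auto simp: locus_def chart_component_def)
qed

lemma chart_component_mem:
  assumes "K \<in> grass 2 UNIV" "pluecker K = vec.span {chart_point z}" "chart_quartic z = 0"
  shows "K \<in> chart_component"
  using assms nonvanishing_iff[OF _ assms(1,2)] by (auto simp: chart_component_def)

lemma chart_component_cover: "locus \<subseteq> chart_component \<union> (grass 2 UNIV - nonvanishing chart_form)"
proof
  fix K assume K: "K \<in> locus"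
  hence G: "K \<in> grass 2 UNIV" by (simp add: locus_def)
  show "K \<in> chart_component \<union> (grass 2 UNIV - nonvanishing chart_form)"
  proof (cases "K \<in> nonvanishing chart_form")
    case True
    then obtain z where "pluecker K = vec.span {chart_point z}" using chart_cover by blast
    thus ?thesis using chart_component_mem[OF G] locus_iff[OF G] K by blast
  qed (use G in blast)
qed

lemma exists_plane_in_component: "\<exists>K\<in>chart_component. K \<in> nonvanishing chart_form"
proof -
  obtain z :: "'a ^ (bool \<times> 16)" where "chart_quartic z = 0" using chart_generic_nonzero by blast
  hence "chart_plane z \<in> chart_component" using chart_component_mem chart_plane by blast
  moreover have "chart_plane z \<in> nonvanishing chart_form"
    using nonvanishing_chart_plane[OF chart_form_hom] chart_form_point by simp
  ultimately show ?thesis by blast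
qed

lemma chart_component_irreducible: "irreducible_closed zariski_gr2 chart_component"
  unfolding irreducible_closed_def
proof (intro conjI allI impI)
  show "closedin zariski_gr2 chart_component" by (rule chart_component_closed)
  show "chart_component \<noteq> {}" using exists_plane_in_component by blast
  have witness: "\<exists>d. \<exists>P\<in>hom_poly d. A \<inter> nonvanishing P = {} \<and> (\<exists>z. chart_quartic z = 0 \<and> P (chart_point z) \<noteq> 0)"
    if A: "closedin zariski_gr2 A" "\<not> chart_component \<subseteq> A" for A
  proof -
    obtain K where K: "K \<in> chart_component" "K \<notin> A" using A(2) by blast
    hence "K \<in> grass 2 UNIV - A" by (simp add: chart_component_def)
    then obtain d P where P: "P \<in> hom_poly d" "K \<in> nonvanishing P" "A \<inter> nonvanishing P = {}"
      using A(1) unfolding closedin_gr by blast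
    have "\<exists>z. chart_quartic z = 0 \<and> P (chart_point z) \<noteq> 0"
      using K(1) P(1,2) unfolding chart_component_def by blast
    thus ?thesis using P by blast
  qed
  fix A B assume A: "closedin zariski_gr2 A" and B: "closedin zariski_gr2 B" and sub: "chart_component \<subseteq> A \<union> B"
  show "chart_component \<subseteq> A \<or> chart_component \<subseteq> B"
  proof (rule ccontr)
    assume "\<not> ?thesis"
    hence nA: "\<not> chart_component \<subseteq> A" and nB: "\<not> chart_component \<subseteq> B" by blast+
    obtain d P z1 where P: "P \<in> hom_poly d" "A \<inter> nonvanishing P = {}" "chart_quartic z1 = 0" "P (chart_point z1) \<noteq> 0"
      using witness[OF A nA] by blast
    obtain d' R z2 where R: "R \<in> hom_poly d'" "B \<inter> nonvanishing R = {}" "chart_quartic z2 = 0" "R (chart_point z2) \<noteq> 0"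
      using witness[OF B nB] by blast
    have poly: "(\<lambda>z. P (chart_point z)) \<in> poly_fun" "(\<lambda>z. R (chart_point z)) \<in> poly_fun"
      using P(1) R(1) by (simp_all add: chart_poly hom_poly_def)
    have prod: "R (chart_point z) = 0" if "chart_quartic z = 0" "P (chart_point z) \<noteq> 0" for z
    proof -
      have "chart_plane z \<in> chart_component" using chart_component_mem chart_plane that(1) by blast
      moreover have "chart_plane z \<in> nonvanishing P" using nonvanishing_chart_plane[OF P(1)] that(2) by simp
      ultimately have "chart_plane z \<in> B" using sub P(2) by blast
      hence "chart_plane z \<notin> nonvanishing R" using R(2) by blast
      thus ?thesis using nonvanishing_chart_plane[OF R(1)] by simp
    qed
    have "\<exists>z. chart_quartic z = 0 \<and> chart_lead z \<noteq> 0 \<and> P (chart_point z) \<noteq> 0"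
    proof (rule ccontr)
      assume "\<not> ?thesis"
      hence "P (chart_point z) = 0" if "chart_quartic z = 0" "chart_lead z \<noteq> 0" for z using that by blast
      moreover have "\<exists>z :: 'a ^ (bool \<times> 16). chart_quartic z = 0 \<and> chart_lead z \<noteq> 0 \<and> chart_lead z \<noteq> 0"
        using chart_generic_nonzero by blast
      ultimately obtain S where "\<forall>z. P (chart_point z) = chart_quartic z * S z"
        using chart.multiple_if_vanishes[OF poly(1) chart.A] by blast
      thus False using P(3,4) by simp
    qed
    then obtain S where "\<forall>z. R (chart_point z) = chart_quartic z * S z"
      using chart.multiple_if_vanishes[OF poly(2) poly(1)] prod by blast
    thus False using R(3,4) by simp
  qed
qed

lemma gr_irreducible: "irreducible_closed zariski_gr2 (grass 2 UNIV :: ('a ^ 16) set set)"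
  unfolding irreducible_closed_def
proof (intro conjI allI impI)
  show "closedin zariski_gr2 (grass 2 UNIV :: ('a ^ 16) set set)" by (simp add: closedin_gr)
  show "(grass 2 UNIV :: ('a ^ 16) set set) \<noteq> {}" using chart_plane(1) by blast
  fix A B :: "('a ^ 16) set set"
  assume A: "closedin zariski_gr2 A" and B: "closedin zariski_gr2 B" and sub: "grass 2 UNIV \<subseteq> A \<union> B"
  show "grass 2 UNIV \<subseteq> A \<or> grass 2 UNIV \<subseteq> B"
  proof (rule ccontr)
    assume "\<not> ?thesis"
    then obtain K K' where "K \<in> grass 2 UNIV - A" "K' \<in> grass 2 UNIV - B" by blast
    then obtain d P d' R where P: "P \<in> hom_poly d" "K \<in> nonvanishing P" "A \<inter> nonvanishing P = {}"
      and R: "R \<in> hom_poly d'" "K' \<in> nonvanishing R" "B \<inter> nonvanishing R = {}"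
      using A B unfolding closedin_gr by meson
    have "nonvanishing R = {}"
    proof (rule gr_domain[OF P(1) R(1) chart_form_hom])
      show "J \<notin> nonvanishing chart_form" if "J \<in> nonvanishing P" "J \<in> nonvanishing R" for J
        using that sub P(3) R(3) by (auto simp: nonvanishing_def)
      show "nonvanishing P \<noteq> {}" using P(2) by blast
      show "nonvanishing chart_form \<noteq> {}" using exists_plane_in_component by blast
    qed
    thus False using R(2) by blast
  qed
qed

text \<open>The polynomials that vanish on the part of an irreducible closed set in the chart form a prime
  ideal. If the closed set strictly contains the component, this ideal does not contain the equation
  of the quadric, but all its elements are divisible by it; so it is zero.\<close>

lemma chart_component_maximal:
  assumes Z: "irreducible_closed zariski_gr2 Z" and sub: "chart_component \<subset> Z"
  shows "Z = grass 2 UNIV"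
proof (rule ccontr)
  assume "Z \<noteq> grass 2 UNIV"
  have Z_closed: "closedin zariski_gr2 Z" using Z by (simp add: irreducible_closed_def)
  hence ZG: "Z \<subseteq> grass 2 UNIV" by (simp add: closedin_gr)
  then obtain K3 where "K3 \<in> grass 2 UNIV - Z" using \<open>Z \<noteq> grass 2 UNIV\<close> by blast
  then obtain d P where P: "P \<in> hom_poly d" "K3 \<in> nonvanishing P" "Z \<inter> nonvanishing P = {}"
    using Z_closed unfolding closedin_gr by blast
  define I where "I = {G \<in> poly_fun. \<forall>K\<in>Z. \<forall>w\<in>pluecker K. chart_form w = 1 \<longrightarrow> G w = 0}"
  have I_point: "G (chart_point z) = 0" if "G \<in> I" "chart_plane z \<in> Z" for G z
    using that chart_form_point[of z] vec.span_base[of "chart_point z" "{chart_point z}"]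
    by (auto simp: I_def chart_plane(2))
  have prime: "F \<in> I \<or> G \<in> I" if F: "F \<in> poly_fun" and G: "G \<in> poly_fun" and FG: "(\<lambda>w. F w * G w) \<in> I" for F G
  proof -
    obtain m H where H: "H \<in> hom_poly m" "\<forall>w. chart_form w = 1 \<longrightarrow> H w = F w"
      using homogenize[OF chart_form_hom F] by blast
    obtain n J where J: "J \<in> hom_poly n" "\<forall>w. chart_form w = 1 \<longrightarrow> J w = G w"
      using homogenize[OF chart_form_hom G] by blast
    \<comment> \<open>The factor \<open>chart_form\<close> makes the products vanish on the planes outside the chart.\<close>
    define H' where "H' w = H w * chart_form w" for w
    define J' where "J' w = J w * chart_form w" for w
    have H': "H' \<in> hom_poly (m + 1)" unfolding H'_def by (rule hom_poly_mult[OF H(1) chart_form_hom])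
    have J': "J' \<in> hom_poly (n + 1)" unfolding J'_def by (rule hom_poly_mult[OF J(1) chart_form_hom])
    have in_I: "G \<in> I" if G: "G \<in> poly_fun" "\<forall>w. chart_form w = 1 \<longrightarrow> J w * chart_form w = G w"
      and sub: "Z \<subseteq> grass 2 UNIV - nonvanishing (\<lambda>w. J w * chart_form w)" for G J
      unfolding I_def
    proof (intro CollectI conjI ballI impI G(1))
      fix K w assume Kw: "K \<in> Z" "w \<in> pluecker K" "chart_form w = 1"
      have "J w * chart_form w = 0" using sub ZG Kw(1,2) unfolding nonvanishing_def by blast
      thus "G w = 0" using G(2) Kw(3) by simp
    qed
    have "Z \<subseteq> (grass 2 UNIV - nonvanishing H') \<union> (grass 2 UNIV - nonvanishing J')"
    proof
      fix K assume K: "K \<in> Z"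
      hence KG: "K \<in> grass 2 UNIV" using ZG by blast
      show "K \<in> (grass 2 UNIV - nonvanishing H') \<union> (grass 2 UNIV - nonvanishing J')"
      proof (cases "K \<in> nonvanishing chart_form")
        case True
        then obtain z where z: "pluecker K = vec.span {chart_point z}" using chart_cover by blast
        have "chart_point z \<in> pluecker K" unfolding z by (rule vec.span_base) simp
        hence "F (chart_point z) * G (chart_point z) = 0"
          using FG K chart_form_point[of z] by (auto simp: I_def)
        hence "H' (chart_point z) = 0 \<or> J' (chart_point z) = 0"
          using H(2) J(2) chart_form_point[of z] by (auto simp: H'_def J'_def)
        thus ?thesis using nonvanishing_iff[OF H' KG z] nonvanishing_iff[OF J' KG z] KG by blast
      next
        case False
        hence "K \<notin> nonvanishing H'" by (auto simp: nonvanishing_def H'_def)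
        thus ?thesis using KG by blast
      qed
    qed
    hence "Z \<subseteq> grass 2 UNIV - nonvanishing H' \<or> Z \<subseteq> grass 2 UNIV - nonvanishing J'"
      by (rule irreducible_closed_union[OF Z closedin_vanishing[OF H'] closedin_vanishing[OF J']])
    thus ?thesis
    proof
      assume "Z \<subseteq> grass 2 UNIV - nonvanishing H'"
      hence "F \<in> I" unfolding H'_def using H(2) by (intro in_I[OF F, of H]) auto
      thus ?thesis ..
    next
      assume "Z \<subseteq> grass 2 UNIV - nonvanishing J'"
      hence "G \<in> I" unfolding J'_def using J(2) by (intro in_I[OF G, of J]) auto
      thus ?thesis ..
    qed
  qed
  have "\<exists>K\<in>Z. K \<in> nonvanishing chart_form \<and> K \<notin> locus"
  proof (rule ccontr)
    assume "\<not> ?thesis"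
    hence "Z \<subseteq> chart_component \<union> (grass 2 UNIV - nonvanishing chart_form)" using chart_component_cover ZG by blast
    hence "Z \<subseteq> chart_component \<or> Z \<subseteq> grass 2 UNIV - nonvanishing chart_form"
      by (rule irreducible_closed_union[OF Z chart_component_closed closedin_vanishing[OF chart_form_hom]])
    thus False using sub exists_plane_in_component by blast
  qed
  then obtain K5 where K5: "K5 \<in> Z" "K5 \<in> nonvanishing chart_form" "K5 \<notin> locus" by blast
  then obtain z5 where z5: "pluecker K5 = vec.span {chart_point z5}" using chart_cover by blast
  have "chart_plane z5 \<in> Z" by (rule closedin_same_pluecker[OF Z_closed K5(1)]) (simp_all add: chart_plane z5)
  moreover have "quadric e f (chart_point z5) \<noteq> 0"
    using locus_iff[OF _ z5] K5(1,3) ZG by (auto simp: chart_quadric)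
  ultimately have quadric_I: "quadric e f \<notin> I" using I_point by blast
  have quadric_poly: "quadric e f \<in> poly_fun" using quadric_hom_poly by (simp add: hom_poly_def)
  have divisible: "\<exists>G\<in>I. \<forall>z. P (chart_point z) = chart_quartic z ^ m * G (chart_point z)" for m
  proof (induction m)
    case 0
    have "P \<in> I" using P(1,3) ZG unfolding I_def nonvanishing_def hom_poly_def by blast
    thus ?case by auto
  next
    case (Suc m)
    then obtain G where G: "G \<in> I" "\<And>z. P (chart_point z) = chart_quartic z ^ m * G (chart_point z)" by blast
    have Gp: "G \<in> poly_fun" using G(1) by (simp add: I_def)
    have "G (chart_point z) = 0" if "chart_quartic z = 0" for z
      using I_point[OF G(1)] chart_component_mem[OF chart_plane that] sub by blast
    then obtain S where S: "S \<in> poly_fun" "\<And>z. G (chart_point z) = chart_quartic z * S z"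
      using quadric_multiple[OF Gp] by blast
    define S' where "S' w = (1 / 12) * S (chart_coord w)" for w
    have S': "S' \<in> poly_fun" unfolding S'_def by (intro poly_fun_intros chart_coord_poly S(1))
    have G_eq: "G w = quadric e f w * S' w" if "K \<in> grass 2 UNIV" "w \<in> pluecker K" "chart_form w = 1" for K w
      using S(2)[of "chart_coord w"] chart_quadric[of "chart_coord w"] chart_point_of_line[OF that]
      by (simp add: S'_def)
    have "quadric e f w * S' w = 0" if Kw: "K \<in> Z" "w \<in> pluecker K" "chart_form w = 1" for K w
    proof -
      have "G w = 0" using G(1) Kw unfolding I_def by blast
      moreover have "G w = quadric e f w * S' w" using G_eq[OF _ Kw(2,3)] Kw(1) ZG by blast
      ultimately show ?thesis by simp
    qed
    hence "(\<lambda>w. quadric e f w * S' w) \<in> I"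
      using poly_fun.mult[OF quadric_poly S'] unfolding I_def by blast
    hence "S' \<in> I" using prime[OF quadric_poly S'] quadric_I by blast
    hence "(\<lambda>w. 12 * S' w) \<in> I" unfolding I_def by (auto intro: poly_fun.intros)
    moreover have "P (chart_point z) = chart_quartic z ^ Suc m * (12 * S' (chart_point z))" for z
    proof -
      have "chart_point z \<in> pluecker (chart_plane z)" unfolding chart_plane(2) by (rule vec.span_base) simp
      hence "G (chart_point z) = quadric e f (chart_point z) * S' (chart_point z)"
        using G_eq[OF chart_plane(1)] chart_form_point by blast
      thus ?thesis unfolding G(2) by (simp add: chart_quadric)
    qed
    ultimately show ?case by (intro bexI[of _ "\<lambda>w. 12 * S' w"] allI)
  qed
  have "\<exists>B\<in>poly_fun. \<forall>z. P (chart_point z) = chart_quartic z ^ m * B z" for m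
  proof -
    obtain G where "G \<in> I" "\<forall>z. P (chart_point z) = chart_quartic z ^ m * G (chart_point z)"
      using divisible by blast
    thus ?thesis using chart_poly[of G] by (intro bexI[of _ "\<lambda>z. G (chart_point z)"]) (simp_all add: I_def)
  qed
  moreover have "(\<lambda>z. P (chart_point z)) \<in> poly_fun" using P(1) by (simp add: chart_poly hom_poly_def)
  ultimately have P0: "P (chart_point z) = 0" for z using chart.no_infinite_division by blast
  have "nonvanishing P = {}"
  proof (rule gr_domain[OF chart_form_hom P(1) chart_form_hom])
    show "K \<notin> nonvanishing chart_form" if "K \<in> nonvanishing chart_form" "K \<in> nonvanishing P" for K
    proof -
      obtain z where "pluecker K = vec.span {chart_point z}" using chart_cover[OF \<open>K \<in> nonvanishing chart_form\<close>] by blast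
      moreover have "K \<in> grass 2 UNIV" using that by (simp add: nonvanishing_def)
      ultimately show ?thesis using nonvanishing_iff[OF P(1)] P0 that(2) by blast
    qed
  qed (use exists_plane_in_component in blast)+
  thus False using P(2) by blast
qed

lemma codim_chart_component: "codim zariski_gr2 chart_component = 1"
proof (rule codim_eq_1)
  show "irreducible_closed zariski_gr2 chart_component" by (rule chart_component_irreducible)
  show "irreducible_closed zariski_gr2 (topspace zariski_gr2 :: ('a ^ 16) set set)"
    unfolding topspace_gr by (rule gr_irreducible)
  obtain z :: "'a ^ (bool \<times> 16)" where "chart_lead z = 0" "chart_rest z \<noteq> 0" using chart.R_nonzero by blast
  hence "chart_quartic z \<noteq> 0" by (simp add: chart_quartic_split)
  hence "chart_plane z \<notin> chart_component" using locus_iff[OF chart_plane] chart_component_subset by blast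
  moreover have "chart_component \<subseteq> grass 2 UNIV" unfolding chart_component_def by blast
  ultimately show "chart_component \<subset> topspace zariski_gr2"
    using chart_plane(1) unfolding topspace_gr by blast
  show "Z = topspace zariski_gr2" if "irreducible_closed zariski_gr2 Z" "chart_component \<subset> Z" for Z
    unfolding topspace_gr using chart_component_maximal[OF that] .
qed

end

context spinor_modules begin

lemma exists_frame_at:
  assumes "K \<in> grass 2 UNIV"
  shows "\<exists>e f t. frame q c c' e f t \<and> K \<in> nonvanishing (frame.chart_form c' f t)"
proof -
  obtain x y where xy: "pluecker K = vec.span {wedge x y}" "wedge x y \<noteq> 0" using grass_2_wedge[OF assms] by blast
  obtain e f t where fr: "frame q c c' e f t" and nz: "two_form (wedge x y) (c' (f 0) t) (c' (f 1) t) \<noteq> 0"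
    using frame_detects[OF wedge_in_ext2 xy(2)] by blast
  interpret frame q c c' e f t by (rule fr)
  have "K \<in> nonvanishing chart_form"
    unfolding nonvanishing_iff[OF chart_form_hom assms xy(1)] using nz by (simp add: chart_form_def)
  thus ?thesis using fr by blast
qed

text \<open>The special locus contains a nonempty open part of the quadric section in each chart. A homogeneous
  polynomial that does not vanish at \<open>K\<close> cannot vanish on this part, since it would be a multiple of the
  equation of the quadric in a chart around \<open>K\<close>.\<close>

lemma special_locus_eq:
  assumes h: "hyperbolic 5 e f"
  shows "special_locus q c c' = grass 2 UNIV - nonvanishing (quadric e f)"
proof
  have "special_locus_open q c c' \<subseteq> grass 2 UNIV - nonvanishing (quadric e f)"
  proof
    fix K assume K: "K \<in> special_locus_open q c c'"
    hence G: "K \<in> grass 2 UNIV" by (simp add: special_locus_open_def)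
    obtain x y where xy: "pluecker K = vec.span {wedge x y}" "K = vec.span {x, y}" using grass_2_wedge[OF G] by blast
    have "x \<in> K" "y \<in> K" unfolding xy(2) by (simp_all add: vec.span_base)
    hence "quadric e f (wedge x y) = 0" using special_quadric[OF K _ _ h] by blast
    thus "K \<in> grass 2 UNIV - nonvanishing (quadric e f)"
      using nonvanishing_iff[OF quadric_hom_poly G xy(1)] G by simp
  qed
  thus "special_locus q c c' \<subseteq> grass 2 UNIV - nonvanishing (quadric e f)"
    unfolding special_locus_def by (rule closure_of_minimal) (rule closedin_vanishing[OF quadric_hom_poly])
  show "grass 2 UNIV - nonvanishing (quadric e f) \<subseteq> special_locus q c c'"
  proof
    fix K assume K: "K \<in> grass 2 UNIV - nonvanishing (quadric e f)"
    hence G: "K \<in> grass 2 UNIV" by blast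
    obtain e' f' t where fr: "frame q c c' e' f' t" and Kc: "K \<in> nonvanishing (frame.chart_form c' f' t)"
      using exists_frame_at[OF G] by blast
    interpret n: frame q c c' e' f' t by (rule fr)
    obtain z where z: "pluecker K = vec.span {n.chart_point z}" using n.chart_cover[OF Kc] by blast
    have zero: "chart_quartic z = 0"
      using n.locus_iff[OF G z] K quadric_independent[OF h n.hyp] by (simp add: n.locus_def)
    show "K \<in> special_locus q c c'"
      unfolding special_locus_def in_closure_of topspace_gr
    proof (intro conjI G allI impI)
      fix T assume T: "K \<in> T \<and> openin zariski_gr2 T"
      then obtain d P where P: "P \<in> hom_poly d" "K \<in> nonvanishing P" "nonvanishing P \<subseteq> T" using openin_gr by blast
      show "\<exists>K'. K' \<in> special_locus_open q c c' \<and> K' \<in> T"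
      proof (rule ccontr)
        assume none: "\<not> ?thesis"
        have "P (n.chart_point z) = 0" if "chart_quartic z = 0" "chart_generic z \<noteq> 0" for z
        proof (rule ccontr)
          assume "P (n.chart_point z) \<noteq> 0"
          hence "n.chart_plane z \<in> T" using n.nonvanishing_chart_plane[OF P(1)] P(3) by blast
          thus False using n.chart_special[OF that] none by (auto simp: n.chart_plane_def)
        qed
        moreover have "P \<in> poly_fun" using P(1) by (simp add: hom_poly_def)
        ultimately obtain S where "\<forall>z. P (n.chart_point z) = chart_quartic z * S z" using n.quadric_multiple by blast
        hence "P (n.chart_point z) = 0" using zero by simp
        thus False using P(2) nonvanishing_iff[OF P(1) G z] by blast
      qed
    qed
  qed
qed

text \<open>An irreducible component that meets a chart is the closure of the part of the divisor in that chart.\<close>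

lemma special_locus_divisor: "divisor zariski_gr2 (special_locus q c c')"
  unfolding divisor_def
proof (intro conjI allI impI)
  obtain e f t where "vacuum_frame q c c' e f t" using exists_vacuum_frame by blast
  then obtain \<mu> where fr: "frame q c c' e f (\<mu> *s t)" using vacuum_frame.normalize by blast
  interpret frame q c c' e f "\<mu> *s t" by (rule fr)
  have eq: "special_locus q c c' = locus" unfolding locus_def by (rule special_locus_eq[OF hyp])
  show "closedin zariski_gr2 (special_locus q c c')" unfolding eq by (rule locus_closed)
  show "special_locus q c c' \<noteq> {}" unfolding eq using chart_component_subset exists_plane_in_component by blast
  fix Z assume Z: "irreducible_component_of zariski_gr2 (special_locus q c c') Z"
  hence irr: "irreducible_closed zariski_gr2 Z" and ZD: "Z \<subseteq> special_locus q c c'"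
    by (auto simp: irreducible_component_of_def)
  then obtain K where K: "K \<in> Z" by (auto simp: irreducible_closed_def)
  have "K \<in> grass 2 UNIV" using K ZD eq by (auto simp: locus_def)
  then obtain e' f' t' where fr': "frame q c c' e' f' t'" and Kc: "K \<in> nonvanishing (frame.chart_form c' f' t')"
    using exists_frame_at by blast
  interpret n: frame q c c' e' f' t' by (rule fr')
  have eq': "special_locus q c c' = n.locus" unfolding n.locus_def by (rule special_locus_eq[OF n.hyp])
  have "Z \<subseteq> n.chart_component \<union> (grass 2 UNIV - nonvanishing n.chart_form)"
    using ZD n.chart_component_cover unfolding eq' by blast
  hence "Z \<subseteq> n.chart_component"
    using irreducible_closed_union[OF irr n.chart_component_closed closedin_vanishing[OF n.chart_form_hom]] K Kc by blast
  moreover have "n.chart_component \<subseteq> special_locus q c c'" unfolding eq' by (rule n.chart_component_subset)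
  ultimately have "Z = n.chart_component"
    using Z n.chart_component_irreducible unfolding irreducible_component_of_def by blast
  thus "codim zariski_gr2 Z = 1" using n.codim_chart_component by simp
qed

lemma special_locus_cut_out:
  assumes h: "hyperbolic 5 e f"
  shows "cut_out ext2 (pluecker ` grass 2 UNIV) (pluecker ` special_locus q c c') (quadric e f)"
  unfolding cut_out_def
proof
  fix p assume "p \<in> proj (ext2 :: ('k ^ (16 \<times> 16)) set)"
  then obtain w where w: "w \<noteq> 0" "p = vec.span {w}" "p \<subseteq> ext2" by (auto simp: proj_iff)
  have wp: "w \<in> p" unfolding w(2) by (rule vec.span_base) simp
  obtain e' f' t where fr: "frame q c c' e' f' t" and nz: "two_form w (c' (f' 0) t) (c' (f' 1) t) \<noteq> 0"
    using frame_detects[of w] w wp by blast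
  interpret n: frame q c c' e' f' t by (rule fr)
  have eq: "quadric e f = quadric e' f'" by (rule quadric_independent[OF h n.hyp])
  have loc: "special_locus q c c' = n.locus" unfolding n.locus_def by (rule special_locus_eq[OF n.hyp])
  show "\<exists>l. Vector_Spaces.linear (*s) (*) l \<and> (\<exists>w\<in>p. l w \<noteq> 0) \<and>
      (\<forall>P\<in>poly_fun. (\<forall>w\<in>\<Union> (pluecker ` special_locus q c c'). l w = 1 \<longrightarrow> P w = 0) \<longleftrightarrow>
        (\<exists>B\<in>poly_fun. \<forall>w\<in>\<Union> (pluecker ` grass 2 UNIV). l w = 1 \<longrightarrow> P w = quadric e f w * B w))"
  proof (intro exI[of _ n.chart_form] conjI ballI iffI)
    show "Vector_Spaces.linear (*s) (*) n.chart_form" by (rule n.chart_form_linear)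
    show "\<exists>w\<in>p. n.chart_form w \<noteq> 0" using wp nz by (auto simp: n.chart_form_def)
  next
    fix P :: "'k ^ (16 \<times> 16) \<Rightarrow> 'k"
    assume P: "P \<in> poly_fun" and vanish: "\<forall>w\<in>\<Union> (pluecker ` special_locus q c c'). n.chart_form w = 1 \<longrightarrow> P w = 0"
    have "P (n.chart_point z) = 0" if "chart_quartic z = 0" for z
    proof -
      have "n.chart_plane z \<in> n.locus" using n.locus_iff[OF n.chart_plane] that by blast
      moreover have "n.chart_point z \<in> pluecker (n.chart_plane z)"
        unfolding n.chart_plane(2) by (rule vec.span_base) simp
      ultimately show ?thesis using vanish n.chart_form_point unfolding loc by blast
    qed
    then obtain S where S: "S \<in> poly_fun" "\<And>z. P (n.chart_point z) = chart_quartic z * S z"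
      using n.quadric_multiple[OF P] by blast
    have "(\<lambda>w. (1 / 12) * S (n.chart_coord w)) \<in> poly_fun" by (intro poly_fun_intros n.chart_coord_poly S(1))
    moreover have "P w = quadric e f w * ((1 / 12) * S (n.chart_coord w))"
      if wl: "w \<in> \<Union> (pluecker ` grass 2 UNIV)" "n.chart_form w = 1" for w
    proof -
      obtain K where "K \<in> grass 2 UNIV" "w \<in> pluecker K" using wl(1) by blast
      hence "n.chart_point (n.chart_coord w) = w" using n.chart_point_of_line wl(2) by blast
      hence "P w = chart_quartic (n.chart_coord w) * S (n.chart_coord w)"
        and "quadric e f w = 12 * chart_quartic (n.chart_coord w)"
        using S(2)[of "n.chart_coord w"] n.chart_quadric[of "n.chart_coord w"] by (simp_all add: eq)
      thus ?thesis by simp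
    qed
    ultimately show "\<exists>B\<in>poly_fun. \<forall>w\<in>\<Union> (pluecker ` grass 2 UNIV). n.chart_form w = 1 \<longrightarrow> P w = quadric e f w * B w"
      by (intro bexI[of _ "\<lambda>w. (1 / 12) * S (n.chart_coord w)"] ballI impI)
  next
    fix P :: "'k ^ (16 \<times> 16) \<Rightarrow> 'k" and w
    assume "\<exists>B\<in>poly_fun. \<forall>w\<in>\<Union> (pluecker ` grass 2 UNIV). n.chart_form w = 1 \<longrightarrow> P w = quadric e f w * B w"
    then obtain S where S: "\<forall>w\<in>\<Union> (pluecker ` grass 2 UNIV). n.chart_form w = 1 \<longrightarrow> P w = quadric e f w * S w" by blast
    assume "w \<in> \<Union> (pluecker ` special_locus q c c')"
    then obtain K where K: "K \<in> special_locus q c c'" "w \<in> pluecker K" by blast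
    show "n.chart_form w = 1 \<longrightarrow> P w = 0"
    proof
      assume l: "n.chart_form w = 1"
      have "K \<in> grass 2 UNIV - nonvanishing (quadric e f)" using K(1) special_locus_eq[OF h] by simp
      hence "K \<in> grass 2 UNIV" "quadric e f w = 0" using K(2) by (auto simp: nonvanishing_def)
      moreover from this have "P w = quadric e f w * S w" using S K(2) l by blast
      ultimately show "P w = 0" by simp
    qed
  qed
qed

end

theorem lemma6p20:
  fixes q :: "'k::{alg_closed_field, field_char_0} ^ 10 \<Rightarrow> 'k"
    and c c' :: "'k ^ 10 \<Rightarrow> 'k ^ 16 \<Rightarrow> 'k ^ 16"
  assumes "nondegenerate_quadratic_form q"
    and "half_spinor_modules q c c'"
  shows "divisor zariski_gr2 (special_locus q c c') \<and>
    (\<exists>Q. smooth_quadric ext2 Q \<and>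
      cut_out ext2 (pluecker ` grass 2 UNIV) (pluecker ` special_locus q c c') Q)"
proof -
  interpret spinor_modules q c c' using assms by unfold_locales
  obtain e f where h: "hyperbolic 5 e f" using exists_hyperbolic by blast
  show ?thesis using special_locus_divisor quadric_smooth[OF h] special_locus_cut_out[OF h] by blast
qed

end
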